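(* (Continuous omitting types.) Assume that there is a countable set of continuous formulas which is c-dense modulo $T$. Let $A$ be a countable subset of the home sort of $\mathcal{U}$ and let $p(x)$ be a set of continuous formulas with parameters from $A$ which is not approximately c-isolated by $A$. Then there is a c-model $M$ containing $A$ such that $\mathrm{Ccl}(M)$ omits $p(x)$, i.e. there is no tuple $a$ from $\mathrm{Ccl}(M)$ with $\mathcal{U}\models p(a)$.
   Context: Fix a compact Hausdorff space $S$. $\mathcal{L}_{\sf S}$ is the first-order language having a relation symbol for every compact $C\subseteq S^n$ ($n\ge 1$) and a function symbol for every continuous $f:S^n\to S$ (in particular a constant for each point of $S$); $S$ is an $\mathcal{L}_{\sf S}$-structure in the obvious way. $\mathcal{L}_{\sf H}$ is a fixed first-order language. $\mathcal{L}$ is a two-sorted language, with sorts ${\sf H}$ (home sort) and ${\sf S}$, expanding $\mathcal{L}_{\sf H}$ on ${\sf H}$ and $\mathcal{L}_{\sf S}$ on ${\sf S}$, possibly with further function symbols of sorts ${\sf H}^n\times{\sf S}^m\to{\sf S}$, and with a relation symbol $r_\varphi(x)$ for every $\mathcal{L}_{\sf H}$-formula $\varphi(x)$. An $\mathcal{L}$-structure is a two-sorted structure of signature $\mathcal{L}$ satisfying $r_\varphi(x)\leftrightarrow\varphi(x)$ for all $\varphi\in\mathcal{L}_{\sf H}$, in which every function symbol $f$ of sort ${\sf H}^n\times{\sf S}^m\to{\sf S}$ is equicontinuous: for every compact neighbourhood $\varepsilon$ of the diagonal of $S^2$ there is a compact neighbourhood $\delta$ of the diagonal of $(S^m)^2$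 such that $\forall x\,\forall\eta,\eta'\,(\langle\eta,\eta'\rangle\in\delta\to\langle f(x,\eta),f(x,\eta')\rangle\in\varepsilon)$ holds. A standard structure is an $\mathcal{L}$-structure $\langle M,S\rangle$ whose ${\sf S}$-sort is $S$ itself with its canonical interpretation of $\mathcal{L}_{\sf S}$; it is identified with $M$. Up to equivalence, atomic formulas are $r_\varphi(x)$ and $\tau(x;\eta)\in C$ with $\tau$ an $n$-tuple of terms of sort ${\sf S}$ and $C\subseteq S^n$ compact. A formula is positive if built from atomic formulas using only $\wedge,\vee$ and $\forall,\exists$ of both sorts; it is continuous if it is positive and all its atomic subformulas are of the form $\tau\in C$. Weakenings: for compact $C,C'\subseteq S^n$ write $C'>C$ if $C'$ is a neighbourhood of $C$; write $\varphi'>\varphi$ if $\varphi'$ is obtained from $\varphi$ by replacing each atomic subformula $\tau\in C$ by $\tau\in C'$ for some $C'>C$. $\mathcal{U}$ is a fixed large standard structure that is p-saturated: it realizes every set of positive formulas with fewer than $|\mathcal{U}|$ parameters from $\mathcal{U}$ that is finitely consistent in $\mathcal{U}$. $T$ is the set of positive sentences true in $\mathcal{U}$. A set $\mathcal{H}$ of formulas is c-dense modulo $T$ if for every continuous formula $\varphi(x)$ and every $\varphi'>\varphi$ there is $\psi(x)\in\mathcal{H}$ with $\varphi\to\psi\to\varphi'$ in every standard model of $T$. A c-model is a subset $M$ of the home sort of $\mathcal{U}$ closed under the function symbols of sort ${\sf H}^n\to{\sf H}$ such that $M\models\varphi(a)$ implies $\mathcal{U}\models\varphi(a)$ for every continuous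 formula $\varphi(x)$ and every tuple $a$ from $M$ (and $S$). For a finite tuple $x$ of ${\sf H}$-variables, a tuple $\tau=\langle\tau_1(x,z),\dots,\tau_n(x,z)\rangle$ of terms of sort ${\sf H}^{|x|+|z|}\to{\sf S}$ and a compact neighbourhood $D$ of the diagonal of $S^2$, $x\sim_{\tau,D}y$ is the formula $\bigwedge_{i=1}^n\forall z\,\langle\tau_i(x,z),\tau_i(y,z)\rangle\in D$; $\mathcal{E}$ is the set of all pairs $\varepsilon=(\tau,D)$ and $x\sim_\varepsilon y$ denotes $x\sim_{\tau,D}y$. For $a\in\mathcal{U}$, $a\sim'x$ is the set of all formulas $a\sim_\varepsilon x$ ($x$ a single variable), and $\mathrm{Ccl}(M)$ is the set of $a\in\mathcal{U}$ such that every finite conjunction of formulas in $a\sim'x$ is satisfied by some element of $M$. A set $p(x)$ of continuous formulas with parameters is approximately c-isolated by a set $B$ if for every $\varepsilon\in\mathcal{E}$ there is a continuous formula $\varphi_\varepsilon(x)$ with parameters from $B$ such that $\{\neg\varphi_\varepsilon(x)\}\cup p(x)$ is realized in $\mathcal{U}$, and every $b\in\mathcal{U}^{|x|}$ with $\mathcal{U}\models\neg\varphi_\varepsilon(b)$ satisfies $b\sim_\varepsilon a$ for some $a$ realizing $p(x)$. *)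

theory Defs
  imports "HOL-Analysis.Analysis"
begin

text \<open>
  The compact Hausdorff space \<open>S\<close> is a type \<open>'s\<close> of class \<open>t2_space\<close> whose universe is compact.
  Points of \<open>S\<^sup>n\<close> are the extensional functions on \<open>{..<n}\<close>.
\<close>

definition Spow :: "nat \<Rightarrow> (nat \<Rightarrow> 's::t2_space) topology" where
  "Spow n = product_topology (\<lambda>_. euclidean) {..<n}"

definition tup :: "'s list \<Rightarrow> nat \<Rightarrow> 's" where
  "tup xs = restrict (nth xs) {..<length xs}"

definition compact_nbhd :: "'a topology \<Rightarrow> 'a set \<Rightarrow> 'a set \<Rightarrow> bool" where
  "compact_nbhd T K N \<longleftrightarrow> compactin T N \<and> (\<exists>V. openin T V \<and> K \<subseteq> V \<and> V \<subseteq> N)"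

definition compact_nbhd_diag :: "'a topology \<Rightarrow> ('a \<times> 'a) set \<Rightarrow> bool" where
  "compact_nbhd_diag T D \<longleftrightarrow> compact_nbhd (prod_topology T T) {(x, x) |x. x \<in> topspace T} D"

definition tuples :: "nat \<Rightarrow> 'a set \<Rightarrow> 'a list set" where
  "tuples n X = {a. length a = n \<and> set a \<subseteq> X}"


section \<open>Languages and standard structures\<close>

text \<open>
  \<open>hfuns\<close> and \<open>hrels\<close> are the symbols of the home language, \<open>sfuns\<close> the further function symbols
  of sort \<open>H\<^sup>n \<times> S\<^sup>m \<rightarrow> S\<close>, with \<open>sfun_ar\<close> giving \<open>(n, m)\<close>. The symbols for compact sets and
  continuous functions need not be listed: they are the sets and functions themselves.
\<close>

record ('f, 'r, 'g) lang =
  hfuns :: "'f set"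
  hfun_ar :: "'f \<Rightarrow> nat"
  hrels :: "'r set"
  hrel_ar :: "'r \<Rightarrow> nat"
  sfuns :: "'g set"
  sfun_ar :: "'g \<Rightarrow> nat \<times> nat"

text \<open>The \<open>S\<close>-sort of a standard structure is the whole type \<open>'s\<close>; only the home sort has a carrier.\<close>

record ('f, 'r, 'g, 'm, 's) struct =
  hdom :: "'m set"
  hfun :: "'f \<Rightarrow> 'm list \<Rightarrow> 'm"
  hrel :: "'r \<Rightarrow> 'm list \<Rightarrow> bool"
  sfun :: "'g \<Rightarrow> 'm list \<Rightarrow> (nat \<Rightarrow> 's) \<Rightarrow> 's"

definition hclosed ::
  "('f, 'r, 'g) lang \<Rightarrow> ('f, 'r, 'g, 'm, 's) struct \<Rightarrow> 'm set \<Rightarrow> bool" where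
  "hclosed L U M \<longleftrightarrow> (\<forall>f\<in>hfuns L. \<forall>a\<in>tuples (hfun_ar L f) M. hfun U f a \<in> M)"

definition equicontinuous ::
  "('f, 'r, 'g) lang \<Rightarrow> ('f, 'r, 'g, 'm, 's::t2_space) struct \<Rightarrow> 'g \<Rightarrow> bool" where
  "equicontinuous L U g \<longleftrightarrow>
     (\<forall>E. compact_nbhd_diag euclidean E \<longrightarrow>
       (\<exists>D. compact_nbhd_diag (Spow (snd (sfun_ar L g))) D \<and>
         (\<forall>a\<in>tuples (fst (sfun_ar L g)) (hdom U). \<forall>s s'.
            (s, s') \<in> D \<longrightarrow> (sfun U g a s, sfun U g a s') \<in> E)))"

definition standard_structure ::
  "('f, 'r, 'g) lang \<Rightarrow> ('f, 'r, 'g, 'm, 's::t2_space) struct \<Rightarrow> bool" where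
  "standard_structure L U \<longleftrightarrow>
     hdom U \<noteq> {} \<and> hclosed L U (hdom U) \<and> (\<forall>g\<in>sfuns L. equicontinuous L U g)"


section \<open>Terms and positive formulas\<close>

text \<open>
  Variables of each sort are de Bruijn indices into a list of values: index \<open>i\<close> of a formula
  \<open>\<phi>(x; \<eta>)\<close> that is not captured by a quantifier refers to the \<open>i\<close>-th entry of the tuple \<open>x\<close>
  (respectively \<open>\<eta>\<close>). \<open>HPar a\<close> is a parameter from the home sort; parameters from \<open>S\<close>
  are constants of the language, i.e.\ 0-ary continuous functions.
\<close>

datatype ('f, 'm) hterm =
    HVar nat
  | HPar 'm
  | HApp 'f "('f, 'm) hterm list"

datatype ('f, 'g, 'm, 's) sterm =
    SVar nat
  | SCont "(nat \<Rightarrow> 's) \<Rightarrow> 's" "('f, 'g, 'm, 's) sterm list"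
  | SApp 'g "('f, 'm) hterm list" "('f, 'g, 'm, 's) sterm list"

datatype ('f, 'r, 'm) hform =
    HEq "('f, 'm) hterm" "('f, 'm) hterm"
  | HRel 'r "('f, 'm) hterm list"
  | HNot "('f, 'r, 'm) hform"
  | HAnd "('f, 'r, 'm) hform" "('f, 'r, 'm) hform"
  | HEx "('f, 'r, 'm) hform"

text \<open>
  \<open>Rel \<phi>\<close> is the atomic formula \<open>r\<^sub>\<phi>\<close>; the axiom \<open>r\<^sub>\<phi> \<leftrightarrow> \<phi>\<close>, which all structures satisfy,
  is built into its semantics. \<open>In \<tau> C\<close> is the atomic formula \<open>\<tau> \<in> C\<close>.
\<close>

datatype ('f, 'r, 'g, 'm, 's) pform =
    Rel "('f, 'r, 'm) hform"
  | In "('f, 'g, 'm, 's) sterm list" "(nat \<Rightarrow> 's) set"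
  | And "('f, 'r, 'g, 'm, 's) pform" "('f, 'r, 'g, 'm, 's) pform"
  | Or "('f, 'r, 'g, 'm, 's) pform" "('f, 'r, 'g, 'm, 's) pform"
  | AllH "('f, 'r, 'g, 'm, 's) pform"
  | ExH "('f, 'r, 'g, 'm, 's) pform"
  | AllS "('f, 'r, 'g, 'm, 's) pform"
  | ExS "('f, 'r, 'g, 'm, 's) pform"

text \<open>
  Well-formedness. \<open>B\<close> is the set of parameters allowed, \<open>n\<close> and \<open>m\<close> are the lengths of the
  tuples of free variables of sort \<open>H\<close> and \<open>S\<close>.
\<close>

fun hterm_in :: "('f, 'r, 'g) lang \<Rightarrow> 'm set \<Rightarrow> nat \<Rightarrow> ('f, 'm) hterm \<Rightarrow> bool" where
  "hterm_in L B n (HVar i) \<longleftrightarrow> i < n"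
| "hterm_in L B n (HPar a) \<longleftrightarrow> a \<in> B"
| "hterm_in L B n (HApp f ts) \<longleftrightarrow>
     f \<in> hfuns L \<and> length ts = hfun_ar L f \<and> (\<forall>t\<in>set ts. hterm_in L B n t)"

fun sterm_in ::
  "('f, 'r, 'g) lang \<Rightarrow> 'm set \<Rightarrow> nat \<Rightarrow> nat \<Rightarrow> ('f, 'g, 'm, 's::t2_space) sterm \<Rightarrow> bool" where
  "sterm_in L B n m (SVar i) \<longleftrightarrow> i < m"
| "sterm_in L B n m (SCont f ts) \<longleftrightarrow>
     continuous_map (Spow (length ts)) euclidean f \<and> (\<forall>t\<in>set ts. sterm_in L B n m t)"
| "sterm_in L B n m (SApp g us ts) \<longleftrightarrow>
     g \<in> sfuns L \<and> sfun_ar L g = (length us, length ts) \<and>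
     (\<forall>u\<in>set us. hterm_in L B n u) \<and> (\<forall>t\<in>set ts. sterm_in L B n m t)"

fun hform_in :: "('f, 'r, 'g) lang \<Rightarrow> 'm set \<Rightarrow> nat \<Rightarrow> ('f, 'r, 'm) hform \<Rightarrow> bool" where
  "hform_in L B n (HEq t u) \<longleftrightarrow> hterm_in L B n t \<and> hterm_in L B n u"
| "hform_in L B n (HRel r ts) \<longleftrightarrow>
     r \<in> hrels L \<and> length ts = hrel_ar L r \<and> (\<forall>t\<in>set ts. hterm_in L B n t)"
| "hform_in L B n (HNot \<phi>) \<longleftrightarrow> hform_in L B n \<phi>"
| "hform_in L B n (HAnd \<phi> \<psi>) \<longleftrightarrow> hform_in L B n \<phi> \<and> hform_in L B n \<psi>"
| "hform_in L B n (HEx \<phi>) \<longleftrightarrow> hform_in L B (Suc n) \<phi>"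

fun positive ::
  "('f, 'r, 'g) lang \<Rightarrow> 'm set \<Rightarrow> nat \<Rightarrow> nat \<Rightarrow> ('f, 'r, 'g, 'm, 's::t2_space) pform \<Rightarrow> bool" where
  "positive L B n m (Rel \<phi>) \<longleftrightarrow> hform_in L B n \<phi>"
| "positive L B n m (In ts C) \<longleftrightarrow>
     ts \<noteq> [] \<and> compactin (Spow (length ts)) C \<and> (\<forall>t\<in>set ts. sterm_in L B n m t)"
| "positive L B n m (And \<phi> \<psi>) \<longleftrightarrow> positive L B n m \<phi> \<and> positive L B n m \<psi>"
| "positive L B n m (Or \<phi> \<psi>) \<longleftrightarrow> positive L B n m \<phi> \<and> positive L B n m \<psi>"
| "positive L B n m (AllH \<phi>) \<longleftrightarrow> positive L B (Suc n) m \<phi>"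
| "positive L B n m (ExH \<phi>) \<longleftrightarrow> positive L B (Suc n) m \<phi>"
| "positive L B n m (AllS \<phi>) \<longleftrightarrow> positive L B n (Suc m) \<phi>"
| "positive L B n m (ExS \<phi>) \<longleftrightarrow> positive L B n (Suc m) \<phi>"

fun no_Rel :: "('f, 'r, 'g, 'm, 's) pform \<Rightarrow> bool" where
  "no_Rel (Rel \<phi>) \<longleftrightarrow> False"
| "no_Rel (In ts C) \<longleftrightarrow> True"
| "no_Rel (And \<phi> \<psi>) \<longleftrightarrow> no_Rel \<phi> \<and> no_Rel \<psi>"
| "no_Rel (Or \<phi> \<psi>) \<longleftrightarrow> no_Rel \<phi> \<and> no_Rel \<psi>"
| "no_Rel (AllH \<phi>) \<longleftrightarrow> no_Rel \<phi>"
| "no_Rel (ExH \<phi>) \<longleftrightarrow> no_Rel \<phi>"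
| "no_Rel (AllS \<phi>) \<longleftrightarrow> no_Rel \<phi>"
| "no_Rel (ExS \<phi>) \<longleftrightarrow> no_Rel \<phi>"

definition continuous_form ::
  "('f, 'r, 'g) lang \<Rightarrow> 'm set \<Rightarrow> nat \<Rightarrow> nat \<Rightarrow> ('f, 'r, 'g, 'm, 's::t2_space) pform \<Rightarrow> bool" where
  "continuous_form L B n m \<phi> \<longleftrightarrow> positive L B n m \<phi> \<and> no_Rel \<phi>"

text \<open>\<open>weakening \<phi> \<phi>'\<close> is \<open>\<phi>' > \<phi>\<close>.\<close>

inductive weakening ::
  "('f, 'r, 'g, 'm, 's::t2_space) pform \<Rightarrow> ('f, 'r, 'g, 'm, 's) pform \<Rightarrow> bool" where
  "weakening (Rel \<phi>) (Rel \<phi>)"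
| "compact_nbhd (Spow (length ts)) C C' \<Longrightarrow> weakening (In ts C) (In ts C')"
| "weakening \<phi> \<phi>' \<Longrightarrow> weakening \<psi> \<psi>' \<Longrightarrow> weakening (And \<phi> \<psi>) (And \<phi>' \<psi>')"
| "weakening \<phi> \<phi>' \<Longrightarrow> weakening \<psi> \<psi>' \<Longrightarrow> weakening (Or \<phi> \<psi>) (Or \<phi>' \<psi>')"
| "weakening \<phi> \<phi>' \<Longrightarrow> weakening (AllH \<phi>) (AllH \<phi>')"
| "weakening \<phi> \<phi>' \<Longrightarrow> weakening (ExH \<phi>) (ExH \<phi>')"
| "weakening \<phi> \<phi>' \<Longrightarrow> weakening (AllS \<phi>) (AllS \<phi>')"
| "weakening \<phi> \<phi>' \<Longrightarrow> weakening (ExS \<phi>) (ExS \<phi>')"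


section \<open>Satisfaction\<close>

fun heval :: "('f, 'r, 'g, 'm, 's) struct \<Rightarrow> 'm list \<Rightarrow> ('f, 'm) hterm \<Rightarrow> 'm" where
  "heval U a (HVar i) = a ! i"
| "heval U a (HPar b) = b"
| "heval U a (HApp f ts) = hfun U f (map (heval U a) ts)"

fun seval ::
  "('f, 'r, 'g, 'm, 's) struct \<Rightarrow> 'm list \<Rightarrow> 's list \<Rightarrow> ('f, 'g, 'm, 's) sterm \<Rightarrow> 's" where
  "seval U a s (SVar i) = s ! i"
| "seval U a s (SCont f ts) = f (tup (map (seval U a s) ts))"
| "seval U a s (SApp g us ts) = sfun U g (map (heval U a) us) (tup (map (seval U a s) ts))"

fun hsat :: "('f, 'r, 'g, 'm, 's) struct \<Rightarrow> 'm list \<Rightarrow> ('f, 'r, 'm) hform \<Rightarrow> bool" where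
  "hsat U a (HEq t u) \<longleftrightarrow> heval U a t = heval U a u"
| "hsat U a (HRel r ts) \<longleftrightarrow> hrel U r (map (heval U a) ts)"
| "hsat U a (HNot \<phi>) \<longleftrightarrow> \<not> hsat U a \<phi>"
| "hsat U a (HAnd \<phi> \<psi>) \<longleftrightarrow> hsat U a \<phi> \<and> hsat U a \<psi>"
| "hsat U a (HEx \<phi>) \<longleftrightarrow> (\<exists>b\<in>hdom U. hsat U (b # a) \<phi>)"

fun sat ::
  "('f, 'r, 'g, 'm, 's) struct \<Rightarrow> 'm list \<Rightarrow> 's list \<Rightarrow> ('f, 'r, 'g, 'm, 's) pform \<Rightarrow> bool" where
  "sat U a s (Rel \<phi>) \<longleftrightarrow> hsat U a \<phi>"
| "sat U a s (In ts C) \<longleftrightarrow> tup (map (seval U a s) ts) \<in> C"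
| "sat U a s (And \<phi> \<psi>) \<longleftrightarrow> sat U a s \<phi> \<and> sat U a s \<psi>"
| "sat U a s (Or \<phi> \<psi>) \<longleftrightarrow> sat U a s \<phi> \<or> sat U a s \<psi>"
| "sat U a s (AllH \<phi>) \<longleftrightarrow> (\<forall>b\<in>hdom U. sat U (b # a) s \<phi>)"
| "sat U a s (ExH \<phi>) \<longleftrightarrow> (\<exists>b\<in>hdom U. sat U (b # a) s \<phi>)"
| "sat U a s (AllS \<phi>) \<longleftrightarrow> (\<forall>c. sat U a (c # s) \<phi>)"
| "sat U a s (ExS \<phi>) \<longleftrightarrow> (\<exists>c. sat U a (c # s) \<phi>)"

definition realizes ::
  "('f, 'r, 'g, 'm, 's) struct \<Rightarrow> 'm list \<Rightarrow> ('f, 'r, 'g, 'm, 's) pform set \<Rightarrow> bool" where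
  "realizes U a p \<longleftrightarrow> (\<forall>\<phi>\<in>p. sat U a [] \<phi>)"


section \<open>Saturation, density and c-models\<close>

definition p_saturated ::
  "('f, 'r, 'g) lang \<Rightarrow> ('f, 'r, 'g, 'm, 's::t2_space) struct \<Rightarrow> bool" where
  "p_saturated L U \<longleftrightarrow>
     (\<forall>B n m q. B \<subseteq> hdom U \<and> B \<prec> hdom U \<and> (\<forall>\<phi>\<in>q. positive L B n m \<phi>) \<and>
        (\<forall>q0. finite q0 \<and> q0 \<subseteq> q \<longrightarrow>
           (\<exists>a\<in>tuples n (hdom U). \<exists>s\<in>tuples m UNIV. \<forall>\<phi>\<in>q0. sat U a s \<phi>))
        \<longrightarrow> (\<exists>a\<in>tuples n (hdom U). \<exists>s\<in>tuples m UNIV. \<forall>\<phi>\<in>q. sat U a s \<phi>))"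

definition Th :: "('f, 'r, 'g) lang \<Rightarrow> ('f, 'r, 'g, 'm, 's::t2_space) struct
    \<Rightarrow> ('f, 'r, 'g, 'm, 's) pform set" where
  "Th L U = {\<phi>. positive L {} 0 0 \<phi> \<and> sat U [] [] \<phi>}"

definition standard_model :: "('f, 'r, 'g) lang \<Rightarrow> ('f, 'r, 'g, 'm, 's::t2_space) pform set
    \<Rightarrow> ('f, 'r, 'g, 'm, 's) struct \<Rightarrow> bool" where
  "standard_model L T N \<longleftrightarrow> standard_structure L N \<and> (\<forall>\<phi>\<in>T. sat N [] [] \<phi>)"

definition c_dense :: "('f, 'r, 'g) lang \<Rightarrow> ('f, 'r, 'g, 'm, 's::t2_space) pform set
    \<Rightarrow> ('f, 'r, 'g, 'm, 's) pform set \<Rightarrow> bool" where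
  "c_dense L T \<H> \<longleftrightarrow>
     (\<forall>n \<phi> \<phi>'. continuous_form L {} n 0 \<phi> \<and> weakening \<phi> \<phi>' \<longrightarrow>
        (\<exists>\<psi>\<in>\<H>. positive L {} n 0 \<psi> \<and>
           (\<forall>N. standard_model L T N \<longrightarrow>
              (\<forall>a\<in>tuples n (hdom N).
                 (sat N a [] \<phi> \<longrightarrow> sat N a [] \<psi>) \<and> (sat N a [] \<psi> \<longrightarrow> sat N a [] \<phi>')))))"

text \<open>
  The structure \<open>\<langle>M, S\<rangle>\<close> is \<open>U\<lparr>hdom := M\<rparr>\<close>; the relations on the home sort are irrelevant for
  continuous formulas.
\<close>

definition c_model ::
  "('f, 'r, 'g) lang \<Rightarrow> ('f, 'r, 'g, 'm, 's::t2_space) struct \<Rightarrow> 'm set \<Rightarrow> bool" where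
  "c_model L U M \<longleftrightarrow>
     M \<subseteq> hdom U \<and> hclosed L U M \<and>
     (\<forall>n m \<phi>. continuous_form L {} n m \<phi> \<longrightarrow>
        (\<forall>a\<in>tuples n M. \<forall>s\<in>tuples m UNIV. sat (U\<lparr>hdom := M\<rparr>) a s \<phi> \<longrightarrow> sat U a s \<phi>))"


section \<open>The relations \<open>\<sim>\<^sub>\<epsilon>\<close>, closure and isolation\<close>

text \<open>
  An index \<open>\<epsilon> = (\<tau>, D)\<close> for tuples \<open>x\<close> of length \<open>n\<close> is encoded as \<open>(k, \<tau>, D)\<close>, where \<open>k\<close> is the
  length of the tuple \<open>z\<close> and the terms \<open>\<tau>\<^sub>i(x, z)\<close> are evaluated at the concatenated tuple.
\<close>

definition indices :: "('f, 'r, 'g) lang \<Rightarrow> nat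
    \<Rightarrow> (nat \<times> ('f, 'g, 'm, 's::t2_space) sterm list \<times> ('s \<times> 's) set) set" where
  "indices L n =
     {(k, \<tau>, D). (\<forall>t\<in>set \<tau>. sterm_in L {} (n + k) 0 t) \<and> compact_nbhd_diag euclidean D}"

fun near :: "('f, 'r, 'g, 'm, 's) struct
    \<Rightarrow> nat \<times> ('f, 'g, 'm, 's) sterm list \<times> ('s \<times> 's) set \<Rightarrow> 'm list \<Rightarrow> 'm list \<Rightarrow> bool" where
  "near U (k, \<tau>, D) a b \<longleftrightarrow>
     (\<forall>t\<in>set \<tau>. \<forall>z\<in>tuples k (hdom U). (seval U (a @ z) [] t, seval U (b @ z) [] t) \<in> D)"

definition Ccl ::
  "('f, 'r, 'g) lang \<Rightarrow> ('f, 'r, 'g, 'm, 's::t2_space) struct \<Rightarrow> 'm set \<Rightarrow> 'm set" where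
  "Ccl L U M =
     {a \<in> hdom U. \<forall>F. finite F \<and> F \<subseteq> indices L 1 \<longrightarrow> (\<exists>b\<in>M. \<forall>\<epsilon>\<in>F. near U \<epsilon> [a] [b])}"

definition approx_c_isolated :: "('f, 'r, 'g) lang \<Rightarrow> ('f, 'r, 'g, 'm, 's::t2_space) struct
    \<Rightarrow> nat \<Rightarrow> ('f, 'r, 'g, 'm, 's) pform set \<Rightarrow> 'm set \<Rightarrow> bool" where
  "approx_c_isolated L U n p B \<longleftrightarrow>
     (\<forall>\<epsilon>\<in>indices L n. \<exists>\<phi>. continuous_form L B n 0 \<phi> \<and>
        (\<exists>a\<in>tuples n (hdom U). \<not> sat U a [] \<phi> \<and> realizes U a p) \<and>
        (\<forall>b\<in>tuples n (hdom U). \<not> sat U b [] \<phi> \<longrightarrow>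
           (\<exists>a\<in>tuples n (hdom U). realizes U a p \<and> near U \<epsilon> b a)))"

end

theory Submission
  imports Defs
begin

text \<open>
  Negations \<open>\<not> \<phi>\<close> of continuous formulas over \<open>A\<close> are treated as basic open sets of a space of
  sequences \<open>b\<^sub>0, b\<^sub>1, \<dots>\<close> of \<open>\<U>\<close>. If \<open>\<not> \<phi>(b)\<close>, then \<open>\<not> \<phi>'(b)\<close> for some \<open>\<phi>' > \<phi>\<close>, and between \<open>\<not> \<phi>'\<close> and
  \<open>\<not> \<phi>\<close> there is a continuous formula; with saturation this gives a Baire category theorem for that space.

  A sequence generic for countably many dense open sets contains, for every formula \<open>\<psi>\<close> of the
  countable c-dense set and all parameters \<open>c\<close> from \<open>A\<close> and the sequence, infinitely many solutions
  of \<open>\<not> \<psi>(x, c)\<close> if there are any in \<open>\<U>\<close>. Failure of isolation yields one \<open>\<epsilon>\<close> such that moreover no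
  tuple of entries with distinct indices is \<open>\<epsilon>\<close>-near a realization of \<open>p\<close>: if \<open>\<not> \<theta>\<close> were contained in the
  \<open>\<epsilon>\<close>-neighbourhood of \<open>p\<close>, then the formula \<open>\<forall>y. \<theta>(y) \<or> y \<nsim> x\<close> would isolate \<open>p\<close> at a coarser scale.

  Continuous formulas are uniformly continuous for \<open>\<sim>\<^sub>\<epsilon>\<close>: by saturation this follows from the fact that
  elements which are near for all \<open>\<epsilon>\<close> give the same value to all terms. Hence both properties pass
  to the closure of the sequence, which is the required c-model.
\<close>

section \<open>Compact neighbourhoods\<close>

text \<open>Saturation speaks only of positive formulas, that is of closed conditions, while
  omission and failure of isolation concern negations. Each passage between the two costs a
  weakening or a coarser \<epsilon>, and the constructions below leave room for that loss in
  advance.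

  Omission is forced only along distinct indices. On such coordinates a condition projects to a
  formula in n independent variables, to which failure of isolation applies; along a repeated index
  the tuple it supplies might have different entries where equal ones are required. Witnesses are
  therefore demanded infinitely often: every tuple of the closure, even one with repeated entries,
  is then a limit of tuples with distinct indices.

  Elements of A and values of home-sort functions are merely approximated by entries of the
  sequence, so M must be its closure. Closing twice adds nothing, which turns omission in M into
  omission in Ccl(M).

  The c-dense set reduces the witness requirements to countably many. Their parameters are named by
  elements of A and by indices, so that all requirements are fixed before the sequence
  exists.\<close>

lemma compact_nbhd_compactin: "compact_nbhd X C C' \<Longrightarrow> compactin X C'"
  by (simp add: compact_nbhd_def)

text \<open>Compact Hausdorff spaces are normal, so \<open>N\<close> can be the closure of an open
  set squeezed between \<open>C\<close> and \<open>V\<close>.\<close>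

lemma compact_nbhd_between:
  assumes "compact_space X" "Hausdorff_space X" "compactin X C" "openin X V" "C \<subseteq> V"
  obtains N where "compact_nbhd X C N" "N \<subseteq> V"
proof -
  have n: "normal_space X"
    using assms compact_Hausdorff_or_regular_imp_normal_space by blast
  have "closedin X C"
    using assms compactin_imp_closedin by blast
  then obtain W where W: "openin X W" "C \<subseteq> W" "X closure_of W \<subseteq> V"
    using n assms unfolding normal_space_alt by meson
  show ?thesis
  proof
    have "compactin X (X closure_of W)"
      by (simp add: assms(1) closedin_compact_space)
    moreover have "W \<subseteq> X closure_of W"
      using W(1) by (simp add: closure_of_subset openin_subset)
    ultimately show "compact_nbhd X C (X closure_of W)"
      unfolding compact_nbhd_def using W by blast
    show "X closure_of W \<subseteq> V" by fact
  qed
qed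

lemma compact_nbhd_interpolate:
  assumes "compact_space X" "Hausdorff_space X" "compactin X C" "compact_nbhd X C C''"
  obtains C' where "compact_nbhd X C C'" "compact_nbhd X C' C''"
proof -
  from assms(4) obtain V where V: "openin X V" "C \<subseteq> V" "V \<subseteq> C''"
    by (auto simp: compact_nbhd_def)
  from compact_nbhd_between[OF assms(1-3) V(1,2)] obtain N where
    N: "compact_nbhd X C N" "N \<subseteq> V" .
  show ?thesis
    using that[OF N(1)] N V assms(4) by (auto simp: compact_nbhd_def)
qed

lemma compact_nbhd_Int:
  assumes "Hausdorff_space X" "compact_nbhd X C N" "compact_nbhd X C N'"
  shows "compact_nbhd X C (N \<inter> N')"
proof -
  obtain V V' where "openin X V" "C \<subseteq> V" "V \<subseteq> N" "openin X V'" "C \<subseteq> V'" "V' \<subseteq> N'"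
    using assms unfolding compact_nbhd_def by blast
  then have "openin X (V \<inter> V') \<and> C \<subseteq> V \<inter> V' \<and> V \<inter> V' \<subseteq> N \<inter> N'"
    by blast
  moreover have "compactin X (N \<inter> N')"
    using assms by (meson compact_nbhd_def compact_Int_closedin compactin_imp_closedin)
  ultimately show ?thesis
    unfolding compact_nbhd_def by blast
qed

lemma Hausdorff_space_euclidean_t2: "Hausdorff_space (euclidean :: 'a::t2_space topology)"
  unfolding Hausdorff_space_def disjnt_def
proof (intro allI impI)
  fix x y :: 'a
  assume "x \<in> topspace euclidean \<and> y \<in> topspace euclidean \<and> x \<noteq> y"
  then show "\<exists>U V. openin euclidean U \<and> openin euclidean V \<and> x \<in> U \<and> y \<in> V \<and> U \<inter> V = {}"
    using hausdorff[of x y] by simp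
qed

lemma Hausdorff_Spow: "Hausdorff_space (Spow n :: (nat \<Rightarrow> 's::t2_space) topology)"
  unfolding Spow_def by (simp add: Hausdorff_space_product_topology Hausdorff_space_euclidean_t2)

lemma compact_nbhd_topspace:
  "compact_space X \<Longrightarrow> C \<subseteq> topspace X \<Longrightarrow> compact_nbhd X C (topspace X)"
  by (auto simp: compact_nbhd_def compact_space_def intro!: exI[of _ "topspace X"])

context
  assumes compact_UNIV: "compact (UNIV :: 's::t2_space set)"
begin

lemma compact_Spow: "compact_space (Spow n :: (nat \<Rightarrow> 's) topology)"
  unfolding Spow_def using compact_UNIV
  by (intro compact_space_product_topology[THEN iffD2]) (simp add: compact_space_def)

lemma compact_UNIV_pairs: "compact (UNIV :: ('s \<times> 's) set)"
  using compact_Times[OF compact_UNIV compact_UNIV] by simp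

section \<open>The uniformity of a compact Hausdorff space\<close>

lemma compact_nbhd_diag_iff:
  "compact_nbhd_diag euclidean (D :: ('s \<times> 's) set) \<longleftrightarrow> closed D \<and> (\<exists>V. open V \<and> (\<forall>x. (x, x) \<in> V) \<and> V \<subseteq> D)"
proof -
  have "compact D \<longleftrightarrow> closed D"
    using compact_imp_closed compact_Int_closed[OF compact_UNIV_pairs, of D] by auto
  then show ?thesis
    by (auto simp: compact_nbhd_diag_def compact_nbhd_def)
qed

lemma closed_diag: "closed {(x, x) |x. x \<in> (UNIV :: 's set)}"
  using closed_diagonal[where 'a='s] by simp

lemma diag_nbhd_inside:
  assumes "open V" "\<forall>x::'s. (x, x) \<in> V"
  obtains D where "compact_nbhd_diag euclidean D" "D \<subseteq> V"
proof -
  have "compactin euclidean {(x, x) |x. x \<in> (UNIV :: 's set)}"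
    using closed_diag compact_Int_closed[OF compact_UNIV_pairs] by fastforce
  moreover have "compact_space (euclidean :: ('s \<times> 's) topology)"
    using compact_UNIV_pairs by (simp add: compact_space_def)
  ultimately obtain N where "compact_nbhd euclidean {(x, x) |x. x \<in> (UNIV :: 's set)} N" "N \<subseteq> V"
    using assms by (elim compact_nbhd_between[where V=V]) (auto simp: Hausdorff_space_euclidean_t2)
  then show ?thesis
    using that[of N] by (simp add: compact_nbhd_diag_def)
qed

lemma diag_nbhd_refl: "compact_nbhd_diag euclidean D \<Longrightarrow> (x::'s, x) \<in> D"
  by (auto simp: compact_nbhd_diag_iff)

lemma diag_nbhd_UNIV: "compact_nbhd_diag euclidean (UNIV :: ('s \<times> 's) set)"
  by (auto simp: compact_nbhd_diag_iff)

lemma diag_nbhd_separates: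
  assumes "x \<noteq> (y::'s)"
  obtains D where "compact_nbhd_diag euclidean D" "(x, y) \<notin> D"
proof (rule diag_nbhd_inside[of "- {(x, y)}"])
  show "open (- {(x, y)})" by (simp add: open_Compl)
qed (use assms that in auto)

lemma diag_nbhd_Int:
  "compact_nbhd_diag euclidean D \<Longrightarrow> compact_nbhd_diag euclidean (D' :: ('s \<times> 's) set) \<Longrightarrow>
    compact_nbhd_diag euclidean (D \<inter> D')"
  unfolding compact_nbhd_diag_def by (rule compact_nbhd_Int) (simp_all add: Hausdorff_space_euclidean_t2)

text \<open>A cover by three open sets suffices: \<open>U1\<close> is the only member of
  \<open>U1\<close>, \<open>U2\<close>, \<open>U3\<close> that meets \<open>K1\<close>, and
  \<open>U2\<close> the only one that meets \<open>K2\<close>. A chain of two \<open>E\<close>-steps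
  from \<open>V1\<close> to \<open>V2\<close> would have its midpoint in both \<open>U1\<close> and
  \<open>U2\<close>.\<close>

lemma diag_nbhd_half_at:
  assumes "x \<noteq> (z::'s)"
  obtains E W where "open E" "\<forall>u. (u, u) \<in> E" "open W" "(x, z) \<in> W" "(E O E) \<inter> W = {}"
proof -
  obtain U1 U2 where U: "open U1" "open U2" "x \<in> U1" "z \<in> U2" "U1 \<inter> U2 = {}"
    using hausdorff[OF assms] by blast
  have cs: "compact_space (euclidean :: 's topology)"
    using compact_UNIV by (simp add: compact_space_def)
  obtain K1 where K1: "compact_nbhd euclidean {x} K1" "K1 \<subseteq> U1"
    using compact_nbhd_between[OF cs, of "{x}" U1] U by (auto simp: Hausdorff_space_euclidean_t2)
  obtain K2 where K2: "compact_nbhd euclidean {z} K2" "K2 \<subseteq> U2"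
    using compact_nbhd_between[OF cs, of "{z}" U2] U by (auto simp: Hausdorff_space_euclidean_t2)
  obtain V1 V2 where V: "open V1" "x \<in> V1" "V1 \<subseteq> K1" "open V2" "z \<in> V2" "V2 \<subseteq> K2"
    using K1 K2 by (auto simp: compact_nbhd_def)
  define U3 where "U3 = - (K1 \<union> K2)"
  have "closed K1" "closed K2"
    using K1 K2 compact_imp_closed by (auto simp: compact_nbhd_def)
  then have "open U3"
    unfolding U3_def by (intro open_Compl closed_Un)
  define E where "E = U1 \<times> U1 \<union> U2 \<times> U2 \<union> U3 \<times> U3"
  show ?thesis
  proof
    show "open E" unfolding E_def using U \<open>open U3\<close> by (intro open_Un open_Times)
    show "\<forall>u. (u, u) \<in> E" unfolding E_def U3_def using K1 K2 by auto
    show "open (V1 \<times> V2)" using V by (intro open_Times)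
    show "(x, z) \<in> V1 \<times> V2" using V by simp
    show "(E O E) \<inter> (V1 \<times> V2) = {}"
      unfolding E_def U3_def using K1 K2 U(5) V(3,6) by blast
  qed
qed

text \<open>This is the halving axiom of the uniformity. The complement of \<open>V\<close> is
  compact, so finitely many of the local relations from \<open>diag_nbhd_half_at\<close> exclude all
  of it, and their intersection is still an open neighbourhood of the diagonal. Symmetry is obtained
  by intersecting with the converse.\<close>

lemma diag_nbhd_half:
  assumes "compact_nbhd_diag euclidean (D :: ('s \<times> 's) set)"
  obtains D1 where "compact_nbhd_diag euclidean D1" "D1 O D1 \<subseteq> D" "sym D1"
proof -
  obtain V where V: "open V" "\<forall>x. (x, x) \<in> V" "V \<subseteq> D"
    using assms by (auto simp: compact_nbhd_diag_iff)
  have "\<forall>q\<in>- V. \<exists>E W. open E \<and> (\<forall>u. (u, u) \<in> E) \<and> open W \<and> q \<in> W \<and> (E O E) \<inter> W = {}"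
  proof
    fix q assume "q \<in> - V"
    then obtain x z where "q = (x, z)" "x \<noteq> z" using V(2) by (cases q) auto
    then show "\<exists>E W. open E \<and> (\<forall>u. (u, u) \<in> E) \<and> open W \<and> q \<in> W \<and> (E O E) \<inter> W = {}"
      by (metis diag_nbhd_half_at)
  qed
  then obtain E W where EW: "\<And>q. q \<in> - V \<Longrightarrow> open (E q) \<and> (\<forall>u. (u, u) \<in> E q) \<and> open (W q) \<and> q \<in> W q
      \<and> (E q O E q) \<inter> W q = {}"
    by metis
  have "compact (- V)"
    using compact_Int_closed[OF compact_UNIV_pairs, of "- V"] V(1) by (simp add: closed_Compl)
  then obtain Q where Q: "Q \<subseteq> - V" "finite Q" "- V \<subseteq> (\<Union>q\<in>Q. W q)"
    by (rule compactE_image[of _ "- V" W]) (use EW in auto)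
  define F where "F = (\<Inter>q\<in>Q. E q)"
  have "open F" unfolding F_def using Q EW by (intro open_INT) auto
  moreover have "\<forall>u. (u, u) \<in> F" unfolding F_def using Q EW by auto
  ultimately obtain D0 where D0: "compact_nbhd_diag euclidean D0" "D0 \<subseteq> F"
    by (rule diag_nbhd_inside)
  have "F O F \<subseteq> V"
  proof
    fix r assume r: "r \<in> F O F"
    show "r \<in> V"
    proof (rule ccontr)
      assume "r \<notin> V"
      then obtain q where "q \<in> Q" "r \<in> W q" using Q by auto
      moreover have "r \<in> E q O E q" using r \<open>q \<in> Q\<close> by (auto simp: F_def)
      ultimately show False using EW Q by blast
    qed
  qed
  have "compact_nbhd_diag euclidean (D0\<inverse>)"
  proof -
    have sw: "continuous_on UNIV (prod.swap :: 's \<times> 's \<Rightarrow> _)"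
      by (simp add: continuous_on_swap)
    have eq: "prod.swap -` X = X\<inverse>" for X :: "('s \<times> 's) set" by auto
    obtain V0 where "open V0" "\<forall>x. (x, x) \<in> V0" "V0 \<subseteq> D0" "closed D0"
      using D0 by (auto simp: compact_nbhd_diag_iff)
    then have "closed (D0\<inverse>)" "open (V0\<inverse>)" "\<forall>x. (x, x) \<in> V0\<inverse>" "V0\<inverse> \<subseteq> D0\<inverse>"
      using closed_vimage[OF _ sw, of D0] open_vimage[OF _ sw, of V0] by (auto simp: eq)
    then show ?thesis by (auto simp: compact_nbhd_diag_iff)
  qed
  then have "compact_nbhd_diag euclidean (D0 \<inter> D0\<inverse>)"
    by (intro diag_nbhd_Int D0)
  moreover have "(D0 \<inter> D0\<inverse>) O (D0 \<inter> D0\<inverse>) \<subseteq> D"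
    using \<open>F O F \<subseteq> V\<close> D0(2) V(3) by blast
  moreover have "sym (D0 \<inter> D0\<inverse>)"
    by (auto simp: sym_def)
  ultimately show ?thesis by (rule that)
qed

text \<open>Leaves room below \<open>D\<close>; this is what makes every formula for nearness a
  weakening of a finer one.\<close>

lemma diag_nbhd_shrink:
  assumes "compact_nbhd_diag euclidean (D :: ('s \<times> 's) set)"
  obtains D0 where "compact_nbhd_diag euclidean D0" "compact_nbhd euclidean D0 D"
proof -
  obtain V where V: "open V" "\<forall>x. (x, x) \<in> V" "V \<subseteq> D"
    using assms by (auto simp: compact_nbhd_diag_iff)
  obtain D0 where D0: "compact_nbhd_diag euclidean D0" "D0 \<subseteq> V"
    using diag_nbhd_inside[OF V(1,2)] .
  moreover have "compact_nbhd euclidean D0 D"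
    using assms V D0 by (auto simp: compact_nbhd_def compact_nbhd_diag_def)
  ultimately show ?thesis using that by blast
qed

end

text \<open>Atomic formulas test extensional functions on \<open>{..<2}\<close>, not pairs; this is
  the form in which a relation on \<open>S\<close> can occur in \<open>In [t, u] _\<close>.\<close>

definition pair_set :: "('s \<times> 's) set \<Rightarrow> (nat \<Rightarrow> 's::t2_space) set" where
  "pair_set D = {f \<in> topspace (Spow 2). (f 0, f 1) \<in> D}"

lemma tup_in_topspace: "length xs = n \<Longrightarrow> tup xs \<in> topspace (Spow n)"
  by (auto simp: tup_def Spow_def)

lemma tup_pair_set [simp]: "tup [x, y] \<in> pair_set D \<longleftrightarrow> (x, y) \<in> D"
  using tup_in_topspace[of "[x, y]" 2] by (auto simp: pair_set_def) (auto simp: tup_def)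

lemma continuous_map_pair: "continuous_map (Spow 2) euclidean (\<lambda>f. (f 0, f 1) :: 's::t2_space \<times> 's)"
proof -
  have "continuous_map (Spow 2) (prod_topology euclidean euclidean) (\<lambda>f. (f 0, f 1) :: 's \<times> 's)"
    unfolding Spow_def by (rule continuous_map_pairedI; rule continuous_map_product_projection) auto
  then show ?thesis by simp
qed

lemma compactin_pair_set:
  assumes "compact (UNIV :: 's::t2_space set)" "compact (D :: ('s \<times> 's) set)"
  shows "compactin (Spow 2) (pair_set D)"
proof -
  have "closedin (Spow 2) (pair_set D)"
    unfolding pair_set_def
    using closedin_continuous_map_preimage[OF continuous_map_pair, of D] compact_imp_closed[OF assms(2)]
    by simp
  then show ?thesis
    using closedin_compact_space[OF compact_Spow[OF assms(1)]] by simp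
qed

lemma compact_nbhd_pair_set:
  assumes "compact (UNIV :: 's::t2_space set)" "compact_nbhd euclidean D (D' :: ('s \<times> 's) set)"
  shows "compact_nbhd (Spow 2) (pair_set D) (pair_set D')"
proof -
  obtain V where V: "open V" "D \<subseteq> V" "V \<subseteq> D'" "compact D'"
    using assms(2) by (auto simp: compact_nbhd_def)
  have "openin (Spow 2) (pair_set V)"
    unfolding pair_set_def
    using openin_continuous_map_preimage[OF continuous_map_pair, of V] V by simp
  moreover have "pair_set D \<subseteq> pair_set V" "pair_set V \<subseteq> pair_set D'"
    using V by (auto simp: pair_set_def)
  ultimately show ?thesis
    unfolding compact_nbhd_def using compactin_pair_set[OF assms(1)] V by blast
qed

section \<open>Substitution and syntactic operations\<close>

fun hsub :: "(nat \<Rightarrow> ('f, 'm) hterm) \<Rightarrow> ('f, 'm) hterm \<Rightarrow> ('f, 'm) hterm" where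
  "hsub \<sigma> (HVar i) = \<sigma> i"
| "hsub \<sigma> (HPar b) = HPar b"
| "hsub \<sigma> (HApp f ts) = HApp f (map (hsub \<sigma>) ts)"

text \<open>A variable of sort \<open>S\<close> is replaced by a variable (\<open>Inl\<close>) or by a constant (\<open>Inr\<close>).\<close>

fun ssub :: "(nat \<Rightarrow> ('f, 'm) hterm) \<Rightarrow> (nat \<Rightarrow> nat + 's) \<Rightarrow> ('f, 'g, 'm, 's) sterm
    \<Rightarrow> ('f, 'g, 'm, 's) sterm" where
  "ssub \<sigma> \<rho> (SVar i) = (case \<rho> i of Inl j \<Rightarrow> SVar j | Inr c \<Rightarrow> SCont (\<lambda>_. c) [])"
| "ssub \<sigma> \<rho> (SCont f ts) = SCont f (map (ssub \<sigma> \<rho>) ts)"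
| "ssub \<sigma> \<rho> (SApp g us ts) = SApp g (map (hsub \<sigma>) us) (map (ssub \<sigma> \<rho>) ts)"

definition hlift :: "(nat \<Rightarrow> ('f, 'm) hterm) \<Rightarrow> nat \<Rightarrow> ('f, 'm) hterm" where
  "hlift \<sigma> = case_nat (HVar 0) (hsub (HVar \<circ> Suc) \<circ> \<sigma>)"

definition slift :: "(nat \<Rightarrow> nat + 's) \<Rightarrow> nat \<Rightarrow> nat + 's" where
  "slift \<rho> = case_nat (Inl 0) (map_sum Suc id \<circ> \<rho>)"

text \<open>Only meant for continuous formulas: the value on \<open>Rel\<close> is junk.\<close>

fun psub :: "(nat \<Rightarrow> ('f, 'm) hterm) \<Rightarrow> (nat \<Rightarrow> nat + 's) \<Rightarrow> ('f, 'r, 'g, 'm, 's) pform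
    \<Rightarrow> ('f, 'r, 'g, 'm, 's) pform" where
  "psub \<sigma> \<rho> (Rel \<phi>) = Rel \<phi>"
| "psub \<sigma> \<rho> (In ts C) = In (map (ssub \<sigma> \<rho>) ts) C"
| "psub \<sigma> \<rho> (And \<phi> \<psi>) = And (psub \<sigma> \<rho> \<phi>) (psub \<sigma> \<rho> \<psi>)"
| "psub \<sigma> \<rho> (Or \<phi> \<psi>) = Or (psub \<sigma> \<rho> \<phi>) (psub \<sigma> \<rho> \<psi>)"
| "psub \<sigma> \<rho> (AllH \<phi>) = AllH (psub (hlift \<sigma>) \<rho> \<phi>)"
| "psub \<sigma> \<rho> (ExH \<phi>) = ExH (psub (hlift \<sigma>) \<rho> \<phi>)"
| "psub \<sigma> \<rho> (AllS \<phi>) = AllS (psub \<sigma> (slift \<rho>) \<phi>)"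
| "psub \<sigma> \<rho> (ExS \<phi>) = ExS (psub \<sigma> (slift \<rho>) \<phi>)"

fun sval :: "'s list \<Rightarrow> nat + 's \<Rightarrow> 's" where
  "sval s (Inl j) = s ! j"
| "sval s (Inr c) = c"

fun sref_in :: "nat \<Rightarrow> nat + 's \<Rightarrow> bool" where
  "sref_in m (Inl j) \<longleftrightarrow> j < m"
| "sref_in m (Inr c) \<longleftrightarrow> True"

lemma continuous_form_simps [simp]:
  "\<not> continuous_form L B n m (Rel \<theta>)"
  "continuous_form L B n m (In ts C) \<longleftrightarrow>
     ts \<noteq> [] \<and> compactin (Spow (length ts)) C \<and> (\<forall>t\<in>set ts. sterm_in L B n m t)"
  "continuous_form L B n m (And \<phi> \<psi>) \<longleftrightarrow> continuous_form L B n m \<phi> \<and> continuous_form L B n m \<psi>"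
  "continuous_form L B n m (Or \<phi> \<psi>) \<longleftrightarrow> continuous_form L B n m \<phi> \<and> continuous_form L B n m \<psi>"
  "continuous_form L B n m (AllH \<phi>) \<longleftrightarrow> continuous_form L B (Suc n) m \<phi>"
  "continuous_form L B n m (ExH \<phi>) \<longleftrightarrow> continuous_form L B (Suc n) m \<phi>"
  "continuous_form L B n m (AllS \<phi>) \<longleftrightarrow> continuous_form L B n (Suc m) \<phi>"
  "continuous_form L B n m (ExS \<phi>) \<longleftrightarrow> continuous_form L B n (Suc m) \<phi>"
  by (auto simp: continuous_form_def)

lemma continuous_form_positive: "continuous_form L B n m \<phi> \<Longrightarrow> positive L B n m \<phi>"
  by (simp add: continuous_form_def)

lemma hterm_in_mono: "hterm_in L B n t \<Longrightarrow> B \<subseteq> B' \<Longrightarrow> n \<le> n' \<Longrightarrow> hterm_in L B' n' t"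
  by (induction t) auto

lemma sterm_in_mono:
  "sterm_in L B n m t \<Longrightarrow> B \<subseteq> B' \<Longrightarrow> n \<le> n' \<Longrightarrow> m \<le> m' \<Longrightarrow> sterm_in L B' n' m' t"
  using hterm_in_mono[of L B n _ B' n'] by (induction t) auto

lemma continuous_form_mono:
  "continuous_form L B n m \<phi> \<Longrightarrow> B \<subseteq> B' \<Longrightarrow> n \<le> n' \<Longrightarrow> m \<le> m' \<Longrightarrow> continuous_form L B' n' m' \<phi>"
proof (induction \<phi> arbitrary: n m n' m')
  case (In ts C)
  then show ?case using sterm_in_mono[of L B n m _ B' n' m'] by auto
next
  case (And \<phi> \<psi>)
  then show ?case using And.IH[of n m n' m'] by simp
next
  case (Or \<phi> \<psi>)
  then show ?case using Or.IH[of n m n' m'] by simp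
next
  case (AllH \<phi>)
  then show ?case using AllH.IH[of "Suc n" m "Suc n'" m'] by simp
next
  case (ExH \<phi>)
  then show ?case using ExH.IH[of "Suc n" m "Suc n'" m'] by simp
next
  case (AllS \<phi>)
  then show ?case using AllS.IH[of n "Suc m" n' "Suc m'"] by simp
next
  case (ExS \<phi>)
  then show ?case using ExS.IH[of n "Suc m" n' "Suc m'"] by simp
qed simp

lemma heval_cong: "hterm_in L B n t \<Longrightarrow> \<forall>i<n. a ! i = a' ! i \<Longrightarrow> heval U a t = heval U a' t"
  by (induction t) (auto cong: map_cong)

lemma seval_cong:
  "sterm_in L B n m t \<Longrightarrow> \<forall>i<n. a ! i = a' ! i \<Longrightarrow> \<forall>i<m. s ! i = s' ! i \<Longrightarrow>
    seval U a s t = seval U a' s' t"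
proof (induction t)
  case (SApp g us ts)
  have "map (heval U a) us = map (heval U a') us"
    using SApp.prems by (auto intro: heval_cong)
  moreover have "map (seval U a s) ts = map (seval U a' s') ts"
    using SApp by auto
  ultimately show ?case by (simp only: seval.simps)
qed (auto cong: map_cong)

lemma nth_Cons_eq: "\<forall>i<n. a ! i = a' ! i \<Longrightarrow> \<forall>i<Suc n. (b # a) ! i = (b # a') ! i"
  by (auto simp: less_Suc_eq_0_disj)

lemma sat_cong:
  "continuous_form L B n m \<phi> \<Longrightarrow> \<forall>i<n. a ! i = a' ! i \<Longrightarrow> \<forall>i<m. s ! i = s' ! i \<Longrightarrow>
    sat U a s \<phi> \<longleftrightarrow> sat U a' s' \<phi>"
proof (induction \<phi> arbitrary: n m a a' s s')
  case (In ts C)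
  have "map (seval U a s) ts = map (seval U a' s') ts"
    using In by (auto intro: seval_cong)
  then show ?case by (simp only: sat.simps)
next
  case (And \<phi> \<psi>)
  from And.prems show ?case using And.IH[of n m a a' s s'] by simp
next
  case (Or \<phi> \<psi>)
  from Or.prems show ?case using Or.IH[of n m a a' s s'] by simp
next
  case (AllH \<phi>)
  then have "sat U (b # a) s \<phi> = sat U (b # a') s' \<phi>" for b
    using nth_Cons_eq by (intro AllH.IH[of "Suc n" m]) simp_all
  then show ?case by simp
next
  case (ExH \<phi>)
  then have "sat U (b # a) s \<phi> = sat U (b # a') s' \<phi>" for b
    using nth_Cons_eq by (intro ExH.IH[of "Suc n" m]) simp_all
  then show ?case by simp
next
  case (AllS \<phi>)
  then have "sat U a (b # s) \<phi> = sat U a' (b # s') \<phi>" for b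
    using nth_Cons_eq by (intro AllS.IH[of n "Suc m"]) simp_all
  then show ?case by simp
next
  case (ExS \<phi>)
  then have "sat U a (b # s) \<phi> = sat U a' (b # s') \<phi>" for b
    using nth_Cons_eq by (intro ExS.IH[of n "Suc m"]) simp_all
  then show ?case by simp
qed simp

lemma sat_append:
  "continuous_form L B n m \<phi> \<Longrightarrow> length a = n \<Longrightarrow> sat U (a @ c) s \<phi> \<longleftrightarrow> sat U a s \<phi>"
  by (rule sat_cong) (auto simp: nth_append)

lemma hterm_in_hsub:
  "hterm_in L B n t \<Longrightarrow> B \<subseteq> B' \<Longrightarrow> \<forall>i<n. hterm_in L B' n' (\<sigma> i) \<Longrightarrow> hterm_in L B' n' (hsub \<sigma> t)"
  by (induction t) auto

lemma sterm_in_ssub: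
  "sterm_in L B n m t \<Longrightarrow> B \<subseteq> B' \<Longrightarrow> \<forall>i<n. hterm_in L B' n' (\<sigma> i) \<Longrightarrow>
    \<forall>i<m. sref_in m' (\<rho> i) \<Longrightarrow> sterm_in L B' n' m' (ssub \<sigma> \<rho> t)"
proof (induction t)
  case (SVar i)
  then show ?case by (cases "\<rho> i") (auto dest: spec[of _ i])
next
  case (SApp g us ts)
  then show ?case using hterm_in_hsub[of L B n _ B' n' \<sigma>] by auto
qed auto

lemma heval_hsub:
  "hterm_in L B n t \<Longrightarrow> \<forall>i<n. heval U a' (\<sigma> i) = a ! i \<Longrightarrow> heval U a' (hsub \<sigma> t) = heval U a t"
  by (induction t) (auto simp: o_def cong: map_cong)

lemma seval_ssub:
  "sterm_in L B n m t \<Longrightarrow> \<forall>i<n. heval U a' (\<sigma> i) = a ! i \<Longrightarrow> \<forall>i<m. sval s' (\<rho> i) = s ! i \<Longrightarrow>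
    seval U a' s' (ssub \<sigma> \<rho> t) = seval U a s t"
proof (induction t)
  case (SVar i)
  then show ?case by (cases "\<rho> i") auto
next
  case (SApp g us ts)
  have "map (heval U a' \<circ> hsub \<sigma>) us = map (heval U a) us"
    using SApp.prems by (auto intro: heval_hsub)
  moreover have "map (seval U a' s' \<circ> ssub \<sigma> \<rho>) ts = map (seval U a s) ts"
    using SApp by auto
  ultimately show ?case by (simp only: seval.simps ssub.simps map_map)
qed (auto simp: o_def cong: map_cong)

lemma hterm_in_hlift:
  "\<forall>i<n. hterm_in L B n' (\<sigma> i) \<Longrightarrow> \<forall>i<Suc n. hterm_in L B (Suc n') (hlift \<sigma> i)"
  by (auto simp: hlift_def less_Suc_eq_0_disj intro!: hterm_in_hsub)

lemma sref_in_slift: "\<forall>i<m. sref_in m' (\<rho> i) \<Longrightarrow> \<forall>i<Suc m. sref_in (Suc m') (slift \<rho> i)"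
proof (intro allI impI)
  fix i assume *: "\<forall>i<m. sref_in m' (\<rho> i)" and i: "i < Suc m"
  show "sref_in (Suc m') (slift \<rho> i)"
  proof (cases i)
    case (Suc j)
    then show ?thesis using * i by (cases "\<rho> j") (auto simp: slift_def dest: spec[of _ j])
  qed (simp add: slift_def)
qed

lemma heval_shift: "heval U (b # a) (hsub (HVar \<circ> Suc) t) = heval U a t"
  by (induction t) (auto cong: map_cong)

lemma heval_hlift:
  "\<forall>i<n. heval U a' (\<sigma> i) = a ! i \<Longrightarrow> \<forall>i<Suc n. heval U (b # a') (hlift \<sigma> i) = (b # a) ! i"
  by (auto simp: hlift_def less_Suc_eq_0_disj heval_shift)

lemma sval_slift:
  "\<forall>i<m. sval s' (\<rho> i) = s ! i \<Longrightarrow> \<forall>i<Suc m. sval (b # s') (slift \<rho> i) = (b # s) ! i"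
proof (intro allI impI)
  fix i assume *: "\<forall>i<m. sval s' (\<rho> i) = s ! i" and i: "i < Suc m"
  show "sval (b # s') (slift \<rho> i) = (b # s) ! i"
  proof (cases i)
    case (Suc j)
    then show ?thesis using * i by (cases "\<rho> j") (auto simp: slift_def dest: spec[of _ j])
  qed (simp add: slift_def)
qed

lemma continuous_form_psub:
  "continuous_form L B n m \<phi> \<Longrightarrow> B \<subseteq> B' \<Longrightarrow> \<forall>i<n. hterm_in L B' n' (\<sigma> i) \<Longrightarrow>
    \<forall>i<m. sref_in m' (\<rho> i) \<Longrightarrow> continuous_form L B' n' m' (psub \<sigma> \<rho> \<phi>)"
proof (induction \<phi> arbitrary: n m n' m' \<sigma> \<rho>)
  case (In ts C)
  then show ?case by (auto intro: sterm_in_ssub)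
next
  case (And \<phi> \<psi>)
  from And.prems show ?case using And.IH[of n m n' \<sigma> m' \<rho>] by simp
next
  case (Or \<phi> \<psi>)
  from Or.prems show ?case using Or.IH[of n m n' \<sigma> m' \<rho>] by simp
qed (simp_all add: hterm_in_hlift sref_in_slift)

lemma sat_psub:
  "continuous_form L B n m \<phi> \<Longrightarrow> \<forall>i<n. heval U a' (\<sigma> i) = a ! i \<Longrightarrow> \<forall>i<m. sval s' (\<rho> i) = s ! i \<Longrightarrow>
    sat U a' s' (psub \<sigma> \<rho> \<phi>) \<longleftrightarrow> sat U a s \<phi>"
proof (induction \<phi> arbitrary: n m a a' s s' \<sigma> \<rho>)
  case (In ts C)
  have "map (seval U a' s' \<circ> ssub \<sigma> \<rho>) ts = map (seval U a s) ts"
    using In by (auto intro: seval_ssub)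
  then show ?case by (simp only: sat.simps psub.simps map_map)
next
  case (And \<phi> \<psi>)
  from And.prems show ?case using And.IH[of n m a' \<sigma> a s' \<rho> s] by simp
next
  case (Or \<phi> \<psi>)
  from Or.prems show ?case using Or.IH[of n m a' \<sigma> a s' \<rho> s] by simp
next
  case (AllH \<phi>)
  then have "sat U (b # a') s' (psub (hlift \<sigma>) \<rho> \<phi>) = sat U (b # a) s \<phi>" for b
    using heval_hlift by (intro AllH.IH[of "Suc n" m]) simp_all
  then show ?case by simp
next
  case (ExH \<phi>)
  then have "sat U (b # a') s' (psub (hlift \<sigma>) \<rho> \<phi>) = sat U (b # a) s \<phi>" for b
    using heval_hlift by (intro ExH.IH[of "Suc n" m]) simp_all
  then show ?case by simp
next
  case (AllS \<phi>)
  then have "sat U a' (b # s') (psub \<sigma> (slift \<rho>) \<phi>) = sat U a (b # s) \<phi>" for b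
    using sval_slift by (intro AllS.IH[of n "Suc m"]) simp_all
  then show ?case by simp
next
  case (ExS \<phi>)
  then have "sat U a' (b # s') (psub \<sigma> (slift \<rho>) \<phi>) = sat U a (b # s) \<phi>" for b
    using sval_slift by (intro ExS.IH[of n "Suc m"]) simp_all
  then show ?case by simp
qed simp

section \<open>Tuples, blocks of quantifiers and finite conjunctions\<close>

lemma tuples_Suc: "a \<in> tuples (Suc n) X \<longleftrightarrow> (\<exists>x b. a = x # b \<and> x \<in> X \<and> b \<in> tuples n X)"
  by (cases a) (auto simp: tuples_def)

lemma tuples_0 [simp]: "a \<in> tuples 0 X \<longleftrightarrow> a = []"
  by (auto simp: tuples_def)

lemma tuples_length: "a \<in> tuples n X \<Longrightarrow> length a = n"
  by (simp add: tuples_def)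

lemma tuples_append: "a \<in> tuples n X \<Longrightarrow> b \<in> tuples m X \<Longrightarrow> a @ b \<in> tuples (n + m) X"
  by (auto simp: tuples_def)

lemma tuples_nth: "a \<in> tuples n X \<Longrightarrow> i < n \<Longrightarrow> a ! i \<in> X"
  by (auto simp: tuples_def)

lemma tuples_snoc:
  "a \<in> tuples (Suc n) X \<longleftrightarrow> (\<exists>b x. a = b @ [x] \<and> b \<in> tuples n X \<and> x \<in> X)"
  by (cases a rule: rev_exhaust) (auto simp: tuples_def)

definition AllHs :: "nat \<Rightarrow> ('f, 'r, 'g, 'm, 's) pform \<Rightarrow> ('f, 'r, 'g, 'm, 's) pform" where
  "AllHs k = AllH ^^ k"

definition ExHs :: "nat \<Rightarrow> ('f, 'r, 'g, 'm, 's) pform \<Rightarrow> ('f, 'r, 'g, 'm, 's) pform" where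
  "ExHs k = ExH ^^ k"

text \<open>The outermost quantifier of the block binds the last entry of \<open>z\<close>, which is
  why tuples are split at their end.\<close>

lemma sat_AllHs: "sat U a s (AllHs k \<phi>) \<longleftrightarrow> (\<forall>z\<in>tuples k (hdom U). sat U (z @ a) s \<phi>)"
proof (induction k arbitrary: a)
  case (Suc k)
  have "sat U a s (AllHs (Suc k) \<phi>) \<longleftrightarrow> (\<forall>b\<in>hdom U. \<forall>z\<in>tuples k (hdom U). sat U (z @ b # a) s \<phi>)"
    by (simp add: AllHs_def) (simp add: Suc[unfolded AllHs_def])
  then show ?case by (force simp: tuples_snoc)
qed (simp add: AllHs_def)

lemma sat_ExHs: "sat U a s (ExHs k \<phi>) \<longleftrightarrow> (\<exists>z\<in>tuples k (hdom U). sat U (z @ a) s \<phi>)"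
proof (induction k arbitrary: a)
  case (Suc k)
  have "sat U a s (ExHs (Suc k) \<phi>) \<longleftrightarrow> (\<exists>b\<in>hdom U. \<exists>z\<in>tuples k (hdom U). sat U (z @ b # a) s \<phi>)"
    by (simp add: ExHs_def) (simp add: Suc[unfolded ExHs_def])
  then show ?case by (force simp: tuples_snoc)
qed (simp add: ExHs_def)

lemma continuous_form_AllHs [simp]:
  "continuous_form L B n m (AllHs k \<phi>) \<longleftrightarrow> continuous_form L B (k + n) m \<phi>"
  by (induction k arbitrary: n) (simp_all add: AllHs_def)

lemma continuous_form_ExHs [simp]:
  "continuous_form L B n m (ExHs k \<phi>) \<longleftrightarrow> continuous_form L B (k + n) m \<phi>"
  by (induction k arbitrary: n) (simp_all add: ExHs_def)

lemma weakening_AllHs: "weakening \<phi> \<phi>' \<Longrightarrow> weakening (AllHs k \<phi>) (AllHs k \<phi>')"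
  by (induction k) (simp_all add: AllHs_def weakening.intros)

text \<open>There are no propositional constants, and \<open>In\<close> requires a nonempty list of
  terms; truth is therefore the statement that an arbitrary constant belongs to all of
  \<open>Spow 1\<close>.\<close>

definition Conj :: "('f, 'r, 'g, 'm, 's::t2_space) pform list \<Rightarrow> ('f, 'r, 'g, 'm, 's) pform" where
  "Conj \<phi>s = foldr And \<phi>s (In [SCont (\<lambda>_. undefined) []] (topspace (Spow 1)))"

lemma sat_Conj [simp]: "sat U a s (Conj \<phi>s) \<longleftrightarrow> (\<forall>\<phi>\<in>set \<phi>s. sat U a s \<phi>)"
  by (induction \<phi>s) (auto simp: Conj_def tup_in_topspace)

lemma continuous_form_Conj:
  assumes "compact (UNIV :: 's::t2_space set)"
  shows "continuous_form L B n m (Conj \<phi>s :: ('f, 'r, 'g, 'm, 's) pform) \<longleftrightarrow> (\<forall>\<phi>\<in>set \<phi>s. continuous_form L B n m \<phi>)"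
  using compact_Spow[OF assms, of 1] by (induction \<phi>s) (auto simp: Conj_def compact_space_def)

lemma weakening_Conj:
  assumes "compact (UNIV :: 's::t2_space set)"
  shows "list_all2 weakening \<phi>s (\<psi>s :: ('f, 'r, 'g, 'm, 's) pform list) \<Longrightarrow> weakening (Conj \<phi>s) (Conj \<psi>s)"
proof (induction rule: list_all2_induct)
  case Nil
  \<comment> \<open>Truth is its own weakening: a compact space is a compact neighbourhood of
    itself.\<close>
  show ?case using compact_Spow[OF assms, of 1]
    by (auto simp: Conj_def compact_nbhd_topspace intro!: weakening.intros)
qed (auto simp: Conj_def intro: weakening.intros)

section \<open>Weakenings\<close>

context
  assumes compact_UNIV: "compact (UNIV :: 's::t2_space set)"
begin

lemma weakening_continuous_form:
  "weakening \<phi> \<phi>' \<Longrightarrow> continuous_form L B n m (\<phi> :: ('f, 'r, 'g, 'm, 's) pform) \<Longrightarrow>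
    continuous_form L B n m \<phi>'"
  by (induction arbitrary: n m rule: weakening.induct) (auto intro: compact_nbhd_compactin)

lemma weakening_exists:
  "continuous_form L B n m (\<phi> :: ('f, 'r, 'g, 'm, 's) pform) \<Longrightarrow> \<exists>\<phi>'. weakening \<phi> \<phi>'"
proof (induction \<phi> arbitrary: n m)
  case (In ts C)
  then have "compact_nbhd (Spow (length ts)) C (topspace (Spow (length ts)))"
    using compact_Spow[OF compact_UNIV] compactin_subset_topspace
    by (intro compact_nbhd_topspace) auto
  then show ?case by (blast intro: weakening.intros)
qed (fastforce intro: weakening.intros)+

lemma weakening_interpolate:
  "weakening \<phi> \<phi>'' \<Longrightarrow> continuous_form L B n m (\<phi> :: ('f, 'r, 'g, 'm, 's) pform) \<Longrightarrow>
    \<exists>\<phi>'. weakening \<phi> \<phi>' \<and> weakening \<phi>' \<phi>''"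
proof (induction arbitrary: n m rule: weakening.induct)
  case (2 ts C C'')
  then have "compactin (Spow (length ts)) C" by simp
  then obtain C' where "compact_nbhd (Spow (length ts)) C C'" "compact_nbhd (Spow (length ts)) C' C''"
    using compact_nbhd_interpolate[OF compact_Spow[OF compact_UNIV] Hausdorff_Spow _ "2.hyps"] by metis
  then show ?case by (blast intro: weakening.intros)
qed (fastforce intro: weakening.intros)+

text \<open>Positive formulas are monotone in their atoms, so intersecting the two neighbourhoods
  atom by atom gives a weakening below both.\<close>

lemma weakening_directed:
  "weakening \<phi> \<phi>1 \<Longrightarrow> weakening (\<phi> :: ('f, 'r, 'g, 'm, 's) pform) \<phi>2 \<Longrightarrow>
    \<exists>\<phi>3. weakening \<phi> \<phi>3 \<and> (\<forall>N a s. sat N a s \<phi>3 \<longrightarrow> sat N a s \<phi>1 \<and> sat N a s \<phi>2)"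
proof (induction arbitrary: \<phi>2 rule: weakening.induct)
  case (1 \<phi>)
  then show ?case by (auto elim!: weakening.cases intro: weakening.intros)
next
  case (2 ts C C1)
  from "2.prems" obtain C2 where C2: "\<phi>2 = In ts C2" "compact_nbhd (Spow (length ts)) C C2"
    by (cases rule: weakening.cases) auto
  have "weakening (In ts C) (In ts (C1 \<inter> C2))"
    by (intro weakening.intros compact_nbhd_Int[OF Hausdorff_Spow] "2.hyps" C2)
  then show ?case unfolding C2 by (intro exI[of _ "In ts (C1 \<inter> C2)"]) simp
next
  case (3 \<phi> \<phi>' \<psi> \<psi>')
  from "3.prems" obtain \<phi>2' \<psi>2' where e: "\<phi>2 = And \<phi>2' \<psi>2'" "weakening \<phi> \<phi>2'" "weakening \<psi> \<psi>2'"
    by (cases rule: weakening.cases) auto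
  from "3.IH"(1)[OF e(2)] "3.IH"(2)[OF e(3)] obtain \<phi>3 \<psi>3 where
    "weakening \<phi> \<phi>3" "\<forall>N a s. sat N a s \<phi>3 \<longrightarrow> sat N a s \<phi>' \<and> sat N a s \<phi>2'"
    "weakening \<psi> \<psi>3" "\<forall>N a s. sat N a s \<psi>3 \<longrightarrow> sat N a s \<psi>' \<and> sat N a s \<psi>2'" by blast
  then show ?case
    unfolding e(1) by (intro exI[of _ "And \<phi>3 \<psi>3"]) (auto intro: weakening.intros)
next
  case (4 \<phi> \<phi>' \<psi> \<psi>')
  from "4.prems" obtain \<phi>2' \<psi>2' where e: "\<phi>2 = Or \<phi>2' \<psi>2'" "weakening \<phi> \<phi>2'" "weakening \<psi> \<psi>2'"
    by (cases rule: weakening.cases) auto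
  from "4.IH"(1)[OF e(2)] "4.IH"(2)[OF e(3)] obtain \<phi>3 \<psi>3 where
    "weakening \<phi> \<phi>3" "\<forall>N a s. sat N a s \<phi>3 \<longrightarrow> sat N a s \<phi>' \<and> sat N a s \<phi>2'"
    "weakening \<psi> \<psi>3" "\<forall>N a s. sat N a s \<psi>3 \<longrightarrow> sat N a s \<psi>' \<and> sat N a s \<psi>2'" by blast
  then show ?case
    unfolding e(1) by (intro exI[of _ "Or \<phi>3 \<psi>3"]) (auto intro: weakening.intros)
next
  case (5 \<phi> \<phi>')
  from "5.prems" obtain \<phi>2' where e: "\<phi>2 = AllH \<phi>2'" "weakening \<phi> \<phi>2'"
    by (cases rule: weakening.cases) auto
  from "5.IH"(1)[OF e(2)] obtain \<phi>3 where
    "weakening \<phi> \<phi>3" "\<forall>N a s. sat N a s \<phi>3 \<longrightarrow> sat N a s \<phi>' \<and> sat N a s \<phi>2'" by blast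
  then show ?case
    unfolding e(1) by (intro exI[of _ "AllH \<phi>3"]) (auto intro: weakening.intros)
next
  case (6 \<phi> \<phi>')
  from "6.prems" obtain \<phi>2' where e: "\<phi>2 = ExH \<phi>2'" "weakening \<phi> \<phi>2'"
    by (cases rule: weakening.cases) auto
  from "6.IH"(1)[OF e(2)] obtain \<phi>3 where
    "weakening \<phi> \<phi>3" "\<forall>N a s. sat N a s \<phi>3 \<longrightarrow> sat N a s \<phi>' \<and> sat N a s \<phi>2'" by blast
  then show ?case
    unfolding e(1) by (intro exI[of _ "ExH \<phi>3"]) (auto intro: weakening.intros)
next
  case (7 \<phi> \<phi>')
  from "7.prems" obtain \<phi>2' where e: "\<phi>2 = AllS \<phi>2'" "weakening \<phi> \<phi>2'"
    by (cases rule: weakening.cases) auto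
  from "7.IH"(1)[OF e(2)] obtain \<phi>3 where
    "weakening \<phi> \<phi>3" "\<forall>N a s. sat N a s \<phi>3 \<longrightarrow> sat N a s \<phi>' \<and> sat N a s \<phi>2'" by blast
  then show ?case
    unfolding e(1) by (intro exI[of _ "AllS \<phi>3"]) (auto intro: weakening.intros)
next
  case (8 \<phi> \<phi>')
  from "8.prems" obtain \<phi>2' where e: "\<phi>2 = ExS \<phi>2'" "weakening \<phi> \<phi>2'"
    by (cases rule: weakening.cases) auto
  from "8.IH"(1)[OF e(2)] obtain \<phi>3 where
    "weakening \<phi> \<phi>3" "\<forall>N a s. sat N a s \<phi>3 \<longrightarrow> sat N a s \<phi>' \<and> sat N a s \<phi>2'" by blast
  then show ?case
    unfolding e(1) by (intro exI[of _ "ExS \<phi>3"]) (auto intro: weakening.intros)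
qed

lemma weakening_finitely_directed:
  assumes "finite Q" "\<forall>\<phi>'\<in>Q. weakening \<phi> \<phi>'" "continuous_form L B n m (\<phi> :: ('f, 'r, 'g, 'm, 's) pform)"
  shows "\<exists>\<phi>0. weakening \<phi> \<phi>0 \<and> (\<forall>N a s. sat N a s \<phi>0 \<longrightarrow> (\<forall>\<phi>'\<in>Q. sat N a s \<phi>'))"
  using assms(1,2)
proof induction
  case empty
  show ?case using weakening_exists[OF assms(3)] by auto
next
  case (insert \<psi> Q)
  then obtain \<phi>0 where *: "weakening \<phi> \<phi>0" "\<forall>N a s. sat N a s \<phi>0 \<longrightarrow> (\<forall>\<phi>'\<in>Q. sat N a s \<phi>')" by auto
  obtain \<phi>3 where "weakening \<phi> \<phi>3" "\<forall>N a s. sat N a s \<phi>3 \<longrightarrow> sat N a s \<phi>0 \<and> sat N a s \<psi>"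
    using weakening_directed[OF *(1), of \<psi>] insert.prems by auto
  then show ?case using *(2) by (intro exI[of _ \<phi>3]) blast
qed

text \<open>Negation is pushed down to the atoms by dualizing connectives and quantifiers; there the
  complement of an open set between \<open>C\<close> and \<open>C'\<close> is compact. The resulting
  \<nu> replaces negation wherever saturation needs a positive formula.\<close>

lemma strong_negation:
  "weakening \<phi> \<phi>' \<Longrightarrow> continuous_form L B n m (\<phi> :: ('f, 'r, 'g, 'm, 's) pform) \<Longrightarrow>
    \<exists>\<nu>. continuous_form L B n m \<nu> \<and>
      (\<forall>N a s. (\<not> sat N a s \<phi>' \<longrightarrow> sat N a s \<nu>) \<and> (sat N a s \<nu> \<longrightarrow> \<not> sat N a s \<phi>))"
proof (induction arbitrary: n m rule: weakening.induct)
  case (2 ts C C')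
  define X where "X = (Spow (length ts) :: (nat \<Rightarrow> 's) topology)"
  obtain V where V: "openin X V" "C \<subseteq> V" "V \<subseteq> C'"
    using "2.hyps" by (auto simp: compact_nbhd_def X_def)
  have "compactin X (topspace X - V)"
    using V compact_Spow[OF compact_UNIV] unfolding X_def by (intro closedin_compact_space) auto
  moreover have "tup (map (seval N a s) ts) \<in> topspace X" for N a s
    unfolding X_def by (rule tup_in_topspace) simp
  ultimately show ?case
    using V "2.prems" unfolding X_def
    by (intro exI[of _ "In ts (topspace (Spow (length ts)) - V)"]) auto
next
  case (3 \<phi> \<phi>' \<psi> \<psi>')
  from "3.prems" "3.IH"[of n m] obtain \<nu>1 \<nu>2 where
    "continuous_form L B n m \<nu>1" "\<forall>N a s. (\<not> sat N a s \<phi>' \<longrightarrow> sat N a s \<nu>1) \<and> (sat N a s \<nu>1 \<longrightarrow> \<not> sat N a s \<phi>)"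
    "continuous_form L B n m \<nu>2" "\<forall>N a s. (\<not> sat N a s \<psi>' \<longrightarrow> sat N a s \<nu>2) \<and> (sat N a s \<nu>2 \<longrightarrow> \<not> sat N a s \<psi>)"
    by auto
  then show ?case by (intro exI[of _ "Or \<nu>1 \<nu>2"]) auto
next
  case (4 \<phi> \<phi>' \<psi> \<psi>')
  from "4.prems" "4.IH"[of n m] obtain \<nu>1 \<nu>2 where
    "continuous_form L B n m \<nu>1" "\<forall>N a s. (\<not> sat N a s \<phi>' \<longrightarrow> sat N a s \<nu>1) \<and> (sat N a s \<nu>1 \<longrightarrow> \<not> sat N a s \<phi>)"
    "continuous_form L B n m \<nu>2" "\<forall>N a s. (\<not> sat N a s \<psi>' \<longrightarrow> sat N a s \<nu>2) \<and> (sat N a s \<nu>2 \<longrightarrow> \<not> sat N a s \<psi>)"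
    by auto
  then show ?case by (intro exI[of _ "And \<nu>1 \<nu>2"]) auto
next
  case (5 \<phi> \<phi>')
  from "5.prems" "5.IH"[of "Suc n" m] obtain \<nu> where "continuous_form L B (Suc n) m \<nu>"
    "\<forall>N a s. (\<not> sat N a s \<phi>' \<longrightarrow> sat N a s \<nu>) \<and> (sat N a s \<nu> \<longrightarrow> \<not> sat N a s \<phi>)" by auto
  then show ?case by (intro exI[of _ "ExH \<nu>"]) auto
next
  case (6 \<phi> \<phi>')
  from "6.prems" "6.IH"[of "Suc n" m] obtain \<nu> where "continuous_form L B (Suc n) m \<nu>"
    "\<forall>N a s. (\<not> sat N a s \<phi>' \<longrightarrow> sat N a s \<nu>) \<and> (sat N a s \<nu> \<longrightarrow> \<not> sat N a s \<phi>)" by auto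
  then show ?case by (intro exI[of _ "AllH \<nu>"]) auto
next
  case (7 \<phi> \<phi>')
  from "7.prems" "7.IH"[of n "Suc m"] obtain \<nu> where "continuous_form L B n (Suc m) \<nu>"
    "\<forall>N a s. (\<not> sat N a s \<phi>' \<longrightarrow> sat N a s \<nu>) \<and> (sat N a s \<nu> \<longrightarrow> \<not> sat N a s \<phi>)" by auto
  then show ?case by (intro exI[of _ "ExS \<nu>"]) auto
next
  case (8 \<phi> \<phi>')
  from "8.prems" "8.IH"[of n "Suc m"] obtain \<nu> where "continuous_form L B n (Suc m) \<nu>"
    "\<forall>N a s. (\<not> sat N a s \<phi>' \<longrightarrow> sat N a s \<nu>) \<and> (sat N a s \<nu> \<longrightarrow> \<not> sat N a s \<phi>)" by auto
  then show ?case by (intro exI[of _ "AllS \<nu>"]) auto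
qed simp

end

section \<open>Consequences of saturation\<close>

text \<open>Largeness of the monster structure is used as uncountability: countable sets of
  parameters are then small enough for \<open>p_saturated\<close>.\<close>

locale saturated_structure =
  fixes L :: "('f, 'r, 'g) lang"
    and U :: "('f, 'r, 'g, 'm, 's::t2_space) struct"
  assumes compact_S: "compact (UNIV :: 's set)"
    and standard: "standard_structure L U"
    and uncountable_U: "uncountable (hdom U)"
    and saturated: "p_saturated L U"
begin

lemma hdom_nonempty: "hdom U \<noteq> {}"
  using uncountable_U by auto

lemma countable_lesspoll_hdom: "countable B \<Longrightarrow> B \<subseteq> hdom U \<Longrightarrow> B \<prec> hdom U"
  unfolding lesspoll_def using uncountable_U countable_lepoll eqpoll_sym
  by (meson eqpoll_imp_lepoll subset_imp_lepoll)

lemma saturation: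
  assumes "countable B" "B \<subseteq> hdom U" "\<forall>\<phi>\<in>q. continuous_form L B n m \<phi>"
    and "\<And>q0. finite q0 \<Longrightarrow> q0 \<subseteq> q \<Longrightarrow>
      \<exists>a\<in>tuples n (hdom U). \<exists>s\<in>tuples m UNIV. \<forall>\<phi>\<in>q0. sat U a s \<phi>"
  shows "\<exists>a\<in>tuples n (hdom U). \<exists>s\<in>tuples m UNIV. \<forall>\<phi>\<in>q. sat U a s \<phi>"
proof -
  have "\<forall>\<phi>\<in>q. positive L B n m \<phi>" using assms(3) continuous_form_positive by blast
  then show ?thesis
    using saturated[unfolded p_saturated_def, rule_format, of B q n m]
      assms countable_lesspoll_hdom[of B] by blast
qed

text \<open>A formula is equivalent in \<open>U\<close> to the set of its weakenings. Only the
  existential quantifiers are a problem, since each weakening of the body might have its own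
  witness; saturation supplies one common witness, to which the induction hypothesis
  applies.\<close>

lemma weakening_separates:
  assumes "countable B" "B \<subseteq> hdom U"
  shows "continuous_form L B n m \<phi> \<Longrightarrow> a \<in> tuples n (hdom U) \<Longrightarrow> s \<in> tuples m UNIV \<Longrightarrow>
    \<not> sat U a s \<phi> \<Longrightarrow> \<exists>\<phi>'. weakening \<phi> \<phi>' \<and> \<not> sat U a s \<phi>'"
proof (induction \<phi> arbitrary: n m a s)
  case (In ts C)
  let ?X = "Spow (length ts)" and ?p = "tup (map (seval U a s) ts)"
  have p: "?p \<in> topspace ?X" by (simp add: tup_in_topspace)
  have C: "compactin ?X C" using In by simp
  have "openin ?X (topspace ?X - {?p})"
    using closedin_Hausdorff_singleton[OF Hausdorff_Spow p] by blast
  moreover have "C \<subseteq> topspace ?X - {?p}"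
    using In compactin_subset_topspace[OF C] by auto
  ultimately obtain C' where "compact_nbhd ?X C C'" "C' \<subseteq> topspace ?X - {?p}"
    using compact_nbhd_between[OF compact_Spow[OF compact_S] Hausdorff_Spow C] by metis
  then show ?case
    by (intro exI[of _ "In ts C'"]) (auto intro: weakening.intros)
next
  case (And \<phi> \<psi>)
  have c: "continuous_form L B n m \<phi>" "continuous_form L B n m \<psi>" using And.prems by auto
  obtain \<phi>0 \<psi>0 where w: "weakening \<phi> \<phi>0" "weakening \<psi> \<psi>0"
    using weakening_exists[OF compact_S] c by blast
  show ?case
  proof (cases "sat U a s \<phi>")
    case False
    with And.IH(1)[OF c(1)] And.prems obtain \<phi>' where "weakening \<phi> \<phi>'" "\<not> sat U a s \<phi>'" by blast
    with w show ?thesis by (intro exI[of _ "And \<phi>' \<psi>0"]) (auto intro: weakening.intros)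
  next
    case True
    then have "\<not> sat U a s \<psi>" using And.prems by simp
    with And.IH(2)[OF c(2)] And.prems obtain \<psi>' where "weakening \<psi> \<psi>'" "\<not> sat U a s \<psi>'" by blast
    with w show ?thesis by (intro exI[of _ "And \<phi>0 \<psi>'"]) (auto intro: weakening.intros)
  qed
next
  case (Or \<phi> \<psi>)
  have c: "continuous_form L B n m \<phi>" "continuous_form L B n m \<psi>" using Or.prems by auto
  obtain \<phi>' \<psi>' where "weakening \<phi> \<phi>'" "\<not> sat U a s \<phi>'" "weakening \<psi> \<psi>'" "\<not> sat U a s \<psi>'"
    using Or.IH(1)[OF c(1) Or.prems(2,3)] Or.IH(2)[OF c(2) Or.prems(2,3)] Or.prems(4) by auto
  then show ?case by (intro exI[of _ "Or \<phi>' \<psi>'"]) (auto intro: weakening.intros)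
next
  case (AllH \<phi>)
  then obtain b where b: "b \<in> hdom U" "\<not> sat U (b # a) s \<phi>" by auto
  have "b # a \<in> tuples (Suc n) (hdom U)" using AllH.prems b by (auto simp: tuples_def)
  then obtain \<phi>' where "weakening \<phi> \<phi>'" "\<not> sat U (b # a) s \<phi>'"
    using AllH.IH[of "Suc n" m "b # a" s] AllH.prems b by auto
  then show ?case using b by (intro exI[of _ "AllH \<phi>'"]) (auto intro: weakening.intros)
next
  case (AllS \<phi>)
  then obtain b where b: "\<not> sat U a (b # s) \<phi>" by auto
  have "b # s \<in> tuples (Suc m) UNIV" using AllS.prems by (auto simp: tuples_def)
  then obtain \<phi>' where "weakening \<phi> \<phi>'" "\<not> sat U a (b # s) \<phi>'"
    using AllS.IH[of n "Suc m" a "b # s"] AllS.prems b by auto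
  then show ?case by (intro exI[of _ "AllS \<phi>'"]) (auto intro: weakening.intros)
next
  case (ExH \<phi>)
  have c: "continuous_form L B (Suc n) m \<phi>" using ExH.prems by simp
  \<comment> \<open>The tuple \<open>a\<close> is frozen as parameters and \<open>s\<close> as
    constants, so the candidate witness remains as the only free variable.\<close>
  define \<sigma> :: "nat \<Rightarrow> ('f, 'm) hterm" where "\<sigma> = case_nat (HVar 0) (\<lambda>i. HPar (a ! i))"
  define \<rho> :: "nat \<Rightarrow> nat + 's" where "\<rho> i = Inr (s ! i)" for i
  have sub: "sat U [b] [] (psub \<sigma> \<rho> \<phi>') \<longleftrightarrow> sat U (b # a) s \<phi>'" if "weakening \<phi> \<phi>'" for b \<phi>'
    using weakening_continuous_form[OF compact_S that c]
    by (rule sat_psub) (auto simp: \<sigma>_def \<rho>_def split: nat.split)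
  show ?case
  proof (rule ccontr)
    assume "\<nexists>\<psi>. weakening (ExH \<phi>) \<psi> \<and> \<not> sat U a s \<psi>"
    then have H: "\<exists>b\<in>hdom U. sat U (b # a) s \<phi>'" if "weakening \<phi> \<phi>'" for \<phi>'
      using weakening.intros(6)[OF that] by auto
    let ?q = "psub \<sigma> \<rho> ` {\<phi>'. weakening \<phi> \<phi>'}"
    have "\<exists>a\<in>tuples 1 (hdom U). \<exists>s\<in>tuples 0 UNIV. \<forall>\<phi>\<in>?q. sat U a s \<phi>"
    proof (rule saturation)
      show "countable (B \<union> set a)" "B \<union> set a \<subseteq> hdom U"
        using assms ExH.prems by (auto simp: tuples_def countable_finite)
      have "continuous_form L (B \<union> set a) 1 0 (psub \<sigma> \<rho> \<phi>')" if "weakening \<phi> \<phi>'" for \<phi>'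
        using weakening_continuous_form[OF compact_S that c]
        by (rule continuous_form_psub)
          (use ExH.prems in \<open>auto simp: \<sigma>_def \<rho>_def tuples_def split: nat.split\<close>)
      then show "\<forall>\<phi>\<in>?q. continuous_form L (B \<union> set a) 1 0 \<phi>" by auto
    next
      fix q0 assume "finite q0" "q0 \<subseteq> ?q"
      then obtain Q where Q: "finite Q" "Q \<subseteq> {\<phi>'. weakening \<phi> \<phi>'}" "q0 = psub \<sigma> \<rho> ` Q"
        by (meson finite_subset_image)
      \<comment> \<open>A single weakening below the finitely many in \<open>Q\<close>: its witness
        serves for all of them.\<close>
      obtain \<phi>0 where \<phi>0: "weakening \<phi> \<phi>0" "\<forall>N a s. sat N a s \<phi>0 \<longrightarrow> (\<forall>\<phi>'\<in>Q. sat N a s \<phi>')"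
        using weakening_finitely_directed[OF compact_S Q(1) _ c] Q(2) by blast
      obtain b where "b \<in> hdom U" "sat U (b # a) s \<phi>0" using H[OF \<phi>0(1)] by blast
      then have "\<forall>\<psi>\<in>q0. sat U [b] [] \<psi>" using \<phi>0(2) Q sub by auto
      then show "\<exists>a\<in>tuples 1 (hdom U). \<exists>s\<in>tuples 0 UNIV. \<forall>\<psi>\<in>q0. sat U a s \<psi>"
        using \<open>b \<in> hdom U\<close> by (intro bexI[of _ "[b]"]) (auto simp: tuples_def)
    qed
    then obtain b where b: "b \<in> hdom U" "\<forall>\<phi>'. weakening \<phi> \<phi>' \<longrightarrow> sat U (b # a) s \<phi>'"
      using sub by (auto simp: tuples_Suc)
    have "b # a \<in> tuples (Suc n) (hdom U)" using ExH.prems b by (auto simp: tuples_def)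
    then have "sat U (b # a) s \<phi>" using ExH.IH[OF c _ ExH.prems(3)] b by blast
    then show False using ExH.prems b by auto
  qed
next
  case (ExS \<phi>)
  have c: "continuous_form L B n (Suc m) \<phi>" using ExS.prems by simp
  define \<sigma> :: "nat \<Rightarrow> ('f, 'm) hterm" where "\<sigma> i = HPar (a ! i)" for i
  define \<rho> :: "nat \<Rightarrow> nat + 's" where "\<rho> = case_nat (Inl 0) (\<lambda>i. Inr (s ! i))"
  have sub: "sat U [] [b] (psub \<sigma> \<rho> \<phi>') \<longleftrightarrow> sat U a (b # s) \<phi>'" if "weakening \<phi> \<phi>'" for b \<phi>'
    using weakening_continuous_form[OF compact_S that c]
    by (rule sat_psub) (auto simp: \<sigma>_def \<rho>_def split: nat.split)
  show ?case
  proof (rule ccontr)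
    assume "\<nexists>\<psi>. weakening (ExS \<phi>) \<psi> \<and> \<not> sat U a s \<psi>"
    then have H: "\<exists>b. sat U a (b # s) \<phi>'" if "weakening \<phi> \<phi>'" for \<phi>'
      using weakening.intros(8)[OF that] by auto
    let ?q = "psub \<sigma> \<rho> ` {\<phi>'. weakening \<phi> \<phi>'}"
    have "\<exists>a\<in>tuples 0 (hdom U). \<exists>s\<in>tuples 1 UNIV. \<forall>\<phi>\<in>?q. sat U a s \<phi>"
    proof (rule saturation)
      show "countable (B \<union> set a)" "B \<union> set a \<subseteq> hdom U"
        using assms ExS.prems by (auto simp: tuples_def countable_finite)
      have "continuous_form L (B \<union> set a) 0 1 (psub \<sigma> \<rho> \<phi>')" if "weakening \<phi> \<phi>'" for \<phi>'
        using weakening_continuous_form[OF compact_S that c]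
        by (rule continuous_form_psub)
          (use ExS.prems in \<open>auto simp: \<sigma>_def \<rho>_def tuples_def split: nat.split\<close>)
      then show "\<forall>\<phi>\<in>?q. continuous_form L (B \<union> set a) 0 1 \<phi>" by auto
    next
      fix q0 assume "finite q0" "q0 \<subseteq> ?q"
      then obtain Q where Q: "finite Q" "Q \<subseteq> {\<phi>'. weakening \<phi> \<phi>'}" "q0 = psub \<sigma> \<rho> ` Q"
        by (meson finite_subset_image)
      obtain \<phi>0 where \<phi>0: "weakening \<phi> \<phi>0" "\<forall>N a s. sat N a s \<phi>0 \<longrightarrow> (\<forall>\<phi>'\<in>Q. sat N a s \<phi>')"
        using weakening_finitely_directed[OF compact_S Q(1) _ c] Q(2) by blast
      obtain b where "sat U a (b # s) \<phi>0" using H[OF \<phi>0(1)] by blast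
      then have "\<forall>\<psi>\<in>q0. sat U [] [b] \<psi>" using \<phi>0(2) Q sub by auto
      then show "\<exists>a\<in>tuples 0 (hdom U). \<exists>s\<in>tuples 1 UNIV. \<forall>\<psi>\<in>q0. sat U a s \<psi>"
        by (intro bexI[of _ "[]"] bexI[of _ "[b]"]) (auto simp: tuples_def)
    qed
    then obtain b where b: "\<forall>\<phi>'. weakening \<phi> \<phi>' \<longrightarrow> sat U a (b # s) \<phi>'"
      using sub by (auto simp: tuples_Suc)
    have "b # s \<in> tuples (Suc m) UNIV" using ExS.prems by (auto simp: tuples_def)
    then have "sat U a (b # s) \<phi>" using ExS.IH[OF c ExS.prems(2)] b by blast
    then show False using ExS.prems by auto
  qed
qed simp

end

section \<open>The relations \<open>\<sim>\<^sub>\<epsilon>\<close>\<close>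

text \<open>The quantifier block puts \<open>z\<close> in front, so the body is read in
  \<open>z @ x @ y\<close>, whereas the terms of an index expect \<open>x @ z\<close> or
  \<open>y @ z\<close>. In the substitutions \<open>k\<close> skips \<open>z\<close>,
  \<open>k + n\<close> skips \<open>z @ x\<close>, and \<open>i - n\<close> finds the entry of
  \<open>z\<close>.\<close>

fun near_form :: "nat \<Rightarrow> nat \<times> ('f, 'g, 'm, 's::t2_space) sterm list \<times> ('s \<times> 's) set
    \<Rightarrow> ('f, 'r, 'g, 'm, 's) pform" where
  "near_form n (k, \<tau>, D) = AllHs k (Conj (map (\<lambda>t. In
     [ssub (\<lambda>i. HVar (if i < n then k + i else i - n)) Inl t,
      ssub (\<lambda>i. HVar (if i < n then k + n + i else i - n)) Inl t] (pair_set D)) \<tau>))"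

context saturated_structure
begin

lemma diag_nbhd_compact: "compact_nbhd_diag euclidean (D :: ('s \<times> 's) set) \<Longrightarrow> compact D"
  by (simp add: compact_nbhd_diag_def compact_nbhd_def)

lemma near_refl: "\<epsilon> \<in> indices L n \<Longrightarrow> near U \<epsilon> a a"
  by (cases \<epsilon>) (auto simp: indices_def diag_nbhd_refl[OF compact_S])

lemma indices_nonempty: "(0, [], UNIV :: ('s \<times> 's) set) \<in> indices L n"
  by (simp add: indices_def diag_nbhd_UNIV[OF compact_S])

lemma continuous_near_form:
  fixes \<epsilon> :: "nat \<times> ('f, 'g, 'm, 's) sterm list \<times> ('s \<times> 's) set"
  assumes "\<epsilon> \<in> indices L n"
  shows "continuous_form L {} (n + n) 0 (near_form n \<epsilon>)"
proof -
  obtain k \<tau> D where e: "\<epsilon> = (k, \<tau>, D)" by (cases \<epsilon>)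
  have "compactin (Spow 2) (pair_set D)"
    using assms e by (intro compactin_pair_set compact_S diag_nbhd_compact) (auto simp: indices_def)
  moreover have *: "sterm_in L {} (k + (n + n)) 0 (ssub \<sigma> Inl t)"
    if "t \<in> set \<tau>" "\<forall>i<n + k. hterm_in L {} (k + (n + n)) (\<sigma> i)" for \<sigma> t
    using assms e that by (intro sterm_in_ssub[of L "{}" "n + k" 0]) (auto simp: indices_def)
  have "sterm_in L {} (k + (n + n)) 0 (ssub (\<lambda>i. HVar (if i < n then k + i else i - n)) Inl t)"
    "sterm_in L {} (k + (n + n)) 0 (ssub (\<lambda>i. HVar (if i < n then k + n + i else i - n)) Inl t)"
    if "t \<in> set \<tau>" for t
    by (intro *[OF that]; auto)+
  ultimately show ?thesis
    unfolding e by (simp add: continuous_form_Conj[OF compact_S] numeral_2_eq_2)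
qed

lemma sat_near_form:
  fixes \<epsilon> :: "nat \<times> ('f, 'g, 'm, 's) sterm list \<times> ('s \<times> 's) set"
  assumes "\<epsilon> \<in> indices L n" "length a = n" "length b = n"
  shows "sat U (a @ b) [] (near_form n \<epsilon>) \<longleftrightarrow> near U \<epsilon> a b"
proof -
  obtain k \<tau> D where e: "\<epsilon> = (k, \<tau>, D)" by (cases \<epsilon>)
  have t: "sterm_in L {} (n + k) 0 t" if "t \<in> set \<tau>" for t
    using assms e that by (auto simp: indices_def)
  have "seval U (z @ a @ b) [] (ssub (\<lambda>i. HVar (if i < n then k + i else i - n)) Inl t) = seval U (a @ z) [] t"
    "seval U (z @ a @ b) [] (ssub (\<lambda>i. HVar (if i < n then k + n + i else i - n)) Inl t) = seval U (b @ z) [] t"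
    if "t \<in> set \<tau>" "z \<in> tuples k (hdom U)" for t z
    using assms that by (intro seval_ssub[OF t]; auto simp: nth_append tuples_def)+
  then show ?thesis
    unfolding e by (auto simp: sat_AllHs)
qed

lemma weakening_near_form:
  assumes "compact_nbhd euclidean D D'"
  shows "weakening (near_form n (k, \<tau>, D) :: ('f, 'r, 'g, 'm, 's) pform) (near_form n (k, \<tau>, D'))"
proof -
  have "compact_nbhd (Spow (Suc (Suc 0))) (pair_set D) (pair_set D')"
    using compact_nbhd_pair_set[OF compact_S assms] by (simp add: numeral_2_eq_2)
  then show ?thesis
    by (auto simp: list.rel_map list.rel_refl
        intro!: weakening_AllHs weakening_Conj[OF compact_S] weakening.intros list.rel_refl_strong)
qed

lemma near_form_weakening:
  fixes \<epsilon> :: "nat \<times> ('f, 'g, 'm, 's) sterm list \<times> ('s \<times> 's) set"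
  assumes "\<epsilon> \<in> indices L n"
  obtains \<epsilon>0 where "\<epsilon>0 \<in> indices L n" "weakening (near_form n \<epsilon>0 :: ('f, 'r, 'g, 'm, 's) pform) (near_form n \<epsilon>)"
proof -
  obtain k \<tau> D where e: "\<epsilon> = (k, \<tau>, D)" by (cases \<epsilon>)
  obtain D0 where D0: "compact_nbhd_diag euclidean D0" "compact_nbhd euclidean D0 D"
    using diag_nbhd_shrink[OF compact_S, of D] assms e by (auto simp: indices_def)
  show ?thesis
  proof
    show "(k, \<tau>, D0) \<in> indices L n" using assms e D0 by (auto simp: indices_def)
    show "weakening (near_form n (k, \<tau>, D0) :: ('f, 'r, 'g, 'm, 's) pform) (near_form n \<epsilon>)"
      unfolding e by (rule weakening_near_form) fact
  qed
qed

text \<open>Nearness is a closed relation, but conditions and isolating formulas are negations of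
  continuous formulas. Here \<open>\<not> \<nu>\<close> is an open relation squeezed between the
  relations for \<open>\<epsilon>0\<close> and \<open>\<epsilon>\<close>; it is the strong negation
  belonging to the weakening of one into the other.\<close>

lemma far_form:
  fixes \<epsilon> :: "nat \<times> ('f, 'g, 'm, 's) sterm list \<times> ('s \<times> 's) set"
  assumes "\<epsilon> \<in> indices L n"
  obtains \<nu> \<epsilon>0 where "continuous_form L {} (n + n) 0 (\<nu> :: ('f, 'r, 'g, 'm, 's) pform)" "\<epsilon>0 \<in> indices L n"
    "\<And>a b. length a = n \<Longrightarrow> length b = n \<Longrightarrow> \<not> sat U (a @ b) [] \<nu> \<Longrightarrow> near U \<epsilon> a b"
    "\<And>a b. length a = n \<Longrightarrow> length b = n \<Longrightarrow> near U \<epsilon>0 a b \<Longrightarrow> \<not> sat U (a @ b) [] \<nu>"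
proof -
  obtain \<epsilon>0 where e0: "\<epsilon>0 \<in> indices L n"
    and w: "weakening (near_form n \<epsilon>0 :: ('f, 'r, 'g, 'm, 's) pform) (near_form n \<epsilon>)"
    using near_form_weakening[OF assms] .
  obtain \<nu> :: "('f, 'r, 'g, 'm, 's) pform" where \<nu>: "continuous_form L {} (n + n) 0 \<nu>"
    "\<forall>N a s. (\<not> sat N a s (near_form n \<epsilon>) \<longrightarrow> sat N a s \<nu>) \<and> (sat N a s \<nu> \<longrightarrow> \<not> sat N a s (near_form n \<epsilon>0))"
    using strong_negation[OF compact_S w continuous_near_form[OF e0]] by blast
  show ?thesis
    using that[OF \<nu>(1) e0] \<nu>(2) sat_near_form[OF assms] sat_near_form[OF e0] by blast
qed

text \<open>Indices with different numbers of variables \<open>z\<close> are compared by padding the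
  shorter tuple with an arbitrary element, which the terms do not see.\<close>

lemma near_mono:
  assumes "near U (k', \<tau>', D') a b" "k \<le> k'" "set \<tau> \<subseteq> set \<tau>'" "D' \<subseteq> D"
    "(k, \<tau>, D) \<in> indices L n" "length a = n" "length b = n"
  shows "near U (k, \<tau>, D) a b"
  unfolding near.simps
proof (intro ballI)
  fix t z assume t: "t \<in> set \<tau>" and z: "z \<in> tuples k (hdom U)"
  obtain c where c: "c \<in> hdom U" using hdom_nonempty by auto
  let ?z = "z @ replicate (k' - k) c"
  have "?z \<in> tuples k' (hdom U)" using z c assms(2) by (auto simp: tuples_def)
  moreover have "sterm_in L {} (n + k) 0 t" using assms(5) t by (auto simp: indices_def)
  then have "seval U (x @ ?z) [] t = seval U (x @ z) [] t" if "length x = n" for x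
    using that z by (intro seval_cong[of L "{}" "n + k" 0 t]) (auto simp: nth_append tuples_def)
  ultimately show "(seval U (a @ z) [] t, seval U (b @ z) [] t) \<in> D"
    using assms t by fastforce
qed

lemma indices_directed:
  fixes \<epsilon> :: "nat \<times> ('f, 'g, 'm, 's) sterm list \<times> ('s \<times> 's) set"
  assumes "\<epsilon> \<in> indices L n" "\<epsilon>' \<in> indices L n"
  obtains \<epsilon>'' where "\<epsilon>'' \<in> indices L n"
    "\<And>a b. length a = n \<Longrightarrow> length b = n \<Longrightarrow> near U \<epsilon>'' a b \<Longrightarrow> near U \<epsilon> a b \<and> near U \<epsilon>' a b"
proof -
  obtain k \<tau> D where e: "\<epsilon> = (k, \<tau>, D)" by (cases \<epsilon>)
  obtain k' \<tau>' D' where e': "\<epsilon>' = (k', \<tau>', D')" by (cases \<epsilon>')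
  show ?thesis
  proof
    show "(max k k', \<tau> @ \<tau>', D \<inter> D') \<in> indices L n"
    proof -
      have "sterm_in L {} (n + max k k') 0 t" if "t \<in> set \<tau>" for t
        using assms(1) that sterm_in_mono[of L "{}" "n + k" 0 t "{}" "n + max k k'" 0]
        unfolding e by (simp add: indices_def)
      moreover have "sterm_in L {} (n + max k k') 0 t" if "t \<in> set \<tau>'" for t
        using assms(2) that sterm_in_mono[of L "{}" "n + k'" 0 t "{}" "n + max k k'" 0]
        unfolding e' by (simp add: indices_def)
      ultimately show ?thesis
        using assms diag_nbhd_Int[OF compact_S, of D D'] unfolding e e' indices_def by auto
    qed
    show "near U \<epsilon> a b \<and> near U \<epsilon>' a b"
      if "length a = n" "length b = n" "near U (max k k', \<tau> @ \<tau>', D \<inter> D') a b" for a b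
      unfolding e e' using that assms unfolding e e' by (intro conjI; intro near_mono[OF that(3)]) auto
  qed
qed

lemma indices_finitely_directed:
  assumes "finite F" "F \<subseteq> indices L n"
  shows "\<exists>\<epsilon>\<in>indices L n. \<forall>a b. length a = n \<longrightarrow> length b = n \<longrightarrow> near U \<epsilon> a b \<longrightarrow> (\<forall>\<epsilon>'\<in>F. near U \<epsilon>' a b)"
  using assms
proof induction
  case empty
  show ?case using indices_nonempty by blast
next
  case (insert \<epsilon>1 F)
  then obtain \<epsilon>2 where 2: "\<epsilon>2 \<in> indices L n" "\<forall>a b. length a = n \<longrightarrow> length b = n \<longrightarrow> near U \<epsilon>2 a b \<longrightarrow> (\<forall>\<epsilon>'\<in>F. near U \<epsilon>' a b)"
    by auto
  have 1: "\<epsilon>1 \<in> indices L n" using insert by simp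
  obtain \<epsilon> where \<epsilon>: "\<epsilon> \<in> indices L n"
    "\<And>a b. length a = n \<Longrightarrow> length b = n \<Longrightarrow> near U \<epsilon> a b \<Longrightarrow> near U \<epsilon>1 a b \<and> near U \<epsilon>2 a b"
    using indices_directed[OF 1 2(1)] by metis
  have "\<forall>\<epsilon>'\<in>insert \<epsilon>1 F. near U \<epsilon>' a b" if "length a = n" "length b = n" "near U \<epsilon> a b" for a b
    using \<epsilon>(2)[OF that] 2(2) that(1,2) by blast
  then show ?case using \<epsilon>(1) by blast
qed

lemma indices_half:
  fixes \<epsilon> :: "nat \<times> ('f, 'g, 'm, 's) sterm list \<times> ('s \<times> 's) set"
  assumes "\<epsilon> \<in> indices L n"
  obtains \<epsilon>' where "\<epsilon>' \<in> indices L n" "\<And>a b. near U \<epsilon>' a b \<Longrightarrow> near U \<epsilon>' b a"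
    "\<And>a b c. near U \<epsilon>' a b \<Longrightarrow> near U \<epsilon>' b c \<Longrightarrow> near U \<epsilon> a c"
proof -
  obtain k \<tau> D where e: "\<epsilon> = (k, \<tau>, D)" by (cases \<epsilon>)
  obtain D1 where D1: "compact_nbhd_diag euclidean D1" "D1 O D1 \<subseteq> D" "sym D1"
    using diag_nbhd_half[OF compact_S, of D] assms e by (auto simp: indices_def)
  show ?thesis
  proof
    show "(k, \<tau>, D1) \<in> indices L n" using assms e D1 by (auto simp: indices_def)
    show "near U (k, \<tau>, D1) b a" if "near U (k, \<tau>, D1) a b" for a b
      using that D1(3) by (auto dest: symD)
    show "near U \<epsilon> a c" if "near U (k, \<tau>, D1) a b" "near U (k, \<tau>, D1) b c" for a b c
      using that D1(2) unfolding e near.simps by blast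
  qed
qed

text \<open>The relations are directed, so one index can stand for a finite set of them.\<close>

lemma Ccl_iff:
  "a \<in> Ccl L U M \<longleftrightarrow> a \<in> hdom U \<and> (\<forall>\<epsilon>\<in>indices L 1. \<exists>b\<in>M. near U \<epsilon> [a] [b])" (is "_ \<longleftrightarrow> ?R")
proof
  assume "a \<in> Ccl L U M"
  then have "a \<in> hdom U" and *: "finite F \<and> F \<subseteq> indices L 1 \<longrightarrow> (\<exists>b\<in>M. \<forall>\<epsilon>\<in>F. near U \<epsilon> [a] [b])" for F
    by (auto simp: Ccl_def)
  then show ?R using *[of "{_}"] by auto
next
  assume R: ?R
  have "\<exists>b\<in>M. \<forall>\<epsilon>\<in>F. near U \<epsilon> [a] [b]" if F: "finite F" "F \<subseteq> indices L 1" for F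
  proof -
    obtain \<epsilon> where \<epsilon>: "\<epsilon> \<in> indices L 1"
      "\<And>a b. length a = 1 \<Longrightarrow> length b = 1 \<Longrightarrow> near U \<epsilon> a b \<Longrightarrow> \<forall>\<epsilon>'\<in>F. near U \<epsilon>' a b"
      using indices_finitely_directed[OF F] by metis
    obtain b where "b \<in> M" "near U \<epsilon> [a] [b]" using R \<epsilon>(1) by blast
    then show ?thesis using \<epsilon>(2)[of "[a]" "[b]"] by auto
  qed
  then show "a \<in> Ccl L U M" using R by (simp add: Ccl_def)
qed

section \<open>Uniform continuity of continuous formulas\<close>

text \<open>The intersection of all the nearness relations on single elements. It is the relation
  that saturation produces in the limit.\<close>

definition indist :: "'m \<Rightarrow> 'm \<Rightarrow> bool" where
  "indist x y \<longleftrightarrow> x \<in> hdom U \<and> y \<in> hdom U \<and> (\<forall>\<epsilon>\<in>indices L 1. near U \<epsilon> [x] [y])"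

lemma indist_refl: "x \<in> hdom U \<Longrightarrow> indist x x"
  by (simp add: indist_def near_refl)

text \<open>A neighbourhood of the diagonal that separates the two values gives an index that
  separates \<open>x\<close> from \<open>y\<close>: the other arguments play the role of
  \<open>z\<close>, which is universally quantified in nearness, and the entries of \<open>s\<close>
  become constants of the term.\<close>

lemma seval_indist_single:
  assumes t: "sterm_in L {} n m t" and n: "n = length xs + Suc (length ys)"
    and xs: "set xs \<subseteq> hdom U" "set ys \<subseteq> hdom U" and xy: "indist x y"
  shows "seval U (xs @ x # ys) s t = seval U (xs @ y # ys) s t"
proof (rule ccontr)
  assume neq: "seval U (xs @ x # ys) s t \<noteq> seval U (xs @ y # ys) s t"
  then obtain D where D: "compact_nbhd_diag euclidean D"
    "(seval U (xs @ x # ys) s t, seval U (xs @ y # ys) s t) \<notin> D"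
    using diag_nbhd_separates[OF compact_S] by metis
  \<comment> \<open>Moves the distinguished argument to position 0, as an index for 1-tuples
    demands; entries of \<open>xs\<close> shift by one and those of \<open>ys\<close> stay.\<close>
  define \<sigma> :: "nat \<Rightarrow> ('f, 'm) hterm" where
    "\<sigma> i = HVar (if i < length xs then Suc i else if i = length xs then 0 else i)" for i
  define t' where "t' = ssub \<sigma> (\<lambda>i. Inr (s ! i)) t"
  have t': "seval U (z # xs @ ys) [] t' = seval U (xs @ z # ys) s t" for z
    unfolding t'_def using t
    by (rule seval_ssub) (auto simp: \<sigma>_def n nth_append nth_Cons' Suc_diff_le)
  have "sterm_in L {} n 0 t'"
    unfolding t'_def using t by (rule sterm_in_ssub) (auto simp: \<sigma>_def n)
  then have "(length (xs @ ys), [t'], D) \<in> indices L 1"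
    using D n by (simp add: indices_def)
  then have "near U (length (xs @ ys), [t'], D) [x] [y]"
    using xy by (auto simp: indist_def simp del: near.simps)
  moreover have "xs @ ys \<in> tuples (length (xs @ ys)) (hdom U)"
    using xs by (simp add: tuples_def)
  ultimately have "(seval U (x # xs @ ys) [] t', seval U (y # xs @ ys) [] t') \<in> D"
    by (simp del: length_append)
  then show False using D(2) by (simp add: t')
qed

text \<open>Arguments are exchanged one at a time; \<open>zs\<close> holds those that have been
  exchanged already.\<close>

lemma seval_indist:
  assumes "list_all2 indist a a'"
  shows "set zs \<subseteq> hdom U \<Longrightarrow> sterm_in L {} (length (zs @ a)) m t \<Longrightarrow> seval U (zs @ a) s t = seval U (zs @ a') s t"
  using assms
proof (induction a a' arbitrary: zs rule: list_all2_induct)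
  case (Cons x xs y ys)
  have xs: "set xs \<subseteq> hdom U"
    using Cons.hyps(2) by (auto simp: list_all2_conv_all_nth indist_def in_set_conv_nth)
  have "seval U (zs @ x # xs) s t = seval U (zs @ y # xs) s t"
    using Cons.prems Cons.hyps xs by (intro seval_indist_single) auto
  also have "\<dots> = seval U (zs @ y # ys) s t"
    using Cons.IH[of "zs @ [y]"] Cons.prems Cons.hyps by (simp add: indist_def)
  finally show ?case .
qed simp

lemma sat_indist:
  "continuous_form L {} n m \<phi> \<Longrightarrow> length a = n \<Longrightarrow> list_all2 indist a a' \<Longrightarrow>
    sat U a s \<phi> \<longleftrightarrow> sat U a' s \<phi>"
proof (induction \<phi> arbitrary: n m a a' s)
  case (In ts C)
  then have "map (seval U a s) ts = map (seval U a' s) ts"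
    using seval_indist[of a a' "[]" m] by auto
  then show ?case by (simp only: sat.simps)
next
  case (And \<phi> \<psi>)
  from And.prems show ?case using And.IH[of n m a a' s] by simp
next
  case (Or \<phi> \<psi>)
  from Or.prems show ?case using Or.IH[of n m a a' s] by simp
next
  case (AllH \<phi>)
  then have "sat U (b # a) s \<phi> = sat U (b # a') s \<phi>" if "b \<in> hdom U" for b
    using indist_refl that by (intro AllH.IH[of "Suc n" m]) simp_all
  then show ?case by simp
next
  case (ExH \<phi>)
  then have "sat U (b # a) s \<phi> = sat U (b # a') s \<phi>" if "b \<in> hdom U" for b
    using indist_refl that by (intro ExH.IH[of "Suc n" m]) simp_all
  then show ?case by simp
next
  case (AllS \<phi>)
  then have "sat U a (b # s) \<phi> = sat U a' (b # s) \<phi>" for b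
    by (intro AllS.IH[of n "Suc m"]) simp_all
  then show ?case by simp
next
  case (ExS \<phi>)
  then have "sat U a (b # s) \<phi> = sat U a' (b # s) \<phi>" for b
    by (intro ExS.IH[of n "Suc m"]) simp_all
  then show ?case by simp
qed simp

text \<open>A compactness argument: if every index failed, saturation would give indistinguishable
  tuples \<open>a\<close>, \<open>a'\<close> of which the former satisfies \<phi> and the latter
  does not, contrary to \<open>sat_indist\<close>. Nearness is measured entry by entry, with an
  index for single elements.\<close>

lemma uniform_continuity:
  assumes w: "weakening \<phi> \<phi>'" and c: "continuous_form L {} n 0 \<phi>"
  shows "\<exists>\<epsilon>\<in>indices L 1. \<forall>a\<in>tuples n (hdom U). \<forall>a'\<in>tuples n (hdom U).
    (\<forall>i<n. near U \<epsilon> [a ! i] [a' ! i]) \<longrightarrow> sat U a [] \<phi> \<longrightarrow> sat U a' [] \<phi>'"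
proof (rule ccontr)
  assume not: "\<not> ?thesis"
  have H: "\<exists>a\<in>tuples n (hdom U). \<exists>a'\<in>tuples n (hdom U). (\<forall>i<n. near U \<epsilon> [a ! i] [a' ! i]) \<and>
      sat U a [] \<phi> \<and> \<not> sat U a' [] \<phi>'" if "\<epsilon> \<in> indices L 1" for \<epsilon>
    using that not by blast
  \<comment> \<open>The failure of \<phi>' is not a positive condition; \<nu> follows from it and
    still excludes \<phi>.\<close>
  obtain \<nu> where \<nu>: "continuous_form L {} n 0 \<nu>"
    "\<forall>N a s. (\<not> sat N a s \<phi>' \<longrightarrow> sat N a s \<nu>) \<and> (sat N a s \<nu> \<longrightarrow> \<not> sat N a s \<phi>)"
    using strong_negation[OF compact_S w c] by blast
  \<comment> \<open>The type to be realized has \<open>n + n\<close> variables: \<phi> speaks of the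
    first half, \<open>\<nu>'\<close> of the second, and \<open>f (\<epsilon>, i)\<close> compares
    the entries number \<open>i\<close> of the two halves.\<close>
  define \<nu>' where "\<nu>' = psub (\<lambda>i. HVar (n + i)) Inl \<nu>"
  define f where "f = (\<lambda>(\<epsilon>, i). psub (case_nat (HVar i) (\<lambda>_. HVar (n + i))) Inl (near_form 1 \<epsilon>)
    :: ('f, 'r, 'g, 'm, 's) pform)"
  let ?P = "indices L 1 \<times> {..<n}"
  have sat\<nu>: "sat U (a @ a') [] \<nu>' \<longleftrightarrow> sat U a' [] \<nu>" if "length a = n" for a a'
    unfolding \<nu>'_def using \<nu>(1) by (rule sat_psub) (auto simp: that nth_append)
  have satf: "sat U (a @ a') [] (f (\<epsilon>, i)) \<longleftrightarrow> near U \<epsilon> [a ! i] [a' ! i]"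
    if "length a = n" "\<epsilon> \<in> indices L 1" "i < n" for a a' \<epsilon> i
  proof -
    have "sat U (a @ a') [] (f (\<epsilon>, i)) \<longleftrightarrow> sat U ([a ! i] @ [a' ! i]) [] (near_form 1 \<epsilon>)"
      unfolding f_def prod.case using continuous_near_form[OF that(2)]
      by (rule sat_psub) (auto simp: that nth_append less_Suc_eq_0_disj)
    then show ?thesis using sat_near_form[OF that(2), of "[a ! i]" "[a' ! i]"] by simp
  qed
  have "\<exists>a\<in>tuples (n + n) (hdom U). \<exists>s\<in>tuples 0 UNIV. \<forall>\<psi>\<in>{\<phi>, \<nu>'} \<union> f ` ?P. sat U a s \<psi>"
  proof (rule saturation)
    show "countable {}" "{} \<subseteq> hdom U" by auto
    have "continuous_form L {} (n + n) 0 \<phi>" by (rule continuous_form_mono[OF c]) auto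
    moreover have "continuous_form L {} (n + n) 0 \<nu>'"
      unfolding \<nu>'_def by (rule continuous_form_psub[OF \<nu>(1)]) auto
    moreover have "continuous_form L {} (n + n) 0 (f (\<epsilon>, i))" if "\<epsilon> \<in> indices L 1" "i < n" for \<epsilon> i
      unfolding f_def prod.case
      by (rule continuous_form_psub[OF continuous_near_form[OF that(1)]])
        (use that in \<open>auto simp: less_Suc_eq_0_disj\<close>)
    ultimately show "\<forall>\<psi>\<in>{\<phi>, \<nu>'} \<union> f ` ?P. continuous_form L {} (n + n) 0 \<psi>" by auto
  next
    fix q0 assume q0: "finite q0" "q0 \<subseteq> {\<phi>, \<nu>'} \<union> f ` ?P"
    then have "finite (q0 - {\<phi>, \<nu>'})" "q0 - {\<phi>, \<nu>'} \<subseteq> f ` ?P" by auto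
    then obtain P where P: "P \<subseteq> ?P" "finite P" "q0 - {\<phi>, \<nu>'} = f ` P"
      by (meson finite_subset_image)
    then have "finite (fst ` P)" "fst ` P \<subseteq> indices L 1" by auto
    then obtain \<epsilon> where \<epsilon>: "\<epsilon> \<in> indices L 1"
      "\<And>a b. length a = 1 \<Longrightarrow> length b = 1 \<Longrightarrow> near U \<epsilon> a b \<Longrightarrow> \<forall>\<epsilon>'\<in>fst ` P. near U \<epsilon>' a b"
      using indices_finitely_directed by metis
    obtain a a' where a: "a \<in> tuples n (hdom U)" "a' \<in> tuples n (hdom U)" "\<forall>i<n. near U \<epsilon> [a ! i] [a' ! i]"
      "sat U a [] \<phi>" "\<not> sat U a' [] \<phi>'"
      using H[OF \<epsilon>(1)] by blast
    have len: "length a = n" using a by (simp add: tuples_def)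
    have "sat U (a @ a') [] \<psi>" if "\<psi> \<in> q0" for \<psi>
    proof (cases "\<psi> \<in> f ` P")
      case True
      then obtain \<epsilon>' i where p: "(\<epsilon>', i) \<in> P" "\<psi> = f (\<epsilon>', i)" by auto
      then have "\<epsilon>' \<in> indices L 1" "i < n" "\<epsilon>' \<in> fst ` P" using P(1) by force+
      then show ?thesis using \<epsilon>(2)[of "[a ! i]" "[a' ! i]"] a(3) satf[OF len] p by auto
    next
      case False
      then have "\<psi> = \<phi> \<or> \<psi> = \<nu>'" using that P(3) by blast
      then show ?thesis
        using a \<nu>(2) sat\<nu>[OF len] sat_append[OF c len] by auto
    qed
    then show "\<exists>a\<in>tuples (n + n) (hdom U). \<exists>s\<in>tuples 0 UNIV. \<forall>\<psi>\<in>q0. sat U a s \<psi>"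
      using tuples_append[OF a(1,2)] by (intro bexI[of _ "a @ a'"] bexI[of _ "[]"]) simp_all
  qed
  then obtain c' where c': "c' \<in> tuples (n + n) (hdom U)" "\<forall>\<psi>\<in>{\<phi>, \<nu>'} \<union> f ` ?P. sat U c' [] \<psi>"
    by auto
  define a a' where "a = take n c'" and "a' = drop n c'"
  have c'_eq: "c' = a @ a'" and len: "length a = n" "length a' = n"
    and sub: "set a \<subseteq> hdom U" "set a' \<subseteq> hdom U"
    using c'(1) set_take_subset[of n c'] set_drop_subset[of n c'] by (auto simp: a_def a'_def tuples_def)
  have "sat U a [] \<phi>" using c'(2) sat_append[OF c len(1)] by (simp add: c'_eq)
  have "sat U a' [] \<nu>" using c'(2) sat\<nu>[OF len(1)] by (simp add: c'_eq)
  then have "\<not> sat U a' [] \<phi>" using \<nu>(2) by blast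
  have "indist (a ! i) (a' ! i)" if "i < n" for i
  proof -
    have "near U \<epsilon> [a ! i] [a' ! i]" if \<epsilon>: "\<epsilon> \<in> indices L 1" for \<epsilon>
    proof -
      have "f (\<epsilon>, i) \<in> f ` ?P" using \<epsilon> \<open>i < n\<close> by blast
      then show ?thesis using satf[OF len(1) \<epsilon> \<open>i < n\<close>] c'(2) unfolding c'_eq by blast
    qed
    then show ?thesis unfolding indist_def using that sub len by auto
  qed
  then have "list_all2 indist a a'"
    using len by (simp add: list_all2_conv_all_nth)
  then show False
    using sat_indist[OF c len(1)] \<open>sat U a [] \<phi>\<close> \<open>\<not> sat U a' [] \<phi>\<close> by blast
qed

end

section \<open>Generic sequences\<close>

text \<open>The prefix is listed backwards, so that an innermost quantifier binds its last entry.\<close>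

definition prefix_rev :: "(nat \<Rightarrow> 'a) \<Rightarrow> nat \<Rightarrow> 'a list" where
  "prefix_rev b i = map b (rev [0..<i])"

lemma prefix_rev_0 [simp]: "prefix_rev b 0 = []"
  by (simp add: prefix_rev_def)

lemma prefix_rev_Suc: "prefix_rev b (Suc i) = b i # prefix_rev b i"
  by (simp add: prefix_rev_def)

lemma length_prefix_rev [simp]: "length (prefix_rev b i) = i"
  by (simp add: prefix_rev_def)

lemma prefix_rev_nth: "v < i \<Longrightarrow> prefix_rev b i ! v = b (i - Suc v)"
  by (simp add: prefix_rev_def rev_nth)

lemma drop_prefix_rev: "drop d (prefix_rev b (d + i)) = prefix_rev b i"
  by (induction d) (simp_all add: prefix_rev_Suc)

lemma prefix_rev_tuples: "range b \<subseteq> X \<Longrightarrow> prefix_rev b i \<in> tuples i X"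
  by (auto simp: tuples_def prefix_rev_def)

lemma prefix_rev_cong: "(\<And>j. j < i \<Longrightarrow> b j = b' j) \<Longrightarrow> prefix_rev b i = prefix_rev b' i"
  by (auto simp: prefix_rev_def)

lemma prefix_rev_exists:
  assumes "w \<in> tuples i X" "X \<noteq> {}"
  obtains b where "range b \<subseteq> X" "prefix_rev b i = w"
proof -
  obtain c where c: "c \<in> X" using assms(2) by auto
  define b where "b j = (if j < i then rev w ! j else c)" for j
  have "prefix_rev b i = w"
    using assms(1) by (intro nth_equalityI) (auto simp: prefix_rev_nth b_def tuples_def rev_nth)
  moreover have "range b \<subseteq> X"
    using assms(1) c by (auto simp: b_def tuples_def rev_nth)
  ultimately show ?thesis using that by blast
qed

context saturated_structure
begin

text \<open>Failure of isolation concerns only formulas whose negation is consistent with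
  \<open>p\<close>; here that restriction is removed at the price of a finer index. The scales are:
  \<open>\<epsilon>\<close>, where isolation fails; \<open>\<epsilon>2\<close>, its half; and
  \<open>\<epsilon>1\<close>, which implies \<open>\<not> \<nu>\<close>, which in turn implies
  \<open>\<epsilon>2\<close>.\<close>

lemma not_isolated_uniform:
  assumes "\<not> approx_c_isolated L U n p A"
  obtains \<epsilon> where "\<epsilon> \<in> indices L n"
    "\<And>\<theta>. continuous_form L A n 0 \<theta> \<Longrightarrow> \<exists>b\<in>tuples n (hdom U). \<not> sat U b [] \<theta> \<Longrightarrow>
      \<exists>b\<in>tuples n (hdom U). \<not> sat U b [] \<theta> \<and> (\<forall>a\<in>tuples n (hdom U). realizes U a p \<longrightarrow> \<not> near U \<epsilon> b a)"
proof -
  obtain \<epsilon> where \<epsilon>: "\<epsilon> \<in> indices L n"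
    and iso: "\<And>\<phi> a. continuous_form L A n 0 \<phi> \<Longrightarrow> a \<in> tuples n (hdom U) \<Longrightarrow> \<not> sat U a [] \<phi> \<Longrightarrow> realizes U a p \<Longrightarrow>
      \<exists>b\<in>tuples n (hdom U). \<not> sat U b [] \<phi> \<and> (\<forall>a\<in>tuples n (hdom U). realizes U a p \<longrightarrow> \<not> near U \<epsilon> b a)"
    using assms unfolding approx_c_isolated_def by blast
  obtain \<epsilon>2 where \<epsilon>2: "\<epsilon>2 \<in> indices L n" "\<And>a b. near U \<epsilon>2 a b \<Longrightarrow> near U \<epsilon>2 b a"
    "\<And>a b c. near U \<epsilon>2 a b \<Longrightarrow> near U \<epsilon>2 b c \<Longrightarrow> near U \<epsilon> a c"
    using indices_half[OF \<epsilon>] by metis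
  obtain \<nu> :: "('f, 'r, 'g, 'm, 's) pform" and \<epsilon>1 where
    \<nu>: "continuous_form L {} (n + n) 0 \<nu>" "\<epsilon>1 \<in> indices L n"
    "\<And>a b. length a = n \<Longrightarrow> length b = n \<Longrightarrow> \<not> sat U (a @ b) [] \<nu> \<Longrightarrow> near U \<epsilon>2 a b"
    "\<And>a b. length a = n \<Longrightarrow> length b = n \<Longrightarrow> near U \<epsilon>1 a b \<Longrightarrow> \<not> sat U (a @ b) [] \<nu>"
    using far_form[OF \<epsilon>2(1)] by metis
  show ?thesis
  proof (rule that[OF \<nu>(2)])
    fix \<theta> assume \<theta>: "continuous_form L A n 0 \<theta>" and "\<exists>b\<in>tuples n (hdom U). \<not> sat U b [] \<theta>"
    then obtain b where b: "b \<in> tuples n (hdom U)" "\<not> sat U b [] \<theta>" by blast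
    \<comment> \<open>The set defined by \<open>\<not> \<phi>\<close> is an open enlargement of the
      one defined by \<open>\<not> \<theta>\<close>; it contains every realization of
      \<open>p\<close> that is \<open>\<epsilon>1\<close>-near to a point of the latter.\<close>
    define \<phi> where "\<phi> = AllHs n (Or \<theta> \<nu>)"
    have \<phi>: "continuous_form L A n 0 \<phi>"
      unfolding \<phi>_def using continuous_form_mono[OF \<theta>, of A "n + n" 0] continuous_form_mono[OF \<nu>(1), of A "n + n" 0]
      by simp
    have sat\<phi>: "\<not> sat U x [] \<phi> \<longleftrightarrow> (\<exists>y\<in>tuples n (hdom U). \<not> sat U y [] \<theta> \<and> \<not> sat U (y @ x) [] \<nu>)" for x
      unfolding \<phi>_def using sat_append[OF \<theta>] by (auto simp: sat_AllHs tuples_length)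
    show "\<exists>b\<in>tuples n (hdom U). \<not> sat U b [] \<theta> \<and> (\<forall>a\<in>tuples n (hdom U). realizes U a p \<longrightarrow> \<not> near U \<epsilon>1 b a)"
    proof (cases "\<exists>a\<in>tuples n (hdom U). realizes U a p \<and> near U \<epsilon>1 b a")
      case False
      then show ?thesis using b by blast
    next
      case True
      then obtain a where a: "a \<in> tuples n (hdom U)" "realizes U a p" "near U \<epsilon>1 b a" by blast
      then have "\<not> sat U a [] \<phi>"
        using sat\<phi> b \<nu>(4)[of b a] by (auto simp: tuples_length)
      then obtain c where c: "c \<in> tuples n (hdom U)" "\<not> sat U c [] \<phi>"
        "\<forall>a\<in>tuples n (hdom U). realizes U a p \<longrightarrow> \<not> near U \<epsilon> c a"
        using iso[OF \<phi> a(1) _ a(2)] by blast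
      \<comment> \<open>This \<open>y\<close> is the point sought: it is within
        \<open>\<epsilon>2\<close> of \<open>c\<close>, so a realization
        \<open>\<epsilon>1\<close>-near to \<open>y\<close> would be \<open>\<epsilon>\<close>-near
        to \<open>c\<close>.\<close>
      then obtain y where y: "y \<in> tuples n (hdom U)" "\<not> sat U y [] \<theta>" "\<not> sat U (y @ c) [] \<nu>"
        using sat\<phi> by blast
      have "near U \<epsilon>2 c y"
        using \<nu>(3)[of y c] y c \<epsilon>2(2) tuples_length by blast
      have "\<not> near U \<epsilon>1 y a'" if a': "a' \<in> tuples n (hdom U)" "realizes U a' p" for a'
      proof
        assume "near U \<epsilon>1 y a'"
        then have "near U \<epsilon>2 y a'" using \<nu>(3,4) y a' tuples_length by metis
        then have "near U \<epsilon> c a'" using \<epsilon>2(3) \<open>near U \<epsilon>2 c y\<close> by blast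
        then show False using c(3) a' by blast
      qed
      then show ?thesis using y by blast
    qed
  qed
qed

text \<open>Prefixes are reversed, so lengthening one adds entries in front, and a formula about the
  old entries must look \<open>d\<close> places further on.\<close>

lemma shift_form:
  assumes "continuous_form L A i 0 \<phi>"
  obtains \<phi>' where "continuous_form L A (d + i) 0 \<phi>'"
    "\<And>w. length w = d + i \<Longrightarrow> sat U w [] \<phi>' \<longleftrightarrow> sat U (drop d w) [] \<phi>"
proof
  show "continuous_form L A (d + i) 0 (psub (\<lambda>v. HVar (d + v)) Inl \<phi>)"
    by (rule continuous_form_psub[OF assms]) auto
  show "sat U w [] (psub (\<lambda>v. HVar (d + v)) Inl \<phi>) \<longleftrightarrow> sat U (drop d w) [] \<phi>" if "length w = d + i" for w
    by (rule sat_psub[OF assms]) (auto simp: that)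
qed

text \<open>\<open>p_saturated\<close> realizes finite tuples only, so an infinite sequence is built
  entry by entry. The invariant is that each \<open>\<nu> k\<close> by itself can still be satisfied
  by a sequence through \<open>l\<close>. Being extendable in this sense is a continuous condition
  on the next entry, and by \<open>dec\<close> finitely many such conditions follow from the one
  with the largest index.\<close>

lemma omega_saturation_step:
  assumes A: "countable A" "A \<subseteq> hdom U"
    and \<nu>: "\<And>k. continuous_form L A (i k) 0 (\<nu> k)"
    and dec: "\<And>k b. range b \<subseteq> hdom U \<Longrightarrow> sat U (prefix_rev b (i (Suc k))) [] (\<nu> (Suc k)) \<Longrightarrow>
      sat U (prefix_rev b (i k)) [] (\<nu> k)"
    and l: "l \<in> tuples j (hdom U)"
    and inv: "\<And>k. \<exists>b. range b \<subseteq> hdom U \<and> prefix_rev b j = l \<and> sat U (prefix_rev b (i k)) [] (\<nu> k)"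
  shows "\<exists>x\<in>hdom U. \<forall>k. \<exists>b. range b \<subseteq> hdom U \<and> prefix_rev b (Suc j) = x # l \<and>
    sat U (prefix_rev b (i k)) [] (\<nu> k)"
proof -
  define E where "E k x \<longleftrightarrow> (\<exists>b. range b \<subseteq> hdom U \<and> prefix_rev b (Suc j) = x # l \<and>
    sat U (prefix_rev b (i k)) [] (\<nu> k))" for k x
  have "\<exists>F. continuous_form L (A \<union> set l) 1 0 F \<and> (\<forall>x\<in>hdom U. sat U [x] [] F \<longleftrightarrow> E k x)" for k
  proof -
    \<comment> \<open>A prefix of length \<open>i k + Suc j\<close> is long enough whichever of the
      two is larger: its last \<open>Suc j\<close> places are \<open>x # l\<close>, its last
      \<open>i k\<close> places are those read by \<open>\<nu> k\<close>, and the first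
      \<open>i k\<close> places are quantified away.\<close>
    obtain \<nu>' where \<nu>': "continuous_form L A (Suc j + i k) 0 \<nu>'"
      "\<And>w. length w = Suc j + i k \<Longrightarrow> sat U w [] \<nu>' \<longleftrightarrow> sat U (drop (Suc j) w) [] (\<nu> k)"
      using shift_form[OF \<nu>] by metis
    define \<psi> where "\<psi> = ExHs (i k) \<nu>'"
    have \<psi>: "continuous_form L A (Suc j) 0 \<psi>"
      using \<nu>'(1) by (simp add: \<psi>_def add.commute)
    define \<sigma> :: "nat \<Rightarrow> ('f, 'm) hterm" where "\<sigma> = case_nat (HVar 0) (\<lambda>v. HPar (l ! v))"
    have "continuous_form L (A \<union> set l) 1 0 (psub \<sigma> Inl \<psi>)"
      by (rule continuous_form_psub[OF \<psi>])
        (use l in \<open>auto simp: \<sigma>_def tuples_def less_Suc_eq_0_disj\<close>)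
    moreover have "sat U [x] [] (psub \<sigma> Inl \<psi>) \<longleftrightarrow> E k x" if x: "x \<in> hdom U" for x
    proof -
      have "sat U [x] [] (psub \<sigma> Inl \<psi>) \<longleftrightarrow> sat U (x # l) [] \<psi>"
        by (rule sat_psub[OF \<psi>]) (auto simp: \<sigma>_def less_Suc_eq_0_disj)
      also have "\<dots> \<longleftrightarrow> (\<exists>z\<in>tuples (i k) (hdom U). sat U (drop (Suc j) (z @ x # l)) [] (\<nu> k))"
        using \<nu>'(2) l by (auto simp: \<psi>_def sat_ExHs tuples_def)
      also have "\<dots> \<longleftrightarrow> E k x"
      proof
        assume "\<exists>z\<in>tuples (i k) (hdom U). sat U (drop (Suc j) (z @ x # l)) [] (\<nu> k)"
        then obtain z where z: "z \<in> tuples (i k) (hdom U)" "sat U (drop (Suc j) (z @ x # l)) [] (\<nu> k)" by blast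
        then have "z @ x # l \<in> tuples (i k + Suc j) (hdom U)" using x l by (auto simp: tuples_def)
        then obtain b where b: "range b \<subseteq> hdom U" "prefix_rev b (i k + Suc j) = z @ x # l"
          using prefix_rev_exists hdom_nonempty by metis
        have "prefix_rev b (Suc j) = x # l"
          using drop_prefix_rev[of "i k" b "Suc j"] b(2) z(1) by (simp add: tuples_def)
        moreover have "prefix_rev b (i k) = drop (Suc j) (z @ x # l)"
          using drop_prefix_rev[of "Suc j" b "i k"] b(2) by (simp add: add.commute)
        ultimately show "E k x" unfolding E_def using b(1) z(2) by metis
      next
        assume "E k x"
        then obtain b where b: "range b \<subseteq> hdom U" "prefix_rev b (Suc j) = x # l"
          "sat U (prefix_rev b (i k)) [] (\<nu> k)" unfolding E_def by blast
        define w where "w = prefix_rev b (i k + Suc j)"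
        have w: "w = take (i k) w @ x # l"
          using drop_prefix_rev[of "i k" b "Suc j"] b(2) by (metis append_take_drop_id w_def)
        have "drop (Suc j) w = prefix_rev b (i k)"
          using drop_prefix_rev[of "Suc j" b "i k"] by (simp add: w_def add.commute)
        then have "sat U (drop (Suc j) (take (i k) w @ x # l)) [] (\<nu> k)"
          using b(3) w by simp
        moreover have "take (i k) w \<in> tuples (i k) (hdom U)"
          using prefix_rev_tuples[OF b(1), of "i k + Suc j"] set_take_subset[of "i k" w]
          by (auto simp: tuples_def w_def)
        ultimately show "\<exists>z\<in>tuples (i k) (hdom U). sat U (drop (Suc j) (z @ x # l)) [] (\<nu> k)" by blast
      qed
      finally show ?thesis .
    qed
    ultimately show ?thesis by blast
  qed
  then obtain F where F: "\<And>k. continuous_form L (A \<union> set l) 1 0 (F k)"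
    "\<And>k x. x \<in> hdom U \<Longrightarrow> sat U [x] [] (F k) \<longleftrightarrow> E k x" by metis
  have dec': "sat U (prefix_rev b (i k)) [] (\<nu> k)"
    if "range b \<subseteq> hdom U" "k \<le> K" "sat U (prefix_rev b (i K)) [] (\<nu> K)" for b k K
    using that(2,3)
  proof (induction rule: inc_induct)
    case (step k)
    then show ?case using dec[OF that(1)] by blast
  qed
  have "\<exists>a\<in>tuples 1 (hdom U). \<exists>s\<in>tuples 0 UNIV. \<forall>\<phi>\<in>range F. sat U a s \<phi>"
  proof (rule saturation)
    show "countable (A \<union> set l)" "A \<union> set l \<subseteq> hdom U"
      using A l by (auto simp: tuples_def countable_finite)
    show "\<forall>\<phi>\<in>range F. continuous_form L (A \<union> set l) 1 0 \<phi>" using F(1) by auto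
  next
    fix q0 assume "finite q0" "q0 \<subseteq> range F"
    then obtain K0 where K0: "finite K0" "q0 = F ` K0" by (meson finite_subset_image)
    obtain K where K: "\<forall>k\<in>K0. k \<le> K" using K0(1) finite_nat_set_iff_bounded_le by auto
    obtain b where b: "range b \<subseteq> hdom U" "prefix_rev b j = l" "sat U (prefix_rev b (i K)) [] (\<nu> K)"
      using inv by blast
    have x: "b j \<in> hdom U" using b(1) by auto
    have "E k (b j)" if "k \<in> K0" for k
      unfolding E_def using dec'[OF b(1) _ b(3)] K that b(1,2) by (auto simp: prefix_rev_Suc)
    then show "\<exists>a\<in>tuples 1 (hdom U). \<exists>s\<in>tuples 0 UNIV. \<forall>\<phi>\<in>q0. sat U a s \<phi>"
      using F(2)[OF x] x K0(2) by (intro bexI[of _ "[b j]"] bexI[of _ "[]"]) (auto simp: tuples_def)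
  qed
  then obtain x where "x \<in> hdom U" "\<forall>k. sat U [x] [] (F k)" by (auto simp: tuples_Suc)
  then show ?thesis using F(2) unfolding E_def by blast
qed

lemma omega_saturation:
  assumes A: "countable A" "A \<subseteq> hdom U"
    and \<nu>: "\<And>k. continuous_form L A (i k) 0 (\<nu> k)"
    and dec: "\<And>k b. range b \<subseteq> hdom U \<Longrightarrow> sat U (prefix_rev b (i (Suc k))) [] (\<nu> (Suc k)) \<Longrightarrow>
      sat U (prefix_rev b (i k)) [] (\<nu> k)"
    and con: "\<And>k. \<exists>b. range b \<subseteq> hdom U \<and> sat U (prefix_rev b (i k)) [] (\<nu> k)"
  obtains b where "range b \<subseteq> hdom U" "\<And>k. sat U (prefix_rev b (i k)) [] (\<nu> k)"
proof -
  define P where "P j l \<longleftrightarrow> l \<in> tuples j (hdom U) \<and>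
    (\<forall>k. \<exists>b. range b \<subseteq> hdom U \<and> prefix_rev b j = l \<and> sat U (prefix_rev b (i k)) [] (\<nu> k))" for j l
  have "\<exists>f. \<forall>j. P j (f j) \<and> (\<exists>x. f (Suc j) = x # f j)"
  proof (rule dependent_nat_choice)
    show "\<exists>l. P 0 l" unfolding P_def using con by auto
    fix l j assume "P j l"
    then have l: "l \<in> tuples j (hdom U)"
      and inv: "\<And>k. \<exists>b. range b \<subseteq> hdom U \<and> prefix_rev b j = l \<and> sat U (prefix_rev b (i k)) [] (\<nu> k)"
      unfolding P_def by blast+
    have "\<exists>x\<in>hdom U. \<forall>k. \<exists>b. range b \<subseteq> hdom U \<and> prefix_rev b (Suc j) = x # l \<and>
      sat U (prefix_rev b (i k)) [] (\<nu> k)"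
      by (rule omega_saturation_step[where A=A]) (fact A \<nu> dec l inv)+
    then obtain x where "x \<in> hdom U" "\<forall>k. \<exists>b. range b \<subseteq> hdom U \<and> prefix_rev b (Suc j) = x # l \<and>
      sat U (prefix_rev b (i k)) [] (\<nu> k)"
      by blast
    then have "P (Suc j) (x # l)"
      using l unfolding P_def tuples_Suc by blast
    then show "\<exists>l'. P (Suc j) l' \<and> (\<exists>x. l' = x # l)" by blast
  qed
  then obtain f where f: "\<And>j. P j (f j)" "\<And>j. \<exists>x. f (Suc j) = x # f j" by blast
  \<comment> \<open>Each \<open>f j\<close> is a reversed prefix of the sequence, so the newest
    entry is the head.\<close>
  define b where "b j = hd (f (Suc j))" for j
  have f_Suc: "f (Suc j) = b j # f j" for j unfolding b_def using f(2)[of j] by auto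
  have pf: "prefix_rev b j = f j" for j
  proof (induction j)
    case 0
    then show ?case using f(1)[of 0] by (simp add: P_def)
  qed (simp add: f_Suc prefix_rev_Suc)
  show ?thesis
  proof
    show "range b \<subseteq> hdom U"
    proof
      fix x assume "x \<in> range b"
      then obtain j where "x = b j" by auto
      then show "x \<in> hdom U" using f(1)[of "Suc j"] by (simp add: P_def f_Suc tuples_def)
    qed
    show "sat U (prefix_rev b (i k)) [] (\<nu> k)" for k
      using f(1)[of "i k"] unfolding P_def pf by metis
  qed
qed

section \<open>Nonempty basic open sets and the Baire category theorem\<close>

definition condition :: "'m set \<Rightarrow> nat \<Rightarrow> ('f, 'r, 'g, 'm, 's) pform \<Rightarrow> bool" where
  "condition A i \<phi> \<longleftrightarrow> continuous_form L A i 0 \<phi> \<and>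
     (\<exists>b. range b \<subseteq> hdom U \<and> \<not> sat U (prefix_rev b i) [] \<phi>)"

text \<open>Expresses that \<open>G\<close> contains a dense open set of sequences; closure under
  intersections of conditions is not asked for.\<close>

definition dense_open :: "'m set \<Rightarrow> ((nat \<Rightarrow> 'm) \<Rightarrow> bool) \<Rightarrow> bool" where
  "dense_open A G \<longleftrightarrow> (\<forall>i \<phi>. condition A i \<phi> \<longrightarrow> (\<exists>i' \<phi>'. condition A i' \<phi>' \<and>
     (\<forall>b. range b \<subseteq> hdom U \<longrightarrow> \<not> sat U (prefix_rev b i') [] \<phi>' \<longrightarrow> \<not> sat U (prefix_rev b i) [] \<phi> \<and> G b)))"

text \<open>As in a compact space, closed sets are interleaved with the open ones, and the
  decreasing closed sets have a common point, here by \<open>omega_saturation\<close>.\<close>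

lemma generic_sequence:
  assumes A: "countable A" "A \<subseteq> hdom U"
    and \<G>: "countable \<G>" "\<G> \<noteq> {}" "\<And>G. G \<in> \<G> \<Longrightarrow> dense_open A G"
  obtains b where "range b \<subseteq> hdom U" "\<And>G. G \<in> \<G> \<Longrightarrow> G b"
proof -
  define G where "G = from_nat_into \<G>"
  have G: "dense_open A (G k)" for k unfolding G_def using \<G> by (simp add: from_nat_into)
  \<comment> \<open>The open set of \<open>y\<close> lies in the closed set of \<nu> and in
    \<open>G k\<close>, and the closed set of \<nu> lies in the open set of
    \<open>x\<close>.\<close>
  define step where "step k x y \<nu> \<longleftrightarrow> continuous_form L A (fst x) 0 \<nu> \<and>
      (\<forall>b. range b \<subseteq> hdom U \<longrightarrow> \<not> sat U (prefix_rev b (fst y)) [] (snd y) \<longrightarrow>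
        sat U (prefix_rev b (fst x)) [] \<nu> \<and> G k b) \<and>
      (\<forall>b. sat U (prefix_rev b (fst x)) [] \<nu> \<longrightarrow> \<not> sat U (prefix_rev b (fst x)) [] (snd x))"
    for k and x y :: "nat \<times> ('f, 'r, 'g, 'm, 's) pform" and \<nu>
  have "\<exists>f. \<forall>k. condition A (fst (f k)) (snd (f k)) \<and> (\<exists>\<nu>. step k (f k) (f (Suc k)) \<nu>)"
  proof (rule dependent_nat_choice)
    \<comment> \<open>A false formula: its negation is the whole space.\<close>
    have "condition A 0 (In [SCont (\<lambda>_. undefined) []] {})"
      unfolding condition_def using hdom_nonempty by (auto intro!: exI[of _ "\<lambda>_. SOME x. x \<in> hdom U"] some_in_eq[THEN iffD2])
    then show "\<exists>x. condition A (fst x) (snd x)" by fastforce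
  next
    fix x k assume x: "condition A (fst x) (snd x)"
    define i \<phi> where "i = fst x" and "\<phi> = snd x"
    have \<phi>: "continuous_form L A i 0 \<phi>" using x by (simp add: condition_def i_def \<phi>_def)
    obtain b where b: "range b \<subseteq> hdom U" "\<not> sat U (prefix_rev b i) [] \<phi>"
      using x by (auto simp: condition_def i_def \<phi>_def)
    obtain \<phi>' where w: "weakening \<phi> \<phi>'" "\<not> sat U (prefix_rev b i) [] \<phi>'"
      using weakening_separates[OF A \<phi> prefix_rev_tuples[OF b(1)] _ b(2)] by auto
    obtain \<nu> where \<nu>: "continuous_form L A i 0 \<nu>"
      "\<forall>N a s. (\<not> sat N a s \<phi>' \<longrightarrow> sat N a s \<nu>) \<and> (sat N a s \<nu> \<longrightarrow> \<not> sat N a s \<phi>)"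
      using strong_negation[OF compact_S w(1) \<phi>] by blast
    \<comment> \<open>Density is applied to the smaller open set of \<open>\<not> \<phi>'\<close>,
      which is contained in the closed set of \<nu>.\<close>
    have "condition A i \<phi>'"
      unfolding condition_def using weakening_continuous_form[OF compact_S w(1) \<phi>] b(1) w(2) by blast
    then obtain i' \<phi>'' where c: "condition A i' \<phi>''"
      "\<forall>b. range b \<subseteq> hdom U \<longrightarrow> \<not> sat U (prefix_rev b i') [] \<phi>'' \<longrightarrow> \<not> sat U (prefix_rev b i) [] \<phi>' \<and> G k b"
      using G[of k] unfolding dense_open_def by blast
    have "step k x (i', \<phi>'') \<nu>"
      unfolding step_def fst_conv snd_conv i_def[symmetric] \<phi>_def[symmetric] using \<nu> c(2) by blast
    then show "\<exists>y. condition A (fst y) (snd y) \<and> (\<exists>\<nu>. step k x y \<nu>)"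
      using c(1) by (intro exI[of _ "(i', \<phi>'')"]) auto
  qed
  then obtain f \<nu> where f: "\<And>k. condition A (fst (f k)) (snd (f k))" "\<And>k. step k (f k) (f (Suc k)) (\<nu> k)"
    by metis
  obtain b where b: "range b \<subseteq> hdom U" "\<And>k. sat U (prefix_rev b (fst (f k))) [] (\<nu> k)"
  proof (rule omega_saturation[of A "\<lambda>k. fst (f k)" \<nu>])
    show "continuous_form L A (fst (f k)) 0 (\<nu> k)" for k using f(2)[of k] by (simp add: step_def)
    show "sat U (prefix_rev b (fst (f k))) [] (\<nu> k)"
      if "range b \<subseteq> hdom U" "sat U (prefix_rev b (fst (f (Suc k)))) [] (\<nu> (Suc k))" for k b
      using f(2)[of k] f(2)[of "Suc k"] that unfolding step_def by blast
    show "\<exists>b. range b \<subseteq> hdom U \<and> sat U (prefix_rev b (fst (f k))) [] (\<nu> k)" for k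
      using f(1)[of "Suc k"] f(2)[of k] unfolding step_def condition_def by blast
  qed (use A in auto)
  show ?thesis
  proof (rule that[OF b(1)])
    fix H assume "H \<in> \<G>"
    then obtain k where k: "H = G k" unfolding G_def using \<G>(1) from_nat_into_surj by metis
    have "\<not> sat U (prefix_rev b (fst (f (Suc k)))) [] (snd (f (Suc k)))"
      using f(2)[of "Suc k"] b(2) unfolding step_def by blast
    then show "H b" using f(2)[of k] b(1) unfolding k step_def by blast
  qed
qed

lemma condition_extend:
  assumes "condition A i \<phi>" "i \<le> I"
  obtains \<phi>' where "condition A I \<phi>'" "\<And>b. sat U (prefix_rev b I) [] \<phi>' \<longleftrightarrow> sat U (prefix_rev b i) [] \<phi>"
proof -
  have "continuous_form L A i 0 \<phi>" using assms by (simp add: condition_def)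
  then obtain \<phi>' where \<phi>': "continuous_form L A ((I - i) + i) 0 \<phi>'"
    "\<And>w. length w = (I - i) + i \<Longrightarrow> sat U w [] \<phi>' \<longleftrightarrow> sat U (drop (I - i) w) [] \<phi>"
    using shift_form by metis
  have *: "sat U (prefix_rev b I) [] \<phi>' \<longleftrightarrow> sat U (prefix_rev b i) [] \<phi>" for b
    using \<phi>'(2)[of "prefix_rev b I"] drop_prefix_rev[of "I - i" b i] assms(2) by simp
  have "condition A I \<phi>'"
    using assms \<phi>'(1) * by (auto simp: condition_def)
  then show ?thesis using that * by blast
qed

end

section \<open>Witnesses and omission are generic\<close>

context saturated_structure
begin

text \<open>An entry of \<open>c\<close> is either an element of \<open>A\<close>
  (\<open>Inl\<close>) or the name of an entry of the sequence (\<open>Inr\<close>). If some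
  sequence in the condition admits a solution of \<open>\<not> \<psi>\<close>, that solution can be
  placed at a coordinate that neither the condition nor \<open>c\<close> mentions; if none does, the
  condition already forces the first alternative.\<close>

lemma dense_open_witness:
  assumes A: "A \<subseteq> hdom U" and \<psi>: "continuous_form L {} (Suc (length c)) 0 \<psi>" and c: "set c \<subseteq> A <+> UNIV"
  shows "dense_open A (\<lambda>b. (\<forall>x\<in>hdom U. sat U (x # map (case_sum id b) c) [] \<psi>) \<or>
    (\<exists>j\<ge>N. \<not> sat U (b j # map (case_sum id b) c) [] \<psi>))"
  unfolding dense_open_def
proof (intro allI impI)
  fix i \<phi> assume \<phi>: "condition A i \<phi>"
  let ?v = "\<lambda>b. map (case_sum id b) c"
  define J where "J = {j. Inr j \<in> set c}"
  have "finite J"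
  proof -
    have "Inr ` J \<subseteq> set c" by (auto simp: J_def)
    then show ?thesis by (meson finite_imageD finite_set finite_subset inj_Inr inj_on_subset subset_UNIV)
  qed
  then obtain I0 where I0: "\<forall>j\<in>J. j \<le> I0" using finite_nat_set_iff_bounded_le by auto
  \<comment> \<open>Coordinate \<open>I\<close> is beyond those read by \<phi>, those named in
    \<open>c\<close>, and \<open>N\<close>; applying this for each \<open>N\<close> yields
    infinitely many solutions.\<close>
  define I where "I = Suc (max I0 (max i N))"
  have I: "i \<le> I" "N \<le> I" "\<And>j. Inr j \<in> set c \<Longrightarrow> j < I"
    using I0 by (auto simp: I_def J_def less_Suc_eq_le le_max_iff_disj)
  obtain \<phi>1 where \<phi>1: "condition A I \<phi>1" "\<And>b. sat U (prefix_rev b I) [] \<phi>1 \<longleftrightarrow> sat U (prefix_rev b i) [] \<phi>"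
    using condition_extend[OF \<phi> I(1)] by metis
  show "\<exists>i' \<phi>'. condition A i' \<phi>' \<and> (\<forall>b. range b \<subseteq> hdom U \<longrightarrow> \<not> sat U (prefix_rev b i') [] \<phi>' \<longrightarrow>
    \<not> sat U (prefix_rev b i) [] \<phi> \<and>
    ((\<forall>x\<in>hdom U. sat U (x # ?v b) [] \<psi>) \<or> (\<exists>j\<ge>N. \<not> sat U (b j # ?v b) [] \<psi>)))"
  proof (cases "\<exists>b. range b \<subseteq> hdom U \<and> \<not> sat U (prefix_rev b I) [] \<phi>1 \<and> (\<exists>x\<in>hdom U. \<not> sat U (x # ?v b) [] \<psi>)")
    case False
    then show ?thesis using \<phi>1 by (intro exI[of _ I] exI[of _ \<phi>1]) auto
  next
    case True
    then obtain b x where b: "range b \<subseteq> hdom U" "\<not> sat U (prefix_rev b I) [] \<phi>1" "x \<in> hdom U"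
      "\<not> sat U (x # ?v b) [] \<psi>" by blast
    obtain \<phi>2 where \<phi>2: "condition A (Suc I) \<phi>2"
      "\<And>b. sat U (prefix_rev b (Suc I)) [] \<phi>2 \<longleftrightarrow> sat U (prefix_rev b I) [] \<phi>1"
      using condition_extend[OF \<phi>1(1), of "Suc I"] by auto
    \<comment> \<open>In a reversed prefix of length \<open>Suc I\<close> the entry
      \<open>b j\<close> is at place \<open>I - j\<close>; the fresh entry \<open>b I\<close> is at
      place 0.\<close>
    define \<sigma> :: "nat \<Rightarrow> ('f, 'm) hterm" where
      "\<sigma> = case_nat (HVar 0) (\<lambda>v. case_sum HPar (\<lambda>j. HVar (I - j)) (c ! v))"
    have ctm: "hterm_in L A (Suc I) (\<sigma> v)" if v: "v < Suc (length c)" for v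
    proof (cases v)
      case (Suc u)
      then have "c ! u \<in> set c" using v by simp
      then show ?thesis using c Suc by (cases "c ! u" rule: sum.exhaust) (auto simp: \<sigma>_def)
    qed (simp add: \<sigma>_def)
    have \<psi>': "continuous_form L A (Suc I) 0 (psub \<sigma> Inl \<psi>)"
      by (rule continuous_form_psub[OF \<psi>]) (use ctm in auto)
    have ev: "heval U (prefix_rev b' (Suc I)) (\<sigma> v) = (b' I # ?v b') ! v" if v: "v < Suc (length c)" for b' v
    proof (cases v)
      case 0
      then show ?thesis by (simp add: \<sigma>_def prefix_rev_Suc)
    next
      case (Suc u)
      then have "c ! u \<in> set c" "u < length c" using v by simp_all
      then show ?thesis
        using Suc I(3)[THEN less_imp_le] by (cases "c ! u" rule: sum.exhaust) (auto simp: \<sigma>_def prefix_rev_nth less_Suc_eq_le)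
    qed
    have sat\<psi>: "sat U (prefix_rev b' (Suc I)) [] (psub \<sigma> Inl \<psi>) \<longleftrightarrow> sat U (b' I # ?v b') [] \<psi>" for b'
      by (rule sat_psub[OF \<psi>]) (use ev in auto)
    define b' where "b' = b(I := x)"
    have b': "range b' \<subseteq> hdom U" using b(1,3) by (auto simp: b'_def)
    have "prefix_rev b' I = prefix_rev b I" by (rule prefix_rev_cong) (simp add: b'_def)
    moreover have "?v b' = ?v b"
      using I(3) by (auto simp: b'_def split: sum.split)
    moreover have "b' I = x" by (simp add: b'_def)
    ultimately have "\<not> sat U (prefix_rev b' (Suc I)) [] (Or \<phi>2 (psub \<sigma> Inl \<psi>))"
      using b(2,4) by (simp only: sat.simps sat\<psi> \<phi>2(2) simp_thms)
    then have "condition A (Suc I) (Or \<phi>2 (psub \<sigma> Inl \<psi>))"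
      using b' \<phi>2(1) \<psi>' unfolding condition_def by auto
    then show ?thesis
      using \<phi>2(2) \<phi>1(2) sat\<psi> I(2) by (intro exI[of _ "Suc I"] exI[of _ "Or \<phi>2 (psub \<sigma> Inl \<psi>)"]) auto
  qed
qed

text \<open>Compactness: the set \<open>p\<close> together with nearness to \<open>c\<close> is not
  realized, so a finite part already is not. Distance from finitely many formulas, unlike distance
  from \<open>p\<close>, is expressed by the negation of one continuous formula.\<close>

lemma omit_finitely:
  assumes A: "countable A" "A \<subseteq> hdom U" and p: "\<forall>\<phi>\<in>p. continuous_form L A n 0 \<phi>"
    and \<epsilon>: "\<epsilon> \<in> indices L n" and c: "c \<in> tuples n (hdom U)"
    and no: "\<forall>a\<in>tuples n (hdom U). realizes U a p \<longrightarrow> \<not> near U \<epsilon> c a"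
  obtains p0 where "finite p0" "p0 \<subseteq> p" "\<forall>a\<in>tuples n (hdom U). realizes U a p0 \<longrightarrow> \<not> near U \<epsilon> c a"
proof -
  define \<psi> :: "('f, 'r, 'g, 'm, 's) pform" where
    "\<psi> = psub (\<lambda>i. if i < n then HPar (c ! i) else HVar (i - n)) Inl (near_form n \<epsilon>)"
  have \<psi>: "continuous_form L (A \<union> set c) n 0 \<psi>"
    unfolding \<psi>_def by (rule continuous_form_psub[OF continuous_near_form[OF \<epsilon>]])
      (use c in \<open>auto simp: tuples_def\<close>)
  have sat\<psi>: "sat U a [] \<psi> \<longleftrightarrow> near U \<epsilon> c a" if "a \<in> tuples n (hdom U)" for a
  proof -
    have "sat U a [] \<psi> \<longleftrightarrow> sat U (c @ a) [] (near_form n \<epsilon>)"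
      unfolding \<psi>_def by (rule sat_psub[OF continuous_near_form[OF \<epsilon>]])
        (use c in \<open>auto simp: tuples_def nth_append\<close>)
    then show ?thesis using sat_near_form[OF \<epsilon>] c that by (simp add: tuples_length)
  qed
  have "\<exists>q0. finite q0 \<and> q0 \<subseteq> insert \<psi> p \<and>
    \<not> (\<exists>a\<in>tuples n (hdom U). \<exists>s\<in>tuples 0 UNIV. \<forall>\<phi>\<in>q0. sat U a s \<phi>)"
  proof (rule ccontr)
    assume not: "\<nexists>q0. finite q0 \<and> q0 \<subseteq> insert \<psi> p \<and>
      \<not> (\<exists>a\<in>tuples n (hdom U). \<exists>s\<in>tuples 0 UNIV. \<forall>\<phi>\<in>q0. sat U a s \<phi>)"
    have "\<exists>a\<in>tuples n (hdom U). \<exists>s\<in>tuples 0 UNIV. \<forall>\<phi>\<in>insert \<psi> p. sat U a s \<phi>"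
    proof (rule saturation)
      show "countable (A \<union> set c)" "A \<union> set c \<subseteq> hdom U"
        using A c by (auto simp: tuples_def countable_finite)
      show "\<forall>\<phi>\<in>insert \<psi> p. continuous_form L (A \<union> set c) n 0 \<phi>"
        using \<psi> p continuous_form_mono[of L A n 0 _ "A \<union> set c" n 0] by auto
    qed (use not in blast)
    then show False using no sat\<psi> by (auto simp: realizes_def)
  qed
  then obtain q0 where q0: "finite q0" "q0 \<subseteq> insert \<psi> p" "\<And>a. a \<in> tuples n (hdom U) \<Longrightarrow> \<exists>\<phi>\<in>q0. \<not> sat U a [] \<phi>"
    by auto
  show ?thesis
  proof (rule that[of "q0 - {\<psi>}"])
    show "\<forall>a\<in>tuples n (hdom U). realizes U a (q0 - {\<psi>}) \<longrightarrow> \<not> near U \<epsilon> c a"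
    proof (intro ballI impI notI)
      fix a assume a: "a \<in> tuples n (hdom U)" "realizes U a (q0 - {\<psi>})" "near U \<epsilon> c a"
      then have "sat U a [] \<psi>" using sat\<psi> by simp
      then show False using q0(3)[OF a(1)] a(2) by (auto simp: realizes_def)
    qed
  qed (use q0 in auto)
qed

text \<open>The condition is projected to the coordinates \<open>js\<close>. The projection is the
  set of solutions of a formula \<open>\<not> \<theta>\<close> in \<open>n\<close> variables, so by
  \<open>ni\<close> it has a point far from \<open>p\<close>; that point is lifted back to a
  sequence, and the condition is narrowed so as to keep the named coordinates far from
  \<open>p\<close>.\<close>

lemma dense_open_omit:
  assumes A: "countable A" "A \<subseteq> hdom U" and p: "\<forall>\<phi>\<in>p. continuous_form L A n 0 \<phi>"
    and \<epsilon>: "\<epsilon> \<in> indices L n"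
    and ni: "\<And>\<theta>. continuous_form L A n 0 \<theta> \<Longrightarrow> \<exists>b\<in>tuples n (hdom U). \<not> sat U b [] \<theta> \<Longrightarrow>
      \<exists>b\<in>tuples n (hdom U). \<not> sat U b [] \<theta> \<and> (\<forall>a\<in>tuples n (hdom U). realizes U a p \<longrightarrow> \<not> near U \<epsilon> b a)"
    and js: "distinct js" "length js = n"
  shows "dense_open A (\<lambda>b. \<forall>a\<in>tuples n (hdom U). realizes U a p \<longrightarrow> \<not> near U \<epsilon> (map b js) a)"
  unfolding dense_open_def
proof (intro allI impI)
  fix i \<phi> assume \<phi>: "condition A i \<phi>"
  obtain I0 where I0: "\<forall>j\<in>set js. j \<le> I0" using finite_nat_set_iff_bounded_le[of "set js"] by auto
  define I where "I = Suc (max I0 i)"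
  have I: "i \<le> I" "\<And>j. j \<in> set js \<Longrightarrow> j < I"
    using I0 by (auto simp: I_def less_Suc_eq_le le_max_iff_disj)
  obtain \<phi>1 where \<phi>1: "condition A I \<phi>1" "\<And>b. sat U (prefix_rev b I) [] \<phi>1 \<longleftrightarrow> sat U (prefix_rev b i) [] \<phi>"
    using condition_extend[OF \<phi> I(1)] by metis
  have c1: "continuous_form L A I 0 \<phi>1" using \<phi>1(1) by (simp add: condition_def)
  obtain b0 where b0: "range b0 \<subseteq> hdom U" "\<not> sat U (prefix_rev b0 I) [] \<phi>1"
    using \<phi>1(1) by (auto simp: condition_def)
  \<comment> \<open>The inverse of \<open>js\<close>. Distinctness makes it two-sided, so that any
    \<open>n\<close>-tuple can be written into the coordinates \<open>js\<close>.\<close>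
  define pos where "pos j = (SOME l. l < n \<and> js ! l = j)" for j
  have pos: "pos j < n \<and> js ! pos j = j" if "j \<in> set js" for j
    unfolding pos_def by (rule someI_ex) (use that js in \<open>auto simp: in_set_conv_nth\<close>)
  have pos_js: "pos (js ! l) = l" if "l < n" for l
    using pos[of "js ! l"] that js nth_eq_iff_index_eq[OF js(1), of "pos (js ! l)" l] by simp
  \<comment> \<open>Place \<open>v\<close> of a prefix of length \<open>I\<close> holds coordinate
    \<open>I - Suc v\<close>. Coordinates in \<open>js\<close> are read from \<open>x\<close>, which
    follows the \<open>I\<close> quantified entries; the others are read from \<open>z\<close>,
    whose entries at coordinates in \<open>js\<close> are dummies.\<close>
  define \<sigma> :: "nat \<Rightarrow> ('f, 'm) hterm" where
    "\<sigma> v = (if I - Suc v \<in> set js then HVar (I + pos (I - Suc v)) else HVar v)" for v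
  define \<theta> where "\<theta> = AllHs I (psub \<sigma> Inl \<phi>1)"
  have \<theta>: "continuous_form L A n 0 \<theta>"
    unfolding \<theta>_def continuous_form_AllHs
    by (rule continuous_form_psub[OF c1]) (use pos in \<open>auto simp: \<sigma>_def\<close>)
  have sat\<sigma>: "sat U (z @ x) [] (psub \<sigma> Inl \<phi>1) \<longleftrightarrow> sat U (prefix_rev b I) [] \<phi>1"
    if z: "length z = I" "length x = n" and b: "map b js = x" "\<And>j. j < I \<Longrightarrow> j \<notin> set js \<Longrightarrow> b j = z ! (I - Suc j)" for z x b
  proof (rule sat_psub[OF c1])
    show "\<forall>v<I. heval U (z @ x) (\<sigma> v) = prefix_rev b I ! v"
    proof (intro allI impI)
      fix v assume v: "v < I"
      show "heval U (z @ x) (\<sigma> v) = prefix_rev b I ! v"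
      proof (cases "I - Suc v \<in> set js")
        case True
        then have "b (I - Suc v) = x ! pos (I - Suc v)"
          using pos[OF True] b(1) js(2) by (metis nth_map)
        then show ?thesis using True v z pos[OF True] by (simp add: \<sigma>_def prefix_rev_nth nth_append)
      next
        case False
        then show ?thesis using v z b(2)[of "I - Suc v"] by (simp add: \<sigma>_def prefix_rev_nth nth_append)
      qed
    qed
  qed simp
  have "map b0 js \<in> tuples n (hdom U)" using b0(1) js(2) by (auto simp: tuples_def)
  moreover have "\<not> sat U (map b0 js) [] \<theta>"
  proof -
    have "\<not> sat U (prefix_rev b0 I @ map b0 js) [] (psub \<sigma> Inl \<phi>1)"
      using sat\<sigma>[of "prefix_rev b0 I" "map b0 js" b0] b0(2) js(2) by (simp add: prefix_rev_nth)
    then show ?thesis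
      unfolding \<theta>_def sat_AllHs using prefix_rev_tuples[OF b0(1)] by blast
  qed
  ultimately obtain x where x: "x \<in> tuples n (hdom U)" "\<not> sat U x [] \<theta>"
    "\<forall>a\<in>tuples n (hdom U). realizes U a p \<longrightarrow> \<not> near U \<epsilon> x a"
    using ni[OF \<theta>] by blast
  then obtain z where z: "z \<in> tuples I (hdom U)" "\<not> sat U (z @ x) [] (psub \<sigma> Inl \<phi>1)"
    unfolding \<theta>_def sat_AllHs by blast
  \<comment> \<open>Lifts the far point \<open>x\<close>: it overwrites the coordinates
    \<open>js\<close>, \<open>z\<close> supplies the rest of the prefix, and beyond \<open>I\<close>
    any values in the domain will do.\<close>
  define b where "b j = (if j \<in> set js then x ! pos j else if j < I then z ! (I - Suc j) else b0 j)" for j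
  have b: "range b \<subseteq> hdom U"
  proof
    fix y assume "y \<in> range b"
    then obtain j where "y = b j" by auto
    then show "y \<in> hdom U"
      using pos[of j] tuples_nth[OF x(1)] tuples_nth[OF z(1), of "I - Suc j"] b0(1) by (auto simp: b_def)
  qed
  have bx: "map b js = x"
    using x(1) js pos_js by (intro nth_equalityI) (auto simp: b_def tuples_def)
  have nb: "\<not> sat U (prefix_rev b I) [] \<phi>1"
    using sat\<sigma>[of z x b] z x(1) bx by (simp add: tuples_length b_def)
  obtain p0 where p0: "finite p0" "p0 \<subseteq> p" "\<forall>a\<in>tuples n (hdom U). realizes U a p0 \<longrightarrow> \<not> near U \<epsilon> x a"
    using omit_finitely[OF A p \<epsilon> x(1,3)] by metis
  obtain ps where ps: "set ps = p0" using finite_list[OF p0(1)] by blast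
  define \<psi> :: "('f, 'r, 'g, 'm, 's) pform" where
    "\<psi> = psub (\<lambda>v. HVar (if v < n then n + (I - Suc (js ! v)) else v - n)) Inl (near_form n \<epsilon>)"
  have \<psi>: "continuous_form L A (n + I) 0 \<psi>"
    unfolding \<psi>_def by (rule continuous_form_psub[OF continuous_near_form[OF \<epsilon>]])
      (use js I(2) in \<open>auto simp: in_set_conv_nth I_def intro!: diff_less\<close>)
  have sat\<psi>: "sat U (a @ prefix_rev b I) [] \<psi> \<longleftrightarrow> near U \<epsilon> (map b js) a" if "a \<in> tuples n (hdom U)" for a b
  proof -
    have j: "prefix_rev b I ! (I - Suc (js ! v)) = b (js ! v)" if "v < n" for v
      using that js I(2)[of "js ! v"] by (simp add: prefix_rev_nth)
    have "sat U (a @ prefix_rev b I) [] \<psi> \<longleftrightarrow> sat U (map b js @ a) [] (near_form n \<epsilon>)"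
      unfolding \<psi>_def by (rule sat_psub[OF continuous_near_form[OF \<epsilon>]])
        (use that js j in \<open>auto simp: tuples_def nth_append\<close>)
    then show ?thesis using sat_near_form[OF \<epsilon>] that js by (simp add: tuples_length)
  qed
  \<comment> \<open>Its negation keeps the old condition and says that no realization of
    \<open>p0\<close> is near to the named coordinates. The sequence \<open>b\<close> shows that it
    is satisfiable.\<close>
  define \<phi>2 where "\<phi>2 = Or \<phi>1 (ExHs n (And (Conj ps) \<psi>))"
  have "continuous_form L A (n + I) 0 (Conj ps)"
    unfolding continuous_form_Conj[OF compact_S] ps
    using p0(2) p continuous_form_mono[of L A n 0 _ A "n + I" 0] by auto
  then have c2: "continuous_form L A I 0 \<phi>2"
    unfolding \<phi>2_def using c1 \<psi> by simp
  have satp: "sat U (a @ w) [] (Conj ps) \<longleftrightarrow> realizes U a p0" if "a \<in> tuples n (hdom U)" for a w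
  proof -
    have "sat U (a @ w) [] \<phi> \<longleftrightarrow> sat U a [] \<phi>" if "\<phi> \<in> p0" for \<phi>
      using p0(2) p that \<open>a \<in> _\<close> by (intro sat_append) (auto simp: tuples_length)
    then show ?thesis by (simp add: ps realizes_def)
  qed
  have sat2: "\<not> sat U (prefix_rev b I) [] \<phi>2 \<longleftrightarrow> \<not> sat U (prefix_rev b I) [] \<phi>1 \<and>
    (\<forall>a\<in>tuples n (hdom U). realizes U a p0 \<longrightarrow> \<not> near U \<epsilon> (map b js) a)" for b
    unfolding \<phi>2_def using satp sat\<psi> by (simp add: sat_ExHs del: sat_Conj)
  have "condition A I \<phi>2"
    unfolding condition_def using c2 b nb sat2[of b] p0(3) bx by auto
  moreover have "realizes U a p \<Longrightarrow> realizes U a p0" for a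
    using p0(2) by (auto simp: realizes_def)
  ultimately show "\<exists>i' \<phi>'. condition A i' \<phi>' \<and> (\<forall>b. range b \<subseteq> hdom U \<longrightarrow> \<not> sat U (prefix_rev b i') [] \<phi>' \<longrightarrow>
    \<not> sat U (prefix_rev b i) [] \<phi> \<and> (\<forall>a\<in>tuples n (hdom U). realizes U a p \<longrightarrow> \<not> near U \<epsilon> (map b js) a))"
    using sat2 \<phi>1(2) by blast
qed

end

section \<open>The closure of a generic sequence\<close>

lemma heval_hdom_update [simp]: "heval (U\<lparr>hdom := M\<rparr>) a t = heval U a t"
  by (induction t) (auto cong: map_cong)

lemma seval_hdom_update [simp]: "seval (U\<lparr>hdom := M\<rparr>) a s t = seval U a s t"
  by (induction t) (auto cong: map_cong)

context saturated_structure
begin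

text \<open>A Tarski-Vaught property for negations of continuous formulas, with solutions at
  arbitrarily large indices and parameters given as actual elements instead of names.\<close>

definition witnessing :: "'m set \<Rightarrow> (nat \<Rightarrow> 'm) \<Rightarrow> bool" where
  "witnessing A b \<longleftrightarrow> range b \<subseteq> hdom U \<and>
     (\<forall>d \<phi> c x N. continuous_form L {} (Suc d) 0 \<phi> \<longrightarrow> c \<in> tuples d (A \<union> range b) \<longrightarrow> x \<in> hdom U \<longrightarrow>
        \<not> sat U (x # c) [] \<phi> \<longrightarrow> (\<exists>j\<ge>N. \<not> sat U (b j # c) [] \<phi>))"

text \<open>The element \<open>c\<close> itself solves the open nearness condition
  \<open>\<not> \<nu>(x, c)\<close>, so entries of arbitrarily large index solve it too.\<close>

lemma witnessing_near:
  assumes w: "witnessing A b" and A: "A \<subseteq> hdom U" and c: "c \<in> A \<union> range b" and \<epsilon>: "\<epsilon> \<in> indices L 1"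
  shows "\<exists>j\<ge>N. near U \<epsilon> [c] [b j]"
proof -
  obtain \<epsilon>1 where \<epsilon>1: "\<epsilon>1 \<in> indices L 1" "\<And>a b. near U \<epsilon>1 a b \<Longrightarrow> near U \<epsilon>1 b a"
    "\<And>a b c. near U \<epsilon>1 a b \<Longrightarrow> near U \<epsilon>1 b c \<Longrightarrow> near U \<epsilon> a c"
    using indices_half[OF \<epsilon>] by metis
  obtain \<nu> :: "('f, 'r, 'g, 'm, 's) pform" and \<epsilon>0 where
    \<nu>: "continuous_form L {} (1 + 1) 0 \<nu>" "\<epsilon>0 \<in> indices L 1"
    "\<And>a b. length a = 1 \<Longrightarrow> length b = 1 \<Longrightarrow> \<not> sat U (a @ b) [] \<nu> \<Longrightarrow> near U \<epsilon>1 a b"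
    "\<And>a b. length a = 1 \<Longrightarrow> length b = 1 \<Longrightarrow> near U \<epsilon>0 a b \<Longrightarrow> \<not> sat U (a @ b) [] \<nu>"
    using far_form[OF \<epsilon>1(1)] by metis
  have c': "c \<in> hdom U" using w A c by (auto simp: witnessing_def)
  have "\<not> sat U (c # [c]) [] \<nu>"
    using \<nu>(4)[of "[c]" "[c]"] near_refl[OF \<nu>(2)] by simp
  moreover have "[c] \<in> tuples 1 (A \<union> range b)" using c by (auto simp: tuples_def)
  moreover have "continuous_form L {} (Suc 1) 0 \<nu>" using \<nu>(1) by simp
  ultimately obtain j where "j \<ge> N" "\<not> sat U (b j # [c]) [] \<nu>"
    using w c' unfolding witnessing_def by blast
  then have "near U \<epsilon>1 [b j] [c]" using \<nu>(3)[of "[b j]" "[c]"] by simp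
  then show ?thesis using \<epsilon>1 near_refl[OF \<epsilon>1(1)] \<open>j \<ge> N\<close> by blast
qed

context
  fixes A :: "'m set" and b :: "nat \<Rightarrow> 'm" and M :: "'m set"
  assumes w: "witnessing A b" and A: "A \<subseteq> hdom U"
  defines "M \<equiv> Ccl L U (range b)"
begin

lemma Ccl_range_hdom: "M \<subseteq> hdom U"
  by (auto simp: M_def Ccl_iff)

lemma Ccl_range_superset: "A \<union> range b \<subseteq> M"
proof
  fix c assume c: "c \<in> A \<union> range b"
  then have "c \<in> hdom U" using w A by (auto simp: witnessing_def)
  moreover have "\<exists>y\<in>range b. near U \<epsilon> [c] [y]" if "\<epsilon> \<in> indices L 1" for \<epsilon>
    using witnessing_near[OF w A c that] by blast
  ultimately show "c \<in> M" by (simp add: M_def Ccl_iff)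
qed

lemma Ccl_range_near:
  assumes m: "m \<in> M" and \<epsilon>: "\<epsilon> \<in> indices L 1"
  shows "\<exists>j\<ge>N. near U \<epsilon> [m] [b j]"
proof -
  obtain \<epsilon>1 where \<epsilon>1: "\<epsilon>1 \<in> indices L 1"
    "\<And>a b c. near U \<epsilon>1 a b \<Longrightarrow> near U \<epsilon>1 b c \<Longrightarrow> near U \<epsilon> a c"
    using indices_half[OF \<epsilon>] by metis
  obtain y where y: "y \<in> range b" "near U \<epsilon>1 [m] [y]"
    using m \<epsilon>1(1) unfolding M_def Ccl_iff by blast
  obtain j where "j \<ge> N" "near U \<epsilon>1 [y] [b j]"
    using witnessing_near[OF w A _ \<epsilon>1(1)] y(1) by blast
  then show ?thesis using \<epsilon>1(2) y(2) by blast
qed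

lemma Ccl_range_near_distinct:
  assumes \<epsilon>: "\<epsilon> \<in> indices L 1"
  shows "set a \<subseteq> M \<Longrightarrow> \<exists>js. distinct js \<and> length js = length a \<and> (\<forall>i<length a. near U \<epsilon> [a ! i] [b (js ! i)])"
proof (induction a)
  case (Cons x a)
  then obtain js where js: "distinct js" "length js = length a" "\<forall>i<length a. near U \<epsilon> [a ! i] [b (js ! i)]"
    by auto
  obtain N where N: "\<forall>j\<in>set js. j < N" using finite_nat_set_iff_bounded[of "set js"] by auto
  obtain j where j: "j \<ge> N" "near U \<epsilon> [x] [b j]" using Ccl_range_near[OF _ \<epsilon>, of x] Cons.prems by auto
  have "j \<notin> set js" using N j(1) by auto
  moreover have "near U \<epsilon> [(x # a) ! i] [b ((j # js) ! i)]" if "i < length (x # a)" for i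
    using that j(2) js(3) by (cases i) auto
  ultimately show ?case using js by (intro exI[of _ "j # js"]) (auto simp del: near.simps)
qed simp

text \<open>Two approximations at half scale compose to one.\<close>

lemma Ccl_range_Ccl: "Ccl L U M \<subseteq> M"
proof
  fix x assume x: "x \<in> Ccl L U M"
  have "\<exists>y\<in>range b. near U \<epsilon> [x] [y]" if \<epsilon>: "\<epsilon> \<in> indices L 1" for \<epsilon>
  proof -
    obtain \<epsilon>1 where \<epsilon>1: "\<epsilon>1 \<in> indices L 1"
      "\<And>a b c. near U \<epsilon>1 a b \<Longrightarrow> near U \<epsilon>1 b c \<Longrightarrow> near U \<epsilon> a c"
      using indices_half[OF \<epsilon>] by metis
    obtain m where m: "m \<in> M" "near U \<epsilon>1 [x] [m]" using x \<epsilon>1(1) unfolding Ccl_iff by blast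
    obtain j where "near U \<epsilon>1 [m] [b j]" using Ccl_range_near[OF m(1) \<epsilon>1(1)] by blast
    then show ?thesis using \<epsilon>1(2) m(2) by blast
  qed
  then show "x \<in> M" using x by (simp add: M_def Ccl_iff)
qed

text \<open>The Tarski-Vaught test passes from the sequence to its closure: the parameters
  \<open>c\<close> are moved to nearby entries \<open>c'\<close>, a witness is found there, and the
  parameters are moved back. Each move may cost one weakening.\<close>

lemma Ccl_range_witness:
  assumes \<phi>: "continuous_form L {} (Suc d) 0 \<phi>" and c: "c \<in> tuples d M"
    and x: "x \<in> hdom U" "\<not> sat U (x # c) [] \<phi>"
  shows "\<exists>y\<in>M. \<not> sat U (y # c) [] \<phi>"
proof -
  have cU: "c \<in> tuples d (hdom U)" using c Ccl_range_hdom by (auto simp: tuples_def)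
  have xc: "y # c' \<in> tuples (Suc d) (hdom U)" if "y \<in> hdom U" "c' \<in> tuples d (hdom U)" for y c'
    using that by (auto simp: tuples_def)
  obtain \<phi>2 where \<phi>2: "weakening \<phi> \<phi>2" "\<not> sat U (x # c) [] \<phi>2"
    using weakening_separates[OF _ _ \<phi> xc[OF x(1) cU] _ x(2)] by auto
  \<comment> \<open>The chain to come: failure of \<open>\<phi>2\<close> at \<open>x # c\<close>
    gives failure of \<open>\<phi>1\<close> at \<open>x # c'\<close>, then at
    \<open>b j # c'\<close>, then failure of \<phi> at \<open>b j # c\<close>.\<close>
  obtain \<phi>1 where \<phi>1: "weakening \<phi> \<phi>1" "weakening \<phi>1 \<phi>2"
    using weakening_interpolate[OF compact_S \<phi>2(1) \<phi>] by blast
  have c1: "continuous_form L {} (Suc d) 0 \<phi>1" by (rule weakening_continuous_form[OF compact_S \<phi>1(1) \<phi>])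
  obtain \<epsilon>1 where \<epsilon>1: "\<epsilon>1 \<in> indices L 1" "\<forall>a\<in>tuples (Suc d) (hdom U). \<forall>a'\<in>tuples (Suc d) (hdom U).
    (\<forall>i<Suc d. near U \<epsilon>1 [a ! i] [a' ! i]) \<longrightarrow> sat U a [] \<phi> \<longrightarrow> sat U a' [] \<phi>1"
    using uniform_continuity[OF \<phi>1(1) \<phi>] by metis
  obtain \<epsilon>2 where \<epsilon>2: "\<epsilon>2 \<in> indices L 1" "\<forall>a\<in>tuples (Suc d) (hdom U). \<forall>a'\<in>tuples (Suc d) (hdom U).
    (\<forall>i<Suc d. near U \<epsilon>2 [a ! i] [a' ! i]) \<longrightarrow> sat U a [] \<phi>1 \<longrightarrow> sat U a' [] \<phi>2"
    using uniform_continuity[OF \<phi>1(2) c1] by metis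
  obtain \<epsilon>3 where \<epsilon>3: "\<epsilon>3 \<in> indices L 1" "\<And>a b. near U \<epsilon>3 a b \<Longrightarrow> near U \<epsilon>3 b a"
    "\<And>a b c. near U \<epsilon>3 a b \<Longrightarrow> near U \<epsilon>3 b c \<Longrightarrow> near U \<epsilon>2 a c"
    using indices_half[OF \<epsilon>2(1)] by metis
  obtain \<epsilon> where \<epsilon>: "\<epsilon> \<in> indices L 1"
    "\<And>a b. length a = 1 \<Longrightarrow> length b = 1 \<Longrightarrow> near U \<epsilon> a b \<Longrightarrow> near U \<epsilon>1 a b \<and> near U \<epsilon>3 a b"
    using indices_directed[OF \<epsilon>1(1) \<epsilon>3(1)] by metis
  obtain js where js: "length js = d" "\<forall>i<d. near U \<epsilon> [c ! i] [b (js ! i)]"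
    using Ccl_range_near_distinct[OF \<epsilon>(1), of c] c by (auto simp: tuples_def simp del: near.simps)
  define c' where "c' = map b js"
  have c': "c' \<in> tuples d (range b)" using js(1) by (auto simp: c'_def tuples_def)
  then have c'U: "c' \<in> tuples d (hdom U)" "c' \<in> tuples d (A \<union> range b)"
    using w by (auto simp: tuples_def witnessing_def)
  have n1: "near U \<epsilon>1 [(y # c) ! i] [(y # c') ! i]" and n2: "near U \<epsilon>2 [(y # c') ! i] [(y # c) ! i]"
    if "i < Suc d" for y i
  proof -
    have "near U \<epsilon>1 [(y # c) ! i] [(y # c') ! i] \<and> near U \<epsilon>3 [(y # c) ! i] [(y # c') ! i]"
    proof (cases i)
      case 0
      then show ?thesis using near_refl[OF \<epsilon>1(1)] near_refl[OF \<epsilon>3(1)] by simp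
    next
      case (Suc v)
      then show ?thesis using that js \<epsilon>(2)[of "[c ! v]" "[c' ! v]"] by (simp add: c'_def)
    qed
    then show "near U \<epsilon>1 [(y # c) ! i] [(y # c') ! i]" "near U \<epsilon>2 [(y # c') ! i] [(y # c) ! i]"
      using \<epsilon>3(2,3) near_refl[OF \<epsilon>3(1)] by blast+
  qed
  have "\<not> sat U (x # c') [] \<phi>1"
    using \<epsilon>2(2) n2 xc[OF x(1) cU] xc[OF x(1) c'U(1)] \<phi>2(2) by blast
  then obtain j where j: "\<not> sat U (b j # c') [] \<phi>1"
    using w c1 c'U(2) x(1) unfolding witnessing_def by blast
  have bj: "b j \<in> hdom U" using w by (auto simp: witnessing_def)
  have "\<not> sat U (b j # c) [] \<phi>"
    using \<epsilon>1(2) n1 xc[OF bj cU] xc[OF bj c'U(1)] j by blast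
  then show ?thesis using Ccl_range_superset by blast
qed

text \<open>The value \<open>y\<close> of the function solves \<open>\<not> \<nu>(x, f(a))\<close>,
  whose parameters are the arguments in \<open>M\<close>. The test then finds solutions in
  \<open>M\<close>, so \<open>y\<close> is a limit of elements of \<open>M\<close> and hence of the
  sequence.\<close>

lemma Ccl_range_hclosed: "hclosed L U M"
  unfolding hclosed_def
proof (intro ballI)
  fix f a assume f: "f \<in> hfuns L" and a: "a \<in> tuples (hfun_ar L f) M"
  define k where "k = hfun_ar L f"
  define y where "y = hfun U f a"
  have aU: "a \<in> tuples k (hdom U)" using a Ccl_range_hdom by (auto simp: tuples_def k_def)
  then have y: "y \<in> hdom U"
    using standard f unfolding standard_structure_def hclosed_def y_def k_def by blast
  have "\<exists>z\<in>range b. near U \<epsilon> [y] [z]" if \<epsilon>: "\<epsilon> \<in> indices L 1" for \<epsilon>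
  proof -
    obtain \<epsilon>1 where \<epsilon>1: "\<epsilon>1 \<in> indices L 1" "\<And>a b. near U \<epsilon>1 a b \<Longrightarrow> near U \<epsilon>1 b a"
      "\<And>a b c. near U \<epsilon>1 a b \<Longrightarrow> near U \<epsilon>1 b c \<Longrightarrow> near U \<epsilon> a c"
      using indices_half[OF \<epsilon>] by metis
    obtain \<nu> :: "('f, 'r, 'g, 'm, 's) pform" and \<epsilon>0 where
      \<nu>: "continuous_form L {} (1 + 1) 0 \<nu>" "\<epsilon>0 \<in> indices L 1"
      "\<And>a b. length a = 1 \<Longrightarrow> length b = 1 \<Longrightarrow> \<not> sat U (a @ b) [] \<nu> \<Longrightarrow> near U \<epsilon>1 a b"
      "\<And>a b. length a = 1 \<Longrightarrow> length b = 1 \<Longrightarrow> near U \<epsilon>0 a b \<Longrightarrow> \<not> sat U (a @ b) [] \<nu>"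
      using far_form[OF \<epsilon>1(1)] by metis
    \<comment> \<open>The second variable of \<nu> is replaced by the term for \<open>f\<close>
      applied to variables \<open>1\<close> to \<open>k\<close>, which hold
      \<open>a\<close>.\<close>
    define \<sigma> :: "nat \<Rightarrow> ('f, 'm) hterm" where
      "\<sigma> = case_nat (HVar 0) (\<lambda>_. HApp f (map (\<lambda>i. HVar (Suc i)) [0..<k]))"
    have c: "continuous_form L {} (Suc k) 0 (psub \<sigma> Inl \<nu>)"
      by (rule continuous_form_psub[OF \<nu>(1)]) (use f in \<open>auto simp: \<sigma>_def k_def less_Suc_eq_0_disj\<close>)
    have "map (heval U (z # a) \<circ> (\<lambda>i. HVar (Suc i))) [0..<k] = a" for z
      using aU by (intro nth_equalityI) (auto simp: tuples_def)
    then have sat: "sat U (z # a) [] (psub \<sigma> Inl \<nu>) \<longleftrightarrow> sat U ([z] @ [y]) [] \<nu>" for z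
      by (intro sat_psub[OF \<nu>(1)]) (auto simp: \<sigma>_def less_Suc_eq_0_disj y_def)
    have "\<not> sat U (y # a) [] (psub \<sigma> Inl \<nu>)"
      unfolding sat using \<nu>(4)[of "[y]" "[y]"] near_refl[OF \<nu>(2)] by simp
    then obtain z where z: "z \<in> M" "\<not> sat U (z # a) [] (psub \<sigma> Inl \<nu>)"
      using Ccl_range_witness[OF c _ y] a unfolding k_def by blast
    then have "near U \<epsilon>1 [y] [z]" using \<nu>(3)[of "[z]" "[y]"] \<epsilon>1(2) unfolding sat by simp
    moreover obtain j where "near U \<epsilon>1 [z] [b j]" using Ccl_range_near[OF z(1) \<epsilon>1(1)] by blast
    ultimately show ?thesis using \<epsilon>1(3) by blast
  qed
  then show "hfun U f a \<in> M" using y by (simp add: M_def Ccl_iff y_def)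
qed

text \<open>Only the universal home quantifier needs an argument: a counterexample in
  \<open>U\<close> yields one in \<open>M\<close> by \<open>Ccl_range_witness\<close>.\<close>

lemma Ccl_range_reflects:
  "continuous_form L {} n m \<phi> \<Longrightarrow> a \<in> tuples n M \<Longrightarrow> s \<in> tuples m UNIV \<Longrightarrow>
    sat (U\<lparr>hdom := M\<rparr>) a s \<phi> \<Longrightarrow> sat U a s \<phi>"
proof (induction \<phi> arbitrary: n m a s)
  case (AllH \<phi>)
  have \<phi>: "continuous_form L {} (Suc n) m \<phi>" using AllH.prems by simp
  show ?case
  proof (rule ccontr)
    assume "\<not> sat U a s (AllH \<phi>)"
    then obtain x where x: "x \<in> hdom U" "\<not> sat U (x # a) s \<phi>" by auto
    \<comment> \<open>The witness lemma has no variables of sort \<open>S\<close>; the points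
      \<open>s\<close> are turned into constants.\<close>
    define \<phi>' where "\<phi>' = psub HVar (\<lambda>i. Inr (s ! i)) \<phi>"
    have \<phi>': "continuous_form L {} (Suc n) 0 \<phi>'"
      unfolding \<phi>'_def by (rule continuous_form_psub[OF \<phi>]) auto
    have sat: "sat U a' [] \<phi>' \<longleftrightarrow> sat U a' s \<phi>" for a'
      unfolding \<phi>'_def by (rule sat_psub[OF \<phi>]) auto
    obtain y where y: "y \<in> M" "\<not> sat U (y # a) s \<phi>"
      using Ccl_range_witness[OF \<phi>' AllH.prems(2) x(1)] x(2) unfolding sat by blast
    have "y # a \<in> tuples (Suc n) M" using y(1) AllH.prems(2) by (auto simp: tuples_def)
    then show False using AllH.IH[OF \<phi> _ AllH.prems(3)] y AllH.prems(4) by auto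
  qed
next
  case (ExH \<phi>)
  have \<phi>: "continuous_form L {} (Suc n) m \<phi>" using ExH.prems by simp
  obtain y where y: "y \<in> M" "sat (U\<lparr>hdom := M\<rparr>) (y # a) s \<phi>" using ExH.prems by auto
  have "y # a \<in> tuples (Suc n) M" using y(1) ExH.prems(2) by (auto simp: tuples_def)
  then show ?case using ExH.IH[OF \<phi> _ ExH.prems(3) y(2)] y(1) Ccl_range_hdom by auto
next
  case (AllS \<phi>)
  have "x # s \<in> tuples (Suc m) UNIV" for x using AllS.prems(3) by (auto simp: tuples_def)
  then have "sat U a (x # s) \<phi>" for x
    using AllS.IH[of n "Suc m" a "x # s"] AllS.prems by auto
  then show ?case by simp
next
  case (ExS \<phi>)
  obtain x where x: "sat (U\<lparr>hdom := M\<rparr>) a (x # s) \<phi>" using ExS.prems by auto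
  have "x # s \<in> tuples (Suc m) UNIV" using ExS.prems(3) by (auto simp: tuples_def)
  then have "sat U a (x # s) \<phi>"
    using ExS.IH[of n "Suc m" a "x # s"] ExS.prems x by auto
  then show ?case by auto
next
  case (And \<phi> \<psi>)
  then show ?case using And.IH(1)[of n m a s] And.IH(2)[of n m a s] by simp
next
  case (Or \<phi> \<psi>)
  then show ?case using Or.IH(1)[of n m a s] Or.IH(2)[of n m a s] by auto
next
  case (In ts C)
  have "map (seval (U\<lparr>hdom := M\<rparr>) a s) ts = map (seval U a s) ts" by simp
  then show ?case using In.prems(4) by (simp only: sat.simps)
qed simp

lemma Ccl_range_c_model: "c_model L U M"
  unfolding c_model_def using Ccl_range_hdom Ccl_range_hclosed Ccl_range_reflects by blast

text \<open>A realization in the closure would be a limit of tuples \<open>map b js\<close> with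
  distinct indices, and one of these would then be \<epsilon>-near to it, against
  \<open>om\<close>.\<close>

lemma Ccl_range_omits:
  assumes \<epsilon>: "\<epsilon> \<in> indices L n"
    and om: "\<And>js. distinct js \<Longrightarrow> length js = n \<Longrightarrow>
      \<forall>a\<in>tuples n (hdom U). realizes U a p \<longrightarrow> \<not> near U \<epsilon> (map b js) a"
  shows "\<not> (\<exists>a\<in>tuples n (Ccl L U M). realizes U a p)"
proof
  assume "\<exists>a\<in>tuples n (Ccl L U M). realizes U a p"
  then obtain a where a: "a \<in> tuples n M" "realizes U a p" using Ccl_range_Ccl by (auto simp: tuples_def)
  then have aU: "a \<in> tuples n (hdom U)" using Ccl_range_hdom by (auto simp: tuples_def)
  obtain \<epsilon>0 where \<epsilon>0: "\<epsilon>0 \<in> indices L n"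
    and w0: "weakening (near_form n \<epsilon>0 :: ('f, 'r, 'g, 'm, 's) pform) (near_form n \<epsilon>)"
    using near_form_weakening[OF \<epsilon>] .
  \<comment> \<open>Entries are approximated by indices for single elements, while
    \<open>\<epsilon>\<close> compares whole \<open>n\<close>-tuples. Uniform continuity of nearness
    itself bridges the two: start from the pair \<open>(a, a)\<close> and move its first half
    only.\<close>
  obtain \<epsilon>1 where \<epsilon>1: "\<epsilon>1 \<in> indices L 1"
    "\<forall>a\<in>tuples (n + n) (hdom U). \<forall>a'\<in>tuples (n + n) (hdom U). (\<forall>i<n + n. near U \<epsilon>1 [a ! i] [a' ! i]) \<longrightarrow>
      sat U a [] (near_form n \<epsilon>0 :: ('f, 'r, 'g, 'm, 's) pform) \<longrightarrow> sat U a' [] (near_form n \<epsilon>)"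
    using uniform_continuity[OF w0 continuous_near_form[OF \<epsilon>0]] by blast
  obtain js where js: "distinct js" "length js = n" "\<forall>i<n. near U \<epsilon>1 [a ! i] [b (js ! i)]"
    using Ccl_range_near_distinct[OF \<epsilon>1(1), of a] a(1) by (auto simp: tuples_def simp del: near.simps)
  have bj: "map b js \<in> tuples n (hdom U)" using js(2) w by (auto simp: tuples_def witnessing_def)
  have len: "length a = n" using a(1) by (rule tuples_length)
  have "near U \<epsilon>1 [(a @ a) ! i] [(map b js @ a) ! i]" if "i < n + n" for i
    using js near_refl[OF \<epsilon>1(1)] that len by (simp add: nth_append del: near.simps)
  moreover have "sat U (a @ a) [] (near_form n \<epsilon>0 :: ('f, 'r, 'g, 'm, 's) pform)"
    using sat_near_form[OF \<epsilon>0 len len] near_refl[OF \<epsilon>0] by blast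
  ultimately have "sat U (map b js @ a) [] (near_form n \<epsilon> :: ('f, 'r, 'g, 'm, 's) pform)"
    using \<epsilon>1(2) tuples_append[OF aU aU] tuples_append[OF bj aU] by blast
  then have "near U \<epsilon> (map b js) a" using sat_near_form[OF \<epsilon>, of "map b js" a] len js(2) by simp
  then show False using om[OF js(1,2)] aU a(2) by blast
qed

end

text \<open>A sequence generic for the witness requirements \<open>Ws\<close> and the omission
  requirements \<open>Oms\<close> is fed into the results on its closure. Requirements for the
  countable set \<open>\<H>\<close> extend to all continuous formulas by c-density.\<close>

lemma omitting_types:
  assumes \<H>: "countable \<H>" "\<forall>\<psi>\<in>\<H>. \<exists>k m. continuous_form L {} k m \<psi>" "c_dense L (Th L U) \<H>"
    and A: "A \<subseteq> hdom U" "countable A" and p: "\<forall>\<phi>\<in>p. continuous_form L A n 0 \<phi>"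
    and iso: "\<not> approx_c_isolated L U n p A"
  shows "\<exists>M. c_model L U M \<and> A \<subseteq> M \<and> \<not> (\<exists>a\<in>tuples n (Ccl L U M). realizes U a p)"
proof -
  obtain \<epsilon> where \<epsilon>: "\<epsilon> \<in> indices L n"
    and ni: "\<And>\<theta>. continuous_form L A n 0 \<theta> \<Longrightarrow> \<exists>b\<in>tuples n (hdom U). \<not> sat U b [] \<theta> \<Longrightarrow>
      \<exists>b\<in>tuples n (hdom U). \<not> sat U b [] \<theta> \<and> (\<forall>a\<in>tuples n (hdom U). realizes U a p \<longrightarrow> \<not> near U \<epsilon> b a)"
    using not_isolated_uniform[OF iso] by metis
  define W where "W = (\<lambda>(N, \<psi>, c) b. (\<forall>x\<in>hdom U. sat U (x # map (case_sum id b) c) [] \<psi>) \<or>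
    (\<exists>j\<ge>N::nat. \<not> sat U (b j # map (case_sum id b) c) [] \<psi>))"
  define Ws where "Ws = {(N :: nat, \<psi>, c). \<psi> \<in> \<H> \<and> set c \<subseteq> A <+> (UNIV :: nat set) \<and> continuous_form L {} (Suc (length c)) 0 \<psi>}"
  define Om where "Om = (\<lambda>(js :: nat list) b. \<forall>a\<in>tuples n (hdom U). realizes U a p \<longrightarrow> \<not> near U \<epsilon> (map b js) a)"
  define Oms where "Oms = {js :: nat list. distinct js \<and> length js = n}"
  have "countable ((UNIV :: nat set) \<times> \<H> \<times> lists (A <+> (UNIV :: nat set)))"
    using \<H>(1) A(2) by (intro countable_SIGMA countable_lists countable_Plus) auto
  then have "countable Ws"
    by (rule countable_subset[rotated]) (auto simp: Ws_def)
  then have "countable (W ` Ws \<union> Om ` Oms)" by auto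
  \<comment> \<open>\<open>generic_sequence\<close> enumerates its family, which must therefore be
    nonempty.\<close>
  moreover have "[0..<n] \<in> Oms" by (simp add: Oms_def)
  then have "W ` Ws \<union> Om ` Oms \<noteq> {}" by blast
  moreover have "dense_open A G" if "G \<in> W ` Ws \<union> Om ` Oms" for G
    using that
  proof
    assume "G \<in> W ` Ws"
    then obtain N \<psi> c where "G = W (N, \<psi>, c)" "set c \<subseteq> A <+> UNIV" "continuous_form L {} (Suc (length c)) 0 \<psi>"
      by (auto simp: Ws_def)
    then show ?thesis unfolding W_def using dense_open_witness[OF A(1)] by simp
  next
    assume "G \<in> Om ` Oms"
    then obtain js where "G = Om js" "distinct js" "length js = n" by (auto simp: Oms_def)
    then show ?thesis
      unfolding Om_def using dense_open_omit[OF A(2,1) p \<epsilon> ni, of js] by blast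
  qed
  ultimately obtain b where b: "range b \<subseteq> hdom U" "\<And>G. G \<in> W ` Ws \<union> Om ` Oms \<Longrightarrow> G b"
    using generic_sequence[OF A(2,1)] by metis
  have "witnessing A b"
    unfolding witnessing_def
  proof (intro conjI allI impI b(1))
    fix d \<phi> c x N
    assume \<phi>: "continuous_form L {} (Suc d) 0 \<phi>" and c: "c \<in> tuples d (A \<union> range b)"
      and x: "x \<in> hdom U" "\<not> sat U (x # c) [] \<phi>"
    have xU: "y # c \<in> tuples (Suc d) (hdom U)" if "y \<in> hdom U" for y
      using that c Un_least[OF A(1) b(1)] unfolding tuples_def by auto
    \<comment> \<open>The margin for c-density: with \<psi> between \<phi> and
      \<open>\<phi>'\<close>, the element \<open>x\<close> refutes \<psi>, and whatever refutes
      \<psi> refutes \<phi>.\<close>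
    obtain \<phi>' where \<phi>': "weakening \<phi> \<phi>'" "\<not> sat U (x # c) [] \<phi>'"
      using weakening_separates[OF _ _ \<phi> xU[OF x(1)] _ x(2)] by auto
    have "standard_model L (Th L U) U"
      using standard by (simp add: standard_model_def Th_def)
    then obtain \<psi> where \<psi>: "\<psi> \<in> \<H>" "positive L {} (Suc d) 0 \<psi>"
      "\<And>a. a \<in> tuples (Suc d) (hdom U) \<Longrightarrow> (sat U a [] \<phi> \<longrightarrow> sat U a [] \<psi>) \<and> (sat U a [] \<psi> \<longrightarrow> sat U a [] \<phi>')"
      using \<H>(3) \<phi> \<phi>'(1) unfolding c_dense_def by metis
    \<comment> \<open>c-density bounds the free variables of \<psi>, membership in
      \<open>\<H>\<close> excludes \<open>Rel\<close>.\<close>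
    have \<psi>c: "continuous_form L {} (Suc d) 0 \<psi>"
      using \<psi>(1,2) \<H>(2) by (auto simp: continuous_form_def)
    have "\<forall>y\<in>set c. \<exists>u\<in>A <+> UNIV. y = case_sum id b u"
    proof
      fix y assume "y \<in> set c"
      then consider "y \<in> A" | j where "y = b j" using c by (auto simp: tuples_def)
      then show "\<exists>u\<in>A <+> UNIV. y = case_sum id b u"
        by cases (auto intro: bexI[of _ "Inl y"] bexI[of _ "Inr _"])
    qed
    \<comment> \<open>Once \<open>b\<close> is fixed, every parameter receives a name, so that one
      of the countably many requirements applies.\<close>
    then obtain g where g: "\<forall>y\<in>set c. g y \<in> A <+> UNIV \<and> y = case_sum id b (g y)" by metis
    define c' where "c' = map g c"
    have c': "set c' \<subseteq> A <+> UNIV" "map (case_sum id b) c' = c" "length c' = d"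
      using g c by (auto simp: c'_def tuples_def map_idI o_def)
    then have "(N, \<psi>, c') \<in> Ws" using \<psi>(1) \<psi>c by (simp add: Ws_def)
    then have "W (N, \<psi>, c') b" using b(2) by blast
    then have "(\<forall>x\<in>hdom U. sat U (x # c) [] \<psi>) \<or> (\<exists>j\<ge>N. \<not> sat U (b j # c) [] \<psi>)"
      by (simp add: W_def c'(2))
    moreover have "\<not> sat U (x # c) [] \<psi>" using \<psi>(3)[OF xU[OF x(1)]] \<phi>'(2) by blast
    ultimately obtain j where "j \<ge> N" "\<not> sat U (b j # c) [] \<psi>" using x(1) by blast
    moreover have "b j \<in> hdom U" using b(1) by auto
    ultimately show "\<exists>j\<ge>N. \<not> sat U (b j # c) [] \<phi>" using \<psi>(3)[OF xU] by blast
  qed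
  moreover have "\<forall>a\<in>tuples n (hdom U). realizes U a p \<longrightarrow> \<not> near U \<epsilon> (map b js) a"
    if "distinct js" "length js = n" for js
  proof -
    have "Om js b" using b(2) that by (auto simp: Oms_def)
    then show ?thesis by (simp add: Om_def)
  qed
  ultimately show ?thesis
    using Ccl_range_c_model[OF _ A(1)] Ccl_range_superset[OF _ A(1)] Ccl_range_omits[OF _ A(1) \<epsilon>] by (metis le_sup_iff)
qed

end

theorem theorem9p7:
  fixes L :: "('f, 'r, 'g) lang"
    and U :: "('f, 'r, 'g, 'm, 's::t2_space) struct"
    and A :: "'m set"
    and n :: nat
    and p :: "('f, 'r, 'g, 'm, 's) pform set"
  assumes "compact (UNIV :: 's set)"
    and "standard_structure L U"
    and "uncountable (hdom U)"
    and "p_saturated L U"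
    and "\<exists>\<H>. countable \<H> \<and> (\<forall>\<psi>\<in>\<H>. \<exists>k m. continuous_form L {} k m \<psi>) \<and>
           c_dense L (Th L U) \<H>"
    and "A \<subseteq> hdom U"
    and "countable A"
    and "\<forall>\<phi>\<in>p. continuous_form L A n 0 \<phi>"
    and "\<not> approx_c_isolated L U n p A"
  shows "\<exists>M. c_model L U M \<and> A \<subseteq> M \<and>
           \<not> (\<exists>a\<in>tuples n (Ccl L U M). realizes U a p)"
proof -
  interpret saturated_structure L U
    by unfold_locales (use assms in auto)
  show ?thesis using omitting_types assms by blast
qed

end
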